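(* Let $\mathcal{A}$ be an exact $C^*$-algebra, let $G$ be a locally compact group, and let $(\mathcal{A},G,\alpha)$ be a $C^*$-dynamical system. Let $g\in G$ be a fixed element for which the identity $e$ of $G$ has a basis of compact $g$-invariant neighborhoods. Then $$ht_{\mathcal{A}}(\alpha_g)\le ht_{\mathcal{A}\times_\alpha G}(Ad_{\lambda_g}).$$
   Context: A set $N\subseteq G$ is $g$-invariant if $gNg^{-1}=N$. A $C^*$-dynamical system $(\mathcal{A},G,\alpha)$ consists of a $C^*$-algebra $\mathcal{A}$, a locally compact group $G$ and a homomorphism $\alpha\colon G\to\mathrm{Aut}(\mathcal{A})$, $t\mapsto\alpha_t$, such that $t\mapsto\alpha_t(a)$ is norm continuous for each $a\in\mathcal{A}$. Reduced crossed product: let $\pi\colon\mathcal{A}\to B(H)$ be a faithful representation (regard $\mathcal{A}\subseteq B(H)$). On $L^2(G,H)$ put $(\tilde\pi(a)\xi)(t)=\alpha_{t^{-1}}(a)(\xi(t))$ and $(\lambda_s\xi)(t)=\xi(s^{-1}t)$. Then $\lambda_s\tilde\pi(a)\lambda_{s^{-1}}=\tilde\pi(\alpha_s(a))$. The reduced crossed product, denoted here $\mathcal{A}\times_\alpha G$, is the $C^*$-algebra given by the norm closed span of the operators $\int_G f(s)\tilde\pi(a)\lambda_s\,ds$, $a\in\mathcal{A}$, $f\in C_c(G)$ ($ds$ a fixed left Haar measure); it is independent of the choice of $\pi$. $Ad_{\lambda_g}$ is the automorphism $x\mapsto\lambda_g x\lambda_g^*$ of $\mathcal{A}\times_\alpha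 G$. Topological entropy: let $\mathcal{B}\subseteq B(K)$ be a faithfully represented $C^*$-algebra and $\beta\in\mathrm{Aut}(\mathcal{B})$. For finite $\omega\subseteq\mathcal{B}$ and $\delta>0$, $rcp(\omega,\delta)$ is the smallest integer $m$ (and $+\infty$ if none exists) for which there are completely positive contractions $\phi\colon\mathcal{B}\to\mathbb{M}_m$ and $\psi\colon\mathbb{M}_m\to B(K)$ with $\|\psi(\phi(b))-b\|<\delta$ for all $b\in\omega$. Put $ht(\beta,\omega,\delta)=\limsup_{n\to\infty}\frac1n\log rcp\big(\bigcup_{i=0}^{n-1}\beta^i(\omega),\delta\big)$, $ht(\beta,\omega)=\sup_{\delta>0}ht(\beta,\omega,\delta)$ and $ht_{\mathcal{B}}(\beta)=\sup_\omega ht(\beta,\omega)$ (supremum over finite $\omega\subseteq\mathcal{B}$). This does not depend on the faithful representation. An equal quantity is obtained if completely positive contractions are replaced by complete contractions throughout. *)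

theory Defs
  imports "HOL-Analysis.Analysis" "Jordan_Normal_Form.Matrix"
begin

section \<open>Complex Hilbert spaces and C*-algebras\<close>

class complex_vector_space = real_vector +
  fixes scaleC :: "complex \<Rightarrow> 'a \<Rightarrow> 'a"  (infixr \<open>*\<^sub>C\<close> 75)
  assumes scaleC_add_right: "c *\<^sub>C (x + y) = c *\<^sub>C x + c *\<^sub>C y"
    and scaleC_add_left: "(c + d) *\<^sub>C x = c *\<^sub>C x + d *\<^sub>C x"
    and scaleC_scaleC: "c *\<^sub>C d *\<^sub>C x = (c * d) *\<^sub>C x"
    and scaleR_scaleC: "r *\<^sub>R x = complex_of_real r *\<^sub>C x"

text \<open>The inner product \<open>cinner\<close> is linear in its first argument; the norm and the
  topology are those of the underlying real inner product \<open>inner\<close>.\<close>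

class complex_hilbert_space = complex_vector_space + real_inner + banach +
  fixes cinner :: "'a \<Rightarrow> 'a \<Rightarrow> complex"
  assumes cinner_add_left: "cinner (x + y) z = cinner x z + cinner y z"
    and cinner_scaleC_left: "cinner (c *\<^sub>C x) y = c * cinner x y"
    and cinner_commute: "cinner x y = cnj (cinner y x)"
    and inner_eq_Re_cinner: "inner x y = Re (cinner x y)"

text \<open>A C*-algebra is not required to have a unit.\<close>

class cstar_algebra = complex_vector_space + real_normed_algebra + banach +
  fixes star :: "'a \<Rightarrow> 'a"
  assumes norm_scaleC: "norm (c *\<^sub>C x) = cmod c * norm x"
    and mult_scaleC_left: "(c *\<^sub>C x) * y = c *\<^sub>C (x * y)"
    and mult_scaleC_right: "x * (c *\<^sub>C y) = c *\<^sub>C (x * y)"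
    and star_add: "star (x + y) = star x + star y"
    and star_scaleC: "star (c *\<^sub>C x) = cnj c *\<^sub>C star x"
    and star_mult: "star (x * y) = star y * star x"
    and star_star: "star (star x) = x"
    and norm_star_mult_self: "norm (star x * x) = (norm x)\<^sup>2"

lemma scaleC_one: "1 *\<^sub>C x = (x :: 'a::complex_vector_space)"
  using scaleR_scaleC[of 1 x] by simp

lemma scaleC_zero_right: "c *\<^sub>C 0 = (0 :: 'a::complex_vector_space)"
  using scaleC_add_right[of c 0 "0::'a"] by simp

lemma scaleC_minus_right: "c *\<^sub>C (- x) = - (c *\<^sub>C x :: 'a::complex_vector_space)"
  using scaleC_add_right[of c x "-x"] scaleC_zero_right[of c, where 'a='a]
  by (metis add.inverse_unique add.right_inverse)

lemma scaleC_diff_right: "c *\<^sub>C (x - y) = c *\<^sub>C x - (c *\<^sub>C y :: 'a::complex_vector_space)"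
  using scaleC_add_right[of c x "-y"] by (simp add: scaleC_minus_right)

lemma scaleC_scaleR: "c *\<^sub>C (r *\<^sub>R x) = r *\<^sub>R (c *\<^sub>C (x :: 'a::complex_vector_space))"
  by (simp add: scaleR_scaleC scaleC_scaleC mult.commute)

lemma cinner_add_right: "cinner x (y + z) = cinner x y + cinner x (z :: 'a::complex_hilbert_space)"
  by (subst (1 2 3) cinner_commute) (simp add: cinner_add_left)

lemma cinner_scaleC_right: "cinner x (c *\<^sub>C y) = cnj c * cinner x (y :: 'a::complex_hilbert_space)"
  by (subst (1 2) cinner_commute) (simp add: cinner_scaleC_left)

lemma Im_cinner: "Im (cinner x y) = inner x (\<i> *\<^sub>C (y :: 'a::complex_hilbert_space))"
  by (simp add: inner_eq_Re_cinner cinner_scaleC_right)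

lemma Im_cinner': "Im (cinner x y) = - inner (\<i> *\<^sub>C x) (y :: 'a::complex_hilbert_space)"
  by (simp add: inner_eq_Re_cinner cinner_scaleC_left)

lemma cinner_eq_Complex:
  "cinner x y = Complex (inner x y) (inner x (\<i> *\<^sub>C (y :: 'a::complex_hilbert_space)))"
  by (simp add: complex_eq_iff inner_eq_Re_cinner cinner_scaleC_right)

lemma cinner_self: "cinner x x = complex_of_real ((norm (x :: 'a::complex_hilbert_space))\<^sup>2)"
proof -
  have "cinner x x = cnj (cinner x x)" by (rule cinner_commute)
  then have "Im (cinner x x) = 0" by (simp add: complex_eq_iff)
  then show ?thesis
    by (simp add: complex_eq_iff power2_norm_eq_inner inner_eq_Re_cinner)
qed

lemma hilbert_norm_scaleC: "norm (c *\<^sub>C x) = cmod c * norm (x :: 'a::complex_hilbert_space)"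
proof -
  have "complex_of_real ((norm (c *\<^sub>C x))\<^sup>2) = c * cnj c * cinner x x"
    by (simp only: cinner_self[symmetric] cinner_scaleC_left cinner_scaleC_right ac_simps)
  also have "\<dots> = complex_of_real ((cmod c * norm x)\<^sup>2)"
    using complex_norm_square[of c] by (simp add: cinner_self power_mult_distrib)
  finally have "(norm (c *\<^sub>C x))\<^sup>2 = (cmod c * norm x)\<^sup>2"
    using of_real_eq_iff by blast
  then show ?thesis by (simp add: power2_eq_iff_nonneg)
qed

lemma bounded_linear_scaleC: "bounded_linear (\<lambda>x :: 'a::complex_hilbert_space. c *\<^sub>C x)"
  by (rule bounded_linear_intro[where K="cmod c"])
    (simp_all add: scaleC_add_right scaleC_scaleR hilbert_norm_scaleC)

lemma cmod_cinner_le: "cmod (cinner x y) \<le> norm x * norm (y :: 'a::complex_hilbert_space)"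
proof -
  define c where "c = cnj (sgn (cinner x y))"
  have "c * cinner x y = complex_of_real (cmod (cinner x y))"
  proof (cases "cinner x y = 0")
    case False
    have "c * cinner x y = cinner x y * cnj (cinner x y) / complex_of_real (cmod (cinner x y))"
      by (simp add: c_def sgn_eq)
    also have "\<dots> = complex_of_real (cmod (cinner x y))"
      using False unfolding complex_norm_square[symmetric] by (simp add: power2_eq_square)
    finally show ?thesis .
  qed (simp add: c_def)
  then have "cmod (cinner x y) = Re (c * cinner x y)" by simp
  also have "\<dots> = inner (c *\<^sub>C x) y"
    by (simp add: inner_eq_Re_cinner cinner_scaleC_left)
  also have "\<dots> \<le> norm (c *\<^sub>C x) * norm y" by (rule norm_cauchy_schwarz)
  also have "\<dots> \<le> norm x * norm y"
    by (intro mult_right_mono) (simp_all add: hilbert_norm_scaleC c_def norm_sgn)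
  finally show ?thesis .
qed

lemma riesz_real:
  fixes f :: "'a::{real_inner, complete_space} \<Rightarrow> real"
  assumes "bounded_linear f"
  shows "\<exists>y. \<forall>x. f x = inner x y"
proof -
  interpret f: bounded_linear f by fact
  obtain K where K: "\<And>x. \<bar>f x\<bar> \<le> norm x * K" using f.bounded by auto
  define F where "F x = (norm x)\<^sup>2 - 2 * f x" for x
  have lb: "F x \<ge> - K\<^sup>2" for x
  proof -
    have "f x \<le> norm x * K" using K[of x] by simp
    moreover have "0 \<le> (norm x - K)\<^sup>2" by simp
    ultimately show ?thesis by (simp add: F_def power2_eq_square algebra_simps)
  qed
  define m where "m = Inf (range F)"
  have bdd: "bdd_below (range F)" using lb by (auto intro!: bdd_belowI)
  have m_le: "m \<le> F x" for x unfolding m_def using bdd by (auto intro: cInf_lower)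
  have "\<exists>x. F x < m + 1 / real (Suc n)" for n
  proof -
    have "Inf (range F) < m + 1 / real (Suc n)" by (simp add: m_def)
    then show ?thesis using cInf_lessD[of "range F"] by blast
  qed
  then obtain X where X: "\<And>n. F (X n) < m + 1 / real (Suc n)" by metis
  have par: "(norm (x - y))\<^sup>2 \<le> 2 * (F x + F y - 2 * m)" for x y
  proof -
    have "(norm (x - y))\<^sup>2 = 2 * (F x + F y - 2 * F ((1/2) *\<^sub>R (x + y)))"
      by (simp add: F_def f.scaleR f.add power_divide power2_norm_eq_inner
          inner_add_left inner_add_right inner_diff_left inner_diff_right inner_commute)
        (simp add: field_simps)?
    then show ?thesis using m_le[of "(1/2) *\<^sub>R (x + y)"] by simp
  qed
  have "Cauchy X"
  proof (rule metric_CauchyI)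
    fix e :: real assume "e > 0"
    then have "0 < e\<^sup>2 / 4" by simp
    then obtain N where "1 / real (Suc N) < e\<^sup>2 / 4" using nat_approx_posE by blast
    then have N: "4 / real (Suc N) < e\<^sup>2" by simp
    have "dist (X n) (X k) < e" if "n \<ge> N" "k \<ge> N" for n k
    proof -
      have *: "1 / real (Suc n) \<le> 1 / real (Suc N)" "1 / real (Suc k) \<le> 1 / real (Suc N)"
        using that by (auto intro!: divide_left_mono)
      have "(norm (X n - X k))\<^sup>2 \<le> 2 * (F (X n) + F (X k) - 2 * m)" by (rule par)
      also have "\<dots> < e\<^sup>2" using X[of n] X[of k] * N by simp
      finally show ?thesis using \<open>e > 0\<close> by (simp add: dist_norm power_less_imp_less_base)
    qed
    then show "\<exists>M. \<forall>m\<ge>M. \<forall>n\<ge>M. dist (X m) (X n) < e" by blast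
  qed
  then obtain y where y: "X \<longlonglongrightarrow> y" using Cauchy_convergent convergent_def by blast
  have "(\<lambda>n. F (X n)) \<longlonglongrightarrow> F y"
    unfolding F_def by (intro tendsto_intros y f.tendsto)
  moreover have "(\<lambda>n. m + 1 / real (Suc n)) \<longlonglongrightarrow> m + 0"
    by (intro tendsto_intros LIMSEQ_inverse_real_of_nat[unfolded inverse_eq_divide])
  ultimately have "F y \<le> m + 0"
    by (rule LIMSEQ_le) (use less_imp_le[OF X] in blast)
  then have Fy: "F y \<le> m" by simp
  have "f x = inner x y" for x
  proof -
    define b where "b = inner y x - f x"
    have q: "0 \<le> 2 * t * b + t\<^sup>2 * (norm x)\<^sup>2" for t
    proof -
      have "(norm (y + t *\<^sub>R x))\<^sup>2 = (norm y)\<^sup>2 + 2 * t * inner y x + t\<^sup>2 * (norm x)\<^sup>2"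
        unfolding power2_norm_eq_inner
        by (simp add: inner_add_left inner_add_right inner_commute power2_eq_square)
      moreover have "F y \<le> F (y + t *\<^sub>R x)" using Fy m_le order_trans by blast
      moreover have "F (y + t *\<^sub>R x) = (norm (y + t *\<^sub>R x))\<^sup>2 - 2 * f y - 2 * (t * f x)"
        by (simp add: F_def f.add f.scaleR)
      moreover have "2 * t * b = 2 * t * inner y x - 2 * (t * f x)"
        unfolding b_def by (simp only: right_diff_distrib mult.assoc)
      ultimately show ?thesis by (simp add: F_def)
    qed
    have "b = 0"
    proof (cases "x = 0")
      case True
      then show ?thesis by (simp add: b_def f.zero)
    next
      case False
      define N where "N = (norm x)\<^sup>2"
      have N: "N > 0" using False by (simp add: N_def)
      have "0 \<le> 2 * (- b / N) * b + (- b / N)\<^sup>2 * N" using q unfolding N_def .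
      also have "\<dots> = - (b\<^sup>2 / N)"
        using N by (simp add: power2_eq_square)
      finally have "b\<^sup>2 / N \<le> 0" by simp
      then have "b\<^sup>2 \<le> 0" using N by (simp add: divide_le_0_iff)
      then show ?thesis by simp
    qed
    then show ?thesis by (simp add: b_def inner_commute)
  qed
  then show ?thesis by blast
qed

section \<open>The C*-algebra of bounded operators on a Hilbert space\<close>

typedef (overloaded) 'h bop =
  "{f :: 'h \<Rightarrow> 'h::complex_hilbert_space. bounded_linear f \<and> (\<forall>c x. f (c *\<^sub>C x) = c *\<^sub>C f x)}"
  morphisms bop_apply Bop
  by (rule exI[of _ "\<lambda>x. 0"]) (simp add: scaleC_zero_right)

setup_lifting type_definition_bop

lemma bounded_linear_bop_apply: "bounded_linear (bop_apply T)"
  using bop_apply[of T] by simp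

lemma bop_apply_scaleC: "bop_apply T (c *\<^sub>C x) = c *\<^sub>C bop_apply T x"
  using bop_apply[of T] by simp

lemma bop_eqI: "(\<And>x. bop_apply S x = bop_apply T x) \<Longrightarrow> S = T"
  by (simp add: bop_apply_inject[symmetric] fun_eq_iff)

instantiation bop :: (complex_hilbert_space) real_normed_algebra
begin

lift_definition zero_bop :: "'a bop" is "\<lambda>x. 0" by (simp add: scaleC_zero_right)
lift_definition plus_bop :: "'a bop \<Rightarrow> 'a bop \<Rightarrow> 'a bop" is "\<lambda>f g x. f x + g x"
  by (simp add: bounded_linear_add scaleC_add_right)
lift_definition minus_bop :: "'a bop \<Rightarrow> 'a bop \<Rightarrow> 'a bop" is "\<lambda>f g x. f x - g x"
  by (simp add: bounded_linear_sub scaleC_diff_right)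
lift_definition uminus_bop :: "'a bop \<Rightarrow> 'a bop" is "\<lambda>f x. - f x"
  by (simp add: bounded_linear_minus scaleC_minus_right)
lift_definition scaleR_bop :: "real \<Rightarrow> 'a bop \<Rightarrow> 'a bop" is "\<lambda>r f x. r *\<^sub>R f x"
  by (simp add: bounded_linear_compose[OF bounded_linear_scaleR_right] scaleC_scaleR)
lift_definition times_bop :: "'a bop \<Rightarrow> 'a bop \<Rightarrow> 'a bop" is "\<lambda>f g x. f (g x)"
  by (simp add: bounded_linear_compose)
lift_definition norm_bop :: "'a bop \<Rightarrow> real" is onorm .

definition dist_bop :: "'a bop \<Rightarrow> 'a bop \<Rightarrow> real" where "dist_bop S T = norm (S - T)"
definition sgn_bop :: "'a bop \<Rightarrow> 'a bop" where "sgn_bop T = scaleR (inverse (norm T)) T"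
definition uniformity_bop :: "('a bop \<times> 'a bop) filter" where
  "uniformity_bop = (INF e\<in>{0<..}. principal {(x, y). dist x y < e})"
definition open_bop :: "'a bop set \<Rightarrow> bool" where
  "open_bop U = (\<forall>x\<in>U. \<forall>\<^sub>F (x', y) in uniformity. x' = x \<longrightarrow> y \<in> U)"

instance
proof
  fix S T U :: "'a bop" and r s :: real
  show "S + T + U = S + (T + U)" "S + T = T + S" "0 + S = S" "- S + S = 0" "S - T = S + - T"
    by (transfer; simp add: algebra_simps)+
  show "r *\<^sub>R (S + T) = r *\<^sub>R S + r *\<^sub>R T" "(r + s) *\<^sub>R S = r *\<^sub>R S + s *\<^sub>R S"
    "r *\<^sub>R s *\<^sub>R S = (r * s) *\<^sub>R S" "1 *\<^sub>R S = S"
    by (transfer; simp add: algebra_simps)+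
  show "S * T * U = S * (T * U)" "(S + T) * U = S * U + T * U"
    by (transfer; simp)+
  show "S * (T + U) = S * T + S * U"
    by transfer (simp add: linear_add bounded_linear.linear)
  show "r *\<^sub>R S * T = r *\<^sub>R (S * T)" by transfer simp
  show "S * r *\<^sub>R T = r *\<^sub>R (S * T)"
    by transfer (simp add: linear_scale bounded_linear.linear)
  show "dist S T = norm (S - T)" by (simp add: dist_bop_def)
  show "sgn S = inverse (norm S) *\<^sub>R S" by (simp add: sgn_bop_def)
  show "uniformity = (INF e\<in>{0<..}. principal {(x, y :: 'a bop). dist x y < e})"
    by (simp add: uniformity_bop_def)
  fix A :: "'a bop set"
  show "open A = (\<forall>x\<in>A. \<forall>\<^sub>F (x', y) in uniformity. x' = x \<longrightarrow> y \<in> A)"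
    by (simp add: open_bop_def)
next
  fix S T :: "'a bop" and r :: real
  show "(norm S = 0) = (S = 0)" by transfer (simp add: onorm_eq_0 fun_eq_iff)
  show "norm (S + T) \<le> norm S + norm T" by transfer (simp add: onorm_triangle)
  show "norm (r *\<^sub>R S) = \<bar>r\<bar> * norm S" by transfer (simp add: onorm_scaleR)
  show "norm (S * T) \<le> norm S * norm T"
    by transfer (use onorm_compose in \<open>auto simp: o_def\<close>)
qed

end

lemma norm_bop_apply_le: "norm (bop_apply T x) \<le> norm T * norm x"
  by transfer (simp add: onorm)

lemma norm_bop_bound: "(\<And>x. norm (bop_apply T x) \<le> b * norm x) \<Longrightarrow> 0 \<le> b \<Longrightarrow> norm T \<le> b"
  by transfer (auto intro: onorm_bound)

instance bop :: (complex_hilbert_space) banach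
proof
  fix X :: "nat \<Rightarrow> 'a bop"
  assume X: "Cauchy X"
  have bl: "bounded_linear (bop_apply (T :: 'a bop))" for T
    by (rule bounded_linear_bop_apply)
  have d: "dist (Blinfun (bop_apply S)) (Blinfun (bop_apply T)) = dist S T" for S T :: "'a bop"
    unfolding dist_norm norm_bop.rep_eq norm_blinfun.rep_eq minus_blinfun.rep_eq minus_bop.rep_eq
    by (simp add: bounded_linear_Blinfun_apply bl)
  have "Cauchy (\<lambda>n. Blinfun (bop_apply (X n)))"
    using X by (simp add: Cauchy_def d)
  then have "convergent (\<lambda>n. Blinfun (bop_apply (X n)))" by (rule Cauchy_convergent)
  then obtain L where L: "(\<lambda>n. Blinfun (bop_apply (X n))) \<longlonglongrightarrow> L"
    unfolding convergent_def ..
  have lim: "(\<lambda>n. bop_apply (X n) x) \<longlonglongrightarrow> blinfun_apply L x" for x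
  proof -
    have "(\<lambda>n. blinfun_apply (Blinfun (bop_apply (X n))) x) \<longlonglongrightarrow> blinfun_apply L x"
      by (rule blinfun.tendsto[OF L tendsto_const])
    then show ?thesis by (simp add: bounded_linear_Blinfun_apply bl)
  qed
  have "blinfun_apply L (c *\<^sub>C x) = c *\<^sub>C blinfun_apply L x" for c x
  proof (rule LIMSEQ_unique)
    show "(\<lambda>n. bop_apply (X n) (c *\<^sub>C x)) \<longlonglongrightarrow> blinfun_apply L (c *\<^sub>C x)" by (rule lim)
    show "(\<lambda>n. bop_apply (X n) (c *\<^sub>C x)) \<longlonglongrightarrow> c *\<^sub>C blinfun_apply L x"
      unfolding bop_apply_scaleC by (rule bounded_linear.tendsto[OF bounded_linear_scaleC lim])
  qed
  then have T: "bop_apply (Bop (blinfun_apply L)) = blinfun_apply L"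
    by (intro Bop_inverse) (simp add: blinfun.bounded_linear_right)
  have "X \<longlonglongrightarrow> Bop (blinfun_apply L)"
    using L unfolding lim_sequentially d[symmetric] T by (simp add: blinfun_apply_inverse)
  then show "convergent X" by (auto simp: convergent_def)
qed

instantiation bop :: (complex_hilbert_space) complex_vector_space
begin

lift_definition scaleC_bop :: "complex \<Rightarrow> 'a bop \<Rightarrow> 'a bop" is "\<lambda>c f x. c *\<^sub>C f x"
  by (simp add: bounded_linear_compose[OF bounded_linear_scaleC] scaleC_scaleC mult.commute)

instance
  by standard (transfer; simp add: scaleC_add_right scaleC_add_left scaleC_scaleC scaleR_scaleC)+

end

lemma cinner_eqI:
  fixes u v :: "'h::complex_hilbert_space"
  assumes "\<And>x. cinner x u = cinner x v"
  shows "u = v"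
proof -
  have "inner (u - v) (u - v) = 0"
    unfolding inner_diff_right[of "u - v"] by (simp only: inner_eq_Re_cinner assms)
  then show ?thesis by simp
qed

lemma ex_adjoint: "\<exists>S :: 'h::complex_hilbert_space bop. \<forall>x y. cinner (bop_apply T x) y = cinner x (bop_apply S y)"
proof -
  interpret T: bounded_linear "bop_apply T" by (rule bounded_linear_bop_apply)
  have "\<exists>z. \<forall>x. inner (bop_apply T x) y = inner x z" for y
    by (rule riesz_real)
      (intro bounded_linear_compose[OF bounded_linear_inner_left bounded_linear_bop_apply])
  then obtain S where S: "\<And>x y. inner (bop_apply T x) y = inner x (S y)" by metis
  have cS: "cinner (bop_apply T x) y = cinner x (S y)" for x y
    by (simp add: complex_eq_iff Im_cinner' S flip: inner_eq_Re_cinner bop_apply_scaleC)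
  have add: "S (x + y) = S x + S y" for x y
    by (rule cinner_eqI) (simp add: cinner_add_right flip: cS)
  have sc: "S (c *\<^sub>C x) = c *\<^sub>C S x" for c x
    by (rule cinner_eqI) (simp add: cinner_scaleC_right flip: cS)
  have nS: "norm (S y) \<le> norm y * norm T" for y
  proof -
    have "norm (S y) * norm (S y) = inner (bop_apply T (S y)) y"
      by (simp add: S norm_eq_sqrt_inner)
    also have "\<dots> \<le> norm (bop_apply T (S y)) * norm y" by (rule norm_cauchy_schwarz)
    also have "\<dots> \<le> norm (S y) * (norm y * norm T)"
      using mult_right_mono[OF norm_bop_apply_le[of T "S y"] norm_ge_zero[of y]]
      by (simp add: ac_simps)
    finally show ?thesis by (cases "S y = 0") auto
  qed
  have "bounded_linear S"
    by (rule bounded_linear_intro[where K="norm T"])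
      (simp_all add: add nS sc scaleR_scaleC)
  then have "bop_apply (Bop S) = S" by (intro Bop_inverse) (simp add: sc)
  then show ?thesis using cS by metis
qed

instantiation bop :: (complex_hilbert_space) cstar_algebra
begin

definition star_bop :: "'a bop \<Rightarrow> 'a bop" where
  "star_bop T = (THE S. \<forall>x y. cinner (bop_apply T x) y = cinner x (bop_apply S y))"

lemma cinner_star_bop: "cinner x (bop_apply (star T) y) = cinner (bop_apply T x) (y :: 'a)"
proof -
  have "\<exists>!S. \<forall>x y. cinner (bop_apply T x) y = cinner x (bop_apply S y)"
  proof (rule ex_ex1I)
    fix R S :: "'a bop"
    assume *: "\<forall>x y. cinner (bop_apply T x) y = cinner x (bop_apply R y)"
      "\<forall>x y. cinner (bop_apply T x) y = cinner x (bop_apply S y)"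
    show "R = S"
      by (rule bop_eqI, rule cinner_eqI) (use * in metis)
  qed (rule ex_adjoint)
  then have "\<forall>x y. cinner (bop_apply T x) y = cinner x (bop_apply (star T) y)"
    unfolding star_bop_def by (rule theI')
  from this[rule_format, of x y] show ?thesis by (rule sym)
qed

lemma cinner_star_bop': "cinner (bop_apply (star T) x) y = cinner x (bop_apply T (y :: 'a))"
proof -
  have "cinner (bop_apply (star T) x) y = cnj (cinner y (bop_apply (star T) x))"
    by (rule cinner_commute)
  also have "\<dots> = cnj (cinner (bop_apply T y) x)" by (simp only: cinner_star_bop)
  also have "\<dots> = cinner x (bop_apply T y)" by (rule cinner_commute[symmetric])
  finally show ?thesis .
qed

lemma star_bop_eqI:
  "(\<And>x y. cinner x (bop_apply S y) = cinner (bop_apply T x) (y :: 'a)) \<Longrightarrow> star T = S"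
  by (rule bop_eqI, rule cinner_eqI) (simp add: cinner_star_bop)

instance
proof
  fix S T :: "'a bop" and c :: complex
  show sc: "norm (c *\<^sub>C S) = cmod c * norm S" for c :: complex and S :: "'a bop"
  proof -
    have le: "norm (c *\<^sub>C S) \<le> cmod c * norm S" for c :: complex and S :: "'a bop"
      by (rule norm_bop_bound)
        (simp_all add: scaleC_bop.rep_eq hilbert_norm_scaleC mult.assoc mult_left_mono norm_bop_apply_le)
    show ?thesis
    proof (cases "c = 0")
      case True
      have "0 *\<^sub>C S = 0" using scaleR_scaleC[of 0 S] by simp
      then show ?thesis using True by simp
    next
      case False
      have "S = inverse c *\<^sub>C c *\<^sub>C S" using False by (simp add: scaleC_scaleC scaleC_one)
      then have "norm S \<le> cmod (inverse c) * norm (c *\<^sub>C S)" by (metis le)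
      then have "cmod c * norm S \<le> cmod c * (cmod (inverse c) * norm (c *\<^sub>C S))"
        by (rule mult_left_mono) simp
      also have "\<dots> = norm (c *\<^sub>C S)" using False by (simp flip: mult.assoc norm_mult)
      finally have "cmod c * norm S \<le> norm (c *\<^sub>C S)" .
      then show ?thesis using le[of c S] by simp
    qed
  qed
  show "(c *\<^sub>C S) * T = c *\<^sub>C (S * T)" by transfer simp
  show "S * (c *\<^sub>C T) = c *\<^sub>C (S * T)" by transfer simp
  show "star (S + T) = star S + star T"
    by (rule star_bop_eqI) (simp add: plus_bop.rep_eq cinner_add_left cinner_add_right cinner_star_bop)
  show "star (c *\<^sub>C S) = cnj c *\<^sub>C star S"
    by (rule star_bop_eqI) (simp add: scaleC_bop.rep_eq cinner_scaleC_left cinner_scaleC_right cinner_star_bop)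
  show "star (S * T) = star T * star S"
    by (rule star_bop_eqI) (simp add: times_bop.rep_eq cinner_star_bop)
  show "star (star S) = S"
    by (rule star_bop_eqI) (simp add: cinner_star_bop')
  show "norm (star S * S) = (norm S)\<^sup>2"
  proof (rule antisym)
    have le: "norm T \<le> norm (star T)" for T :: "'a bop"
    proof (rule norm_bop_bound)
      fix x
      have "norm (bop_apply T x) * norm (bop_apply T x) = Re (cinner (bop_apply T x) (bop_apply T x))"
        by (simp add: cinner_self power2_eq_square)
      also have "\<dots> = inner x (bop_apply (star T) (bop_apply T x))"
        by (simp add: cinner_star_bop inner_eq_Re_cinner)
      also have "\<dots> \<le> norm x * norm (bop_apply (star T) (bop_apply T x))" by (rule norm_cauchy_schwarz)
      also have "\<dots> \<le> norm x * (norm (star T) * norm (bop_apply T x))"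
        by (intro mult_left_mono norm_bop_apply_le) simp
      finally show "norm (bop_apply T x) \<le> norm (star T) * norm x"
        by (cases "bop_apply T x = 0") (auto simp: ac_simps)
    qed simp
    have "norm (star S) = norm S"
      using le[of S] le[of "star S"] \<open>star (star S) = S\<close> by simp
    then show "norm (star S * S) \<le> (norm S)\<^sup>2"
      using norm_mult_ineq[of "star S" S] by (simp add: power2_eq_square)
    have "norm S \<le> sqrt (norm (star S * S))"
    proof (rule norm_bop_bound)
      fix x
      have "(norm (bop_apply S x))\<^sup>2 = Re (cinner (bop_apply S x) (bop_apply S x))"
        by (simp add: cinner_self)
      also have "\<dots> = inner x (bop_apply (star S * S) x)"
        by (simp add: cinner_star_bop inner_eq_Re_cinner times_bop.rep_eq)
      also have "\<dots> \<le> norm x * norm (bop_apply (star S * S) x)" by (rule norm_cauchy_schwarz)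
      also have "\<dots> \<le> norm x * (norm (star S * S) * norm x)"
        by (intro mult_left_mono norm_bop_apply_le) simp
      also have "\<dots> = (sqrt (norm (star S * S)) * norm x)\<^sup>2"
        by (simp add: power_mult_distrib) (simp add: power2_eq_square)
      finally show "norm (bop_apply S x) \<le> sqrt (norm (star S * S)) * norm x"
        by (rule power2_le_imp_le) simp
    qed simp
    then have "(norm S)\<^sup>2 \<le> (sqrt (norm (star S * S)))\<^sup>2" by (rule power_mono) simp
    then show "(norm S)\<^sup>2 \<le> norm (star S * S)" by simp
  qed
qed

end


section \<open>Strongly measurable functions\<close>

text \<open>The Hilbert spaces are not assumed separable, hence the condition on the range.\<close>

definition strongly_measurable :: "'a measure \<Rightarrow> ('a \<Rightarrow> 'b::metric_space) \<Rightarrow> bool" where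
  "strongly_measurable M f \<longleftrightarrow>
     f \<in> borel_measurable M \<and> (\<exists>D. countable D \<and> range f \<subseteq> closure D)"

lemma strongly_measurableI_inner:
  fixes f :: "'a \<Rightarrow> 'b::real_inner"
  assumes meas: "\<And>h. (\<lambda>t. inner (f t) h) \<in> borel_measurable M"
    and D: "countable D" "range f \<subseteq> closure D"
  shows "strongly_measurable M f"
proof -
  have cball: "f -` cball c r \<inter> space M \<in> sets M" if r: "r \<ge> 0" for c r
  proof -
    have "f -` cball c r \<inter> space M =
        space M \<inter> (\<Inter>d\<in>D. {t\<in>space M. inner (f t) (d - c) \<le> r * norm (d - c) + inner c (d - c)})"
      (is "?L = ?R")
    proof (intro equalityI subsetI)
      fix t assume t: "t \<in> ?L"
      have "inner (f t - c) (d - c) \<le> r * norm (d - c)" for d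
      proof -
        have "inner (f t - c) (d - c) \<le> norm (f t - c) * norm (d - c)" by (rule norm_cauchy_schwarz)
        also have "\<dots> \<le> r * norm (d - c)"
          using t by (intro mult_right_mono) (auto simp: dist_norm norm_minus_commute)
        finally show ?thesis .
      qed
      then show "t \<in> ?R" using t by (auto simp: inner_diff_left algebra_simps)
    next
      fix t assume t: "t \<in> ?R"
      have "f t \<in> closure D" using D by auto
      then obtain X where X: "\<And>n. X n \<in> D" "X \<longlonglongrightarrow> f t"
        unfolding closure_sequential by blast
      have "(\<lambda>n. inner (f t - c) (X n - c)) \<longlonglongrightarrow> inner (f t - c) (f t - c)"
        "(\<lambda>n. r * norm (X n - c)) \<longlonglongrightarrow> r * norm (f t - c)"
        by (intro tendsto_intros X)+
      then have "inner (f t - c) (f t - c) \<le> r * norm (f t - c)"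
        by (rule LIMSEQ_le) (use t X(1) in \<open>auto simp: inner_diff_left algebra_simps\<close>)
      then have "norm (f t - c) * norm (f t - c) \<le> r * norm (f t - c)"
        by (simp add: power2_norm_eq_inner flip: power2_eq_square)
      then have "norm (f t - c) \<le> r" using r by (cases "norm (f t - c) = 0") auto
      then show "t \<in> ?L" using t by (auto simp: dist_norm norm_minus_commute)
    qed
    also have "\<dots> \<in> sets M"
    proof (cases "D = {}")
      case False
      have "{t\<in>space M. inner (f t) (d - c) \<le> r * norm (d - c) + inner c (d - c)} \<in> sets M" for d
        using meas[of "d - c"] by measurable
      then show ?thesis using D False by (intro sets.Int sets.countable_INT') auto
    qed simp
    finally show ?thesis .
  qed
  have "f \<in> borel_measurable M"
  proof (rule borel_measurableI)
    fix U :: "'b set" assume U: "open U"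
    define I where "I = {(d, n). d \<in> D \<and> cball d (1 / real (Suc n)) \<subseteq> U}"
    have "countable I"
      by (rule countable_subset[of _ "D \<times> UNIV"]) (use D in \<open>auto simp: I_def\<close>)
    have "f -` U \<inter> space M = (\<Union>(d, n)\<in>I. f -` cball d (1 / real (Suc n)) \<inter> space M)"
    proof (intro equalityI subsetI)
      fix t assume t: "t \<in> f -` U \<inter> space M"
      then obtain e where e: "e > 0" "cball (f t) e \<subseteq> U" using U open_contains_cball by blast
      then obtain n where n: "1 / real (Suc n) < e / 2" using nat_approx_posE[of "e/2"] by auto
      have "f t \<in> closure D" using D by auto
      then obtain d where d: "d \<in> D" "dist d (f t) < 1 / real (Suc n)"
        unfolding closure_approachable by (metis zero_less_divide_1_iff of_nat_0_less_iff zero_less_Suc)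
      have "cball d (1 / real (Suc n)) \<subseteq> cball (f t) e"
      proof
        fix x assume "x \<in> cball d (1 / real (Suc n))"
        then have "dist d x \<le> 1 / real (Suc n)" by simp
        then show "x \<in> cball (f t) e"
          using d n dist_triangle[of "f t" x d] by (simp add: dist_commute)
      qed
      then have "(d, n) \<in> I" using e d by (auto simp: I_def)
      moreover have "t \<in> f -` cball d (1 / real (Suc n)) \<inter> space M" using d t by simp
      ultimately show "t \<in> (\<Union>(d, n)\<in>I. f -` cball d (1 / real (Suc n)) \<inter> space M)" by blast
    qed (auto simp: I_def)
    also have "\<dots> \<in> sets M"
      using \<open>countable I\<close> by (intro sets.countable_UN') (auto intro!: cball)
    finally show "f -` U \<inter> space M \<in> sets M" .
  qed
  then show ?thesis using D by (auto simp: strongly_measurable_def)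
qed

lemma strongly_measurable_const: "strongly_measurable M (\<lambda>t. c)"
  unfolding strongly_measurable_def by (auto intro!: exI[of _ "{c}"])

lemma strongly_measurable_image:
  assumes f: "strongly_measurable M f" and \<phi>: "continuous_on UNIV \<phi>"
  shows "strongly_measurable M (\<lambda>t. \<phi> (f t))"
proof -
  obtain D where D: "countable D" "range f \<subseteq> closure D" and m: "f \<in> borel_measurable M"
    using f by (auto simp: strongly_measurable_def)
  have "\<phi> ` closure D \<subseteq> closure (\<phi> ` D)"
    by (rule image_closure_subset) (auto intro: continuous_on_subset[OF \<phi>] closure_subset[THEN subsetD])
  then have "range (\<lambda>t. \<phi> (f t)) \<subseteq> closure (\<phi> ` D)" using D by auto
  moreover have "(\<lambda>t. \<phi> (f t)) \<in> borel_measurable M"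
    using measurable_compose[OF m borel_measurable_continuous_onI[OF \<phi>]] .
  ultimately show ?thesis using D by (auto simp: strongly_measurable_def)
qed

lemma strongly_measurable_add:
  fixes f g :: "'a \<Rightarrow> 'b::real_inner"
  assumes f: "strongly_measurable M f" and g: "strongly_measurable M g"
  shows "strongly_measurable M (\<lambda>t. f t + g t)"
proof -
  obtain D where D: "countable D" "range f \<subseteq> closure D" and mf: "f \<in> borel_measurable M"
    using f by (auto simp: strongly_measurable_def)
  obtain E where E: "countable E" "range g \<subseteq> closure E" and mg: "g \<in> borel_measurable M"
    using g by (auto simp: strongly_measurable_def)
  have m: "(\<lambda>t. inner (f t) h) \<in> borel_measurable M" if "f \<in> borel_measurable M" for f :: "'a \<Rightarrow> 'b" and h
    by (rule measurable_compose[OF that borel_measurable_continuous_onI]) (intro continuous_intros)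
  show ?thesis
  proof (rule strongly_measurableI_inner)
    show "(\<lambda>t. inner (f t + g t) h) \<in> borel_measurable M" for h
      unfolding inner_add_left by (intro borel_measurable_add m mf mg)
    show "countable ((\<lambda>(x, y). x + y) ` (D \<times> E))" using D E by simp
    have "continuous_on (closure (D \<times> E)) (\<lambda>(x, y). x + y)"
      by (auto intro!: continuous_intros simp: case_prod_beta)
    then have "(\<lambda>(x, y). x + y) ` closure (D \<times> E) \<subseteq> closure ((\<lambda>(x, y). x + y) ` (D \<times> E))"
      by (rule image_closure_subset) (rule closed_closure, rule closure_subset)
    moreover have "(f t, g t) \<in> closure (D \<times> E)" for t
      using D(2) E(2) by (auto simp: closure_Times)
    ultimately have "(\<lambda>(x, y). x + y) (f t, g t) \<in> closure ((\<lambda>(x, y). x + y) ` (D \<times> E))" for t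
      by (rule subsetD[OF _ imageI])
    then show "range (\<lambda>t. f t + g t) \<subseteq> closure ((\<lambda>(x, y). x + y) ` (D \<times> E))"
      by auto
  qed
qed

lemma strongly_measurable_lim:
  assumes f: "\<And>n. strongly_measurable M (f n)" and lim: "\<And>t. (\<lambda>n. f n t) \<longlonglongrightarrow> g t"
  shows "strongly_measurable M g"
proof -
  obtain D where D: "\<And>n. countable (D n)" "\<And>n. range (f n) \<subseteq> closure (D n)"
    and m: "\<And>n. f n \<in> borel_measurable M"
    using f unfolding strongly_measurable_def by metis
  have "g \<in> borel_measurable M" by (rule borel_measurable_LIMSEQ_metric[OF m lim])
  moreover have "range g \<subseteq> closure (\<Union>n. D n)"
  proof clarify
    fix t
    have "f n t \<in> closure (\<Union>n. D n)" for n
      using D(2)[of n] closure_mono[of "D n" "\<Union>n. D n"] by blast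
    then show "g t \<in> closure (\<Union>n. D n)"
      using closed_sequentially[OF closed_closure _ lim] by blast
  qed
  moreover have "countable (\<Union>n. D n)" using D(1) by simp
  ultimately show ?thesis unfolding strongly_measurable_def by (intro conjI exI)
qed

lemma strongly_measurable_indicator:
  fixes f :: "'a \<Rightarrow> 'b::real_inner"
  assumes f: "strongly_measurable M f" and A: "A \<in> sets M"
  shows "strongly_measurable M (\<lambda>t. indicat_real A t *\<^sub>R f t)"
proof -
  obtain D where D: "countable D" "range f \<subseteq> closure D" and mf: "f \<in> borel_measurable M"
    using f by (auto simp: strongly_measurable_def)
  show ?thesis
  proof (rule strongly_measurableI_inner)
    have m: "(\<lambda>t. inner (f t) h) \<in> borel_measurable M" for h
      by (rule measurable_compose[OF mf borel_measurable_continuous_onI]) (intro continuous_intros)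
    show "(\<lambda>t. inner (indicat_real A t *\<^sub>R f t) h) \<in> borel_measurable M" for h
      unfolding inner_scaleR_left using A by (intro borel_measurable_times m) simp
    show "countable (insert 0 D)" using D by simp
    have "f t \<in> closure D" for t using D by auto
    then show "range (\<lambda>t. indicat_real A t *\<^sub>R f t) \<subseteq> closure (insert 0 D)"
      by (auto simp: closure_insert indicator_def)
  qed
qed

lemma borel_measurable_norm_strongly:
  "strongly_measurable M f \<Longrightarrow> (\<lambda>t. norm (f t :: 'b::real_normed_vector)) \<in> borel_measurable M"
  unfolding strongly_measurable_def by auto

lemma borel_measurable_inner_strongly:
  fixes f g :: "'a \<Rightarrow> 'b::real_inner"
  assumes f: "strongly_measurable M f" and g: "strongly_measurable M g"
  shows "(\<lambda>t. inner (f t) (g t)) \<in> borel_measurable M"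
proof -
  have "strongly_measurable M (\<lambda>t. - g t)"
    by (rule strongly_measurable_image[OF g]) (intro continuous_intros)
  from strongly_measurable_add[OF f this] strongly_measurable_add[OF f g]
  have "(\<lambda>t. ((norm (f t + g t))\<^sup>2 - (norm (f t + - g t))\<^sup>2) / 4) \<in> borel_measurable M"
    by (intro borel_measurable_divide borel_measurable_diff borel_measurable_power
        borel_measurable_norm_strongly) auto
  moreover have "((norm (f t + g t))\<^sup>2 - (norm (f t + - g t))\<^sup>2) / 4 = inner (f t) (g t)" for t
    by (simp add: power2_norm_eq_inner inner_add_left inner_add_right inner_diff_left
        inner_diff_right inner_commute)
  ultimately show ?thesis by simp
qed

lemma borel_measurable_cinner_strongly:
  fixes f g :: "'a \<Rightarrow> 'b::complex_hilbert_space"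
  assumes f: "strongly_measurable M f" and g: "strongly_measurable M g"
  shows "(\<lambda>t. cinner (f t) (g t)) \<in> borel_measurable M"
proof -
  have "strongly_measurable M (\<lambda>t. \<i> *\<^sub>C g t)"
    by (rule strongly_measurable_image[OF g])
      (rule bounded_linear.continuous_on[OF bounded_linear_scaleC continuous_on_id])
  then show ?thesis
    unfolding borel_measurable_complex_iff cinner_eq_Complex
    using borel_measurable_inner_strongly[OF f] g by simp
qed


section \<open>Square-integrable vector-valued functions\<close>

definition square_integrable :: "'a measure \<Rightarrow> ('a \<Rightarrow> 'b::real_normed_vector) set" where
  "square_integrable M =
     {f. strongly_measurable M f \<and> (\<integral>\<^sup>+ t. ennreal ((norm (f t))\<^sup>2) \<partial>M) < \<infinity>}"

lemma square_integrable_zero: "(\<lambda>t. 0) \<in> square_integrable M"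
  by (simp add: square_integrable_def strongly_measurable_const)

lemma square_integrable_add:
  fixes f g :: "'a \<Rightarrow> 'b::real_inner"
  assumes f: "f \<in> square_integrable M" and g: "g \<in> square_integrable M"
  shows "(\<lambda>t. f t + g t) \<in> square_integrable M"
proof -
  have sm: "strongly_measurable M f" "strongly_measurable M g"
    using f g by (auto simp: square_integrable_def)
  note [measurable] = sm[THEN borel_measurable_norm_strongly]
  have le: "(norm (f t + g t))\<^sup>2 \<le> 2 * (norm (f t))\<^sup>2 + 2 * (norm (g t))\<^sup>2" for t
  proof -
    have "(norm (f t + g t))\<^sup>2 \<le> (norm (f t) + norm (g t))\<^sup>2"
      by (intro power_mono norm_triangle_ineq) simp
    also have "\<dots> \<le> 2 * (norm (f t))\<^sup>2 + 2 * (norm (g t))\<^sup>2"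
      using sum_squares_bound[of "norm (f t)" "norm (g t)"] by (simp add: power2_sum)
    finally show ?thesis .
  qed
  have "(\<integral>\<^sup>+ t. ennreal ((norm (f t + g t))\<^sup>2) \<partial>M)
      \<le> (\<integral>\<^sup>+ t. 2 * ennreal ((norm (f t))\<^sup>2) + 2 * ennreal ((norm (g t))\<^sup>2) \<partial>M)"
  proof (rule nn_integral_mono)
    fix t
    have "ennreal ((norm (f t + g t))\<^sup>2) \<le> ennreal (2 * (norm (f t))\<^sup>2 + 2 * (norm (g t))\<^sup>2)"
      by (rule ennreal_leI[OF le])
    then show "ennreal ((norm (f t + g t))\<^sup>2) \<le> 2 * ennreal ((norm (f t))\<^sup>2) + 2 * ennreal ((norm (g t))\<^sup>2)"
      by (simp add: ennreal_mult)
  qed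
  also have "\<dots> = 2 * (\<integral>\<^sup>+ t. ennreal ((norm (f t))\<^sup>2) \<partial>M) + 2 * (\<integral>\<^sup>+ t. ennreal ((norm (g t))\<^sup>2) \<partial>M)"
    by (simp add: nn_integral_add nn_integral_cmult)
  also have "\<dots> < \<infinity>" using f g by (auto simp: square_integrable_def ennreal_mult_less_top)
  finally show ?thesis using strongly_measurable_add[OF sm] by (simp add: square_integrable_def)
qed

lemma square_integrable_bounded_linear:
  fixes f :: "'a \<Rightarrow> 'b::real_normed_vector" and \<phi> :: "'b \<Rightarrow> 'c::real_normed_vector"
  assumes f: "f \<in> square_integrable M" and \<phi>: "bounded_linear \<phi>"
  shows "(\<lambda>t. \<phi> (f t)) \<in> square_integrable M"
proof -
  have sm: "strongly_measurable M f" using f by (auto simp: square_integrable_def)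
  note [measurable] = sm[THEN borel_measurable_norm_strongly]
  obtain K where K: "K \<ge> 0" "\<And>x. norm (\<phi> x) \<le> norm x * K"
    using bounded_linear.nonneg_bounded[OF \<phi>] by blast
  have "(\<integral>\<^sup>+ t. ennreal ((norm (\<phi> (f t)))\<^sup>2) \<partial>M) \<le> (\<integral>\<^sup>+ t. ennreal (K\<^sup>2) * ennreal ((norm (f t))\<^sup>2) \<partial>M)"
  proof (rule nn_integral_mono)
    fix t
    have "(norm (\<phi> (f t)))\<^sup>2 \<le> (norm (f t) * K)\<^sup>2" by (intro power_mono K) simp
    then have "ennreal ((norm (\<phi> (f t)))\<^sup>2) \<le> ennreal (K\<^sup>2 * (norm (f t))\<^sup>2)"
      by (intro ennreal_leI) (simp add: power_mult_distrib mult.commute)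
    then show "ennreal ((norm (\<phi> (f t)))\<^sup>2) \<le> ennreal (K\<^sup>2) * ennreal ((norm (f t))\<^sup>2)"
      by (simp add: ennreal_mult)
  qed
  also have "\<dots> = ennreal (K\<^sup>2) * (\<integral>\<^sup>+ t. ennreal ((norm (f t))\<^sup>2) \<partial>M)"
    by (simp add: nn_integral_cmult)
  also have "\<dots> < \<infinity>" using f by (auto simp: square_integrable_def ennreal_mult_less_top)
  finally show ?thesis
    using strongly_measurable_image[OF sm linear_continuous_on[OF \<phi>]] by (simp add: square_integrable_def)
qed

lemma square_integrable_diff:
  fixes f g :: "'a \<Rightarrow> 'b::real_inner"
  assumes f: "f \<in> square_integrable M" and g: "g \<in> square_integrable M"
  shows "(\<lambda>t. f t - g t) \<in> square_integrable M"
  using square_integrable_add[OF f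
      square_integrable_bounded_linear[OF g bounded_linear_minus[OF bounded_linear_ident]]] by simp

lemma integrable_cinner:
  fixes f g :: "'a \<Rightarrow> 'b::complex_hilbert_space"
  assumes f: "f \<in> square_integrable M" and g: "g \<in> square_integrable M"
  shows "integrable M (\<lambda>t. cinner (f t) (g t))"
proof (rule integrableI_bounded)
  have sm: "strongly_measurable M f" "strongly_measurable M g"
    using f g by (auto simp: square_integrable_def)
  note [measurable] = sm[THEN borel_measurable_norm_strongly]
  show "(\<lambda>t. cinner (f t) (g t)) \<in> borel_measurable M"
    by (rule borel_measurable_cinner_strongly[OF sm])
  have "(\<integral>\<^sup>+ t. ennreal (cmod (cinner (f t) (g t))) \<partial>M)
      \<le> (\<integral>\<^sup>+ t. ennreal ((norm (f t))\<^sup>2) + ennreal ((norm (g t))\<^sup>2) \<partial>M)"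
  proof (rule nn_integral_mono)
    fix t
    have "cmod (cinner (f t) (g t)) \<le> norm (f t) * norm (g t)" by (rule cmod_cinner_le)
    also have "\<dots> \<le> (norm (f t))\<^sup>2 + (norm (g t))\<^sup>2"
      using sum_squares_bound[of "norm (f t)" "norm (g t)"] mult_nonneg_nonneg[OF norm_ge_zero[of "f t"] norm_ge_zero[of "g t"]]
      by linarith
    finally show "ennreal (cmod (cinner (f t) (g t))) \<le> ennreal ((norm (f t))\<^sup>2) + ennreal ((norm (g t))\<^sup>2)"
      by (simp add: ennreal_leI flip: ennreal_plus)
  qed
  also have "\<dots> = (\<integral>\<^sup>+ t. ennreal ((norm (f t))\<^sup>2) \<partial>M) + (\<integral>\<^sup>+ t. ennreal ((norm (g t))\<^sup>2) \<partial>M)"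
    by (simp add: nn_integral_add)
  also have "\<dots> < \<infinity>" using f g by (auto simp: square_integrable_def)
  finally show "(\<integral>\<^sup>+ t. ennreal (cmod (cinner (f t) (g t))) \<partial>M) < \<infinity>" .
qed

lemma square_integrable_complete:
  fixes x :: "nat \<Rightarrow> 'a \<Rightarrow> 'b::{real_inner, banach}"
  assumes x: "\<And>n. x n \<in> square_integrable M"
    and cauchy: "\<And>e::real. e > 0 \<Longrightarrow> \<exists>N. \<forall>m\<ge>N. \<forall>n\<ge>N. (\<integral>\<^sup>+ t. ennreal ((norm (x m t - x n t))\<^sup>2) \<partial>M) \<le> ennreal e"
  shows "\<exists>y\<in>square_integrable M. \<forall>e>0. \<exists>N. \<forall>n\<ge>N. (\<integral>\<^sup>+ t. ennreal ((norm (x n t - y t))\<^sup>2) \<partial>M) \<le> ennreal e"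
proof -
  have sm: "strongly_measurable M (x n)" for n using x by (auto simp: square_integrable_def)
  have smd: "strongly_measurable M (\<lambda>t. x m t - x n t)" for m n
    using square_integrable_diff[OF x x] by (auto simp: square_integrable_def)
  note [measurable] = smd[THEN borel_measurable_norm_strongly]
  have "\<exists>N. \<forall>m\<ge>N. \<forall>n\<ge>N. (\<integral>\<^sup>+ t. ennreal ((norm (x m t - x n t))\<^sup>2) \<partial>M) \<le> ennreal ((1/4)^j)" for j :: nat
    by (rule cauchy) simp
  then obtain N where N: "\<And>j m n. m \<ge> N j \<Longrightarrow> n \<ge> N j \<Longrightarrow>
      (\<integral>\<^sup>+ t. ennreal ((norm (x m t - x n t))\<^sup>2) \<partial>M) \<le> ennreal ((1/4)^j)"
    by metis
  define K where "K j = (\<Sum>i\<le>j. N i) + j" for j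
  have K: "K j \<ge> N j" "K j \<ge> j" "K (Suc j) \<ge> N j" for j
    by (simp_all add: K_def lessThan_Suc_atMost[symmetric])
  define d where "d j t = norm (x (K (Suc j)) t - x (K j) t)" for j t
  have [measurable]: "d j \<in> borel_measurable M" for j unfolding d_def by measurable
  define S where "S t = (\<Sum>j. ennreal (2^j * (d j t)\<^sup>2))" for t
  have [measurable]: "S \<in> borel_measurable M" unfolding S_def by measurable
  have "(\<integral>\<^sup>+ t. S t \<partial>M) = (\<Sum>j. \<integral>\<^sup>+ t. ennreal (2^j * (d j t)\<^sup>2) \<partial>M)"
    unfolding S_def by (rule nn_integral_suminf) measurable
  also have "\<dots> \<le> (\<Sum>j. ennreal ((1/2)^j))"
  proof (intro suminf_le summableI)
    fix j
    have "(\<integral>\<^sup>+ t. ennreal (2^j * (d j t)\<^sup>2) \<partial>M) = ennreal (2^j) * (\<integral>\<^sup>+ t. ennreal ((d j t)\<^sup>2) \<partial>M)"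
      by (subst nn_integral_cmult[symmetric]) (auto simp: ennreal_mult)
    also have "\<dots> \<le> ennreal (2^j) * ennreal ((1/4)^j)"
      unfolding d_def by (intro mult_left_mono N K) simp
    also have "\<dots> = ennreal ((1/2)^j)"
      by (simp add: ennreal_mult[symmetric] power_mult_distrib[symmetric])
    finally show "(\<integral>\<^sup>+ t. ennreal (2^j * (d j t)\<^sup>2) \<partial>M) \<le> ennreal ((1/2)^j)" .
  qed
  also have "\<dots> = ennreal (\<Sum>j. (1/2)^j)"
    by (rule suminf_ennreal2) (auto intro: summable_geometric)
  also have "\<dots> < \<infinity>" by simp
  finally have "(\<integral>\<^sup>+ t. S t \<partial>M) \<noteq> \<infinity>" by simp
  then have AE: "AE t in M. S t \<noteq> \<infinity>" by (intro nn_integral_PInf_AE) measurable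
  define A where "A = {t\<in>space M. S t \<noteq> \<infinity>}"
  have A: "A \<in> sets M" unfolding A_def by measurable
  have conv: "convergent (\<lambda>j. x (K j) t)" if "t \<in> A" for t
  proof -
    have fin: "S t \<noteq> \<infinity>" using that by (simp add: A_def)
    define B where "B = enn2real (S t)"
    have S: "S t = ennreal B" using fin by (simp add: B_def less_top)
    have B0: "B \<ge> 0" by (simp add: B_def)
    have B: "2^j * (d j t)\<^sup>2 \<le> B" for j
    proof -
      have "ennreal (2^j * (d j t)\<^sup>2) = (\<Sum>i\<in>{j}. ennreal (2^i * (d i t)\<^sup>2))" by simp
      also have "\<dots> \<le> S t" unfolding S_def by (rule sum_le_suminf[OF summableI]) simp_all
      finally show ?thesis using S B0 by simp
    qed
    have dj: "d j t \<le> sqrt B * (1 / sqrt 2)^j" for j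
    proof (rule power2_le_imp_le)
      have "((1 / sqrt 2)^j)\<^sup>2 = ((1 / sqrt 2)\<^sup>2)^j"
        by (simp only: power_mult[symmetric] mult.commute)
      also have "(1 / sqrt 2)\<^sup>2 = 1 / 2" by (simp add: power_divide)
      finally have "((1 / sqrt 2)^j)\<^sup>2 = (1 / 2)^j" .
      then have "(sqrt B * (1 / sqrt 2)^j)\<^sup>2 = B * (1 / 2)^j"
        unfolding power_mult_distrib real_sqrt_pow2[OF B0] by (rule arg_cong)
      moreover have "(2^j * (d j t)\<^sup>2) * (1 / 2)^j \<le> B * (1 / 2)^j"
        by (rule mult_right_mono[OF B]) simp
      moreover have "(2^j * (d j t)\<^sup>2) * (1 / 2)^j = (d j t)\<^sup>2" by (simp add: power_divide)
      ultimately show "(d j t)\<^sup>2 \<le> (sqrt B * (1 / sqrt 2)^j)\<^sup>2" by (simp only:)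
      show "0 \<le> sqrt B * (1 / sqrt 2)^j" using B0 by simp
    qed
    have "summable (\<lambda>j. sqrt B * (1 / sqrt 2)^j)"
      by (intro summable_mult summable_geometric) simp
    then have "summable (\<lambda>j. x (K (Suc j)) t - x (K j) t)"
      by (rule summable_comparison_test'[where N=0]) (use dj in \<open>simp add: d_def\<close>)
    then have "convergent (\<lambda>n. \<Sum>j<n. x (K (Suc j)) t - x (K j) t)"
      by (simp add: summable_iff_convergent)
    then have "convergent (\<lambda>n. (x (K n) t - x (K 0) t) + x (K 0) t)"
      by (intro convergent_add convergent_const) (simp add: sum_lessThan_telescope[of "\<lambda>j. x (K j) t"])
    then show ?thesis by simp
  qed
  define y where "y t = lim (\<lambda>j. indicat_real A t *\<^sub>R x (K j) t)" for t
  have lim: "(\<lambda>j. indicat_real A t *\<^sub>R x (K j) t) \<longlonglongrightarrow> y t" for t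
    unfolding y_def convergent_LIMSEQ_iff[symmetric]
    using conv[of t] by (cases "t \<in> A") (simp_all add: convergent_const)
  have smy: "strongly_measurable M y"
    by (rule strongly_measurable_lim[OF _ lim]) (rule strongly_measurable_indicator[OF sm A])
  have bound: "(\<integral>\<^sup>+ t. ennreal ((norm (x n t - y t))\<^sup>2) \<partial>M) \<le> ennreal e"
    if n: "\<And>m. m \<ge> n0 \<Longrightarrow> (\<integral>\<^sup>+ t. ennreal ((norm (x n t - x m t))\<^sup>2) \<partial>M) \<le> ennreal e" for n n0 e
  proof -
    have "(\<integral>\<^sup>+ t. ennreal ((norm (x n t - y t))\<^sup>2) \<partial>M)
        = (\<integral>\<^sup>+ t. liminf (\<lambda>j. ennreal ((norm (x n t - x (K j) t))\<^sup>2)) \<partial>M)"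
    proof (rule nn_integral_cong_AE)
      show "AE t in M. ennreal ((norm (x n t - y t))\<^sup>2) = liminf (\<lambda>j. ennreal ((norm (x n t - x (K j) t))\<^sup>2))"
        using AE AE_space
      proof eventually_elim
        case (elim t)
        then have "(\<lambda>j. x (K j) t) \<longlonglongrightarrow> y t" using lim[of t] by (simp add: A_def)
        then have "(\<lambda>j. ennreal ((norm (x n t - x (K j) t))\<^sup>2)) \<longlonglongrightarrow> ennreal ((norm (x n t - y t))\<^sup>2)"
          by (intro tendsto_intros tendsto_ennrealI)
        then show ?case by (rule lim_imp_Liminf[OF sequentially_bot, symmetric])
      qed
    qed
    also have "\<dots> \<le> liminf (\<lambda>j. \<integral>\<^sup>+ t. ennreal ((norm (x n t - x (K j) t))\<^sup>2) \<partial>M)"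
      by (rule nn_integral_liminf) measurable
    also have "\<dots> \<le> limsup (\<lambda>j. \<integral>\<^sup>+ t. ennreal ((norm (x n t - x (K j) t))\<^sup>2) \<partial>M)"
      by (rule Liminf_le_Limsup) simp
    also have "\<dots> \<le> ennreal e"
    proof (rule Limsup_bounded)
      show "\<forall>\<^sub>F j in sequentially. (\<integral>\<^sup>+ t. ennreal ((norm (x n t - x (K j) t))\<^sup>2) \<partial>M) \<le> ennreal e"
        using eventually_ge_at_top[of n0]
        by eventually_elim (use n K(2) order_trans in blast)
    qed
    finally show ?thesis .
  qed
  have smxy: "strongly_measurable M (\<lambda>t. x n t - y t)" for n
  proof -
    have "strongly_measurable M (\<lambda>t. - y t)"
      by (rule strongly_measurable_image[OF smy]) (intro continuous_intros)
    from strongly_measurable_add[OF sm this] show ?thesis by simp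
  qed
  have "y \<in> square_integrable M"
  proof -
    have "(\<lambda>t. x (N 0) t - y t) \<in> square_integrable M"
      using bound[of "N 0" "N 0" "1"] N[of 0 "N 0"] smxy[of "N 0"]
      by (auto simp: square_integrable_def intro: le_less_trans)
    from square_integrable_diff[OF x[of "N 0"] this] show ?thesis by simp
  qed
  moreover have "\<exists>N. \<forall>n\<ge>N. (\<integral>\<^sup>+ t. ennreal ((norm (x n t - y t))\<^sup>2) \<partial>M) \<le> ennreal e" if e: "e > 0" for e
  proof -
    obtain N' where "\<forall>m\<ge>N'. \<forall>n\<ge>N'. (\<integral>\<^sup>+ t. ennreal ((norm (x m t - x n t))\<^sup>2) \<partial>M) \<le> ennreal e"
      using cauchy[OF e] by blast
    then show ?thesis using bound by blast
  qed
  ultimately show ?thesis by blast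
qed


section \<open>Locally compact groups and the Hilbert space of square-integrable functions\<close>

text \<open>A locally compact Hausdorff group together with a fixed left Haar measure \<open>haar\<close>, that is,
  a nonzero left invariant measure on the Borel sets which is finite on compact sets, outer
  regular on Borel sets and inner regular on open sets. Making the measure a class parameter
  allows the Hilbert space of square-integrable functions on the group to be a type.

  The class \<open>topological_group_add\<close> does not include commutativity. The group operation is
  written additively: \<open>s + t\<close> stands for the product \<open>st\<close>, \<open>- s\<close> for the inverse of \<open>s\<close>,
  and \<open>0\<close> for the identity. (The constant \<open>borel\<close> is not available inside a class
  specification; see \<open>sets_haar_borel\<close> below.)\<close>

class locally_compact_group = topological_group_add + t2_space +
  fixes haar :: "'a measure"
  assumes locally_compact_group: "\<exists>U K. open U \<and> x \<in> U \<and> U \<subseteq> K \<and> compact K"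
    and sets_haar: "sets haar = sigma_sets UNIV {U. open U}"
    and haar_nonzero: "emeasure haar UNIV \<noteq> 0"
    and haar_left_invariant: "A \<in> sets haar \<Longrightarrow> emeasure haar ((\<lambda>t. g + t) ` A) = emeasure haar A"
    and haar_compact_finite: "compact K \<Longrightarrow> emeasure haar K < \<infinity>"
    and haar_outer_regular:
      "A \<in> sets haar \<Longrightarrow> emeasure haar A = (INF U\<in>{U. open U \<and> A \<subseteq> U}. emeasure haar U)"
    and haar_inner_regular:
      "open U \<Longrightarrow> emeasure haar U = (SUP K\<in>{K. compact K \<and> K \<subseteq> U}. emeasure haar K)"

lemma sets_haar_borel: "sets (haar :: 'g::locally_compact_group measure) = sets borel"
  by (simp add: sets_haar borel_def)

definition L2_rel :: "('g::locally_compact_group \<Rightarrow> 'h::complex_hilbert_space) \<Rightarrow> ('g \<Rightarrow> 'h) \<Rightarrow> bool" where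
  "L2_rel f g \<longleftrightarrow>
     f \<in> square_integrable haar \<and> g \<in> square_integrable haar \<and> (AE t in haar. f t = g t)"

quotient_type (overloaded) ('g, 'h) L2 =
  "'g::locally_compact_group \<Rightarrow> 'h::complex_hilbert_space" / partial: L2_rel
proof (rule part_equivpI)
  show "\<exists>f. L2_rel f f"
    by (rule exI[of _ "\<lambda>t. 0"]) (simp add: L2_rel_def square_integrable_zero)
  show "symp L2_rel" by (auto simp: symp_def L2_rel_def)
  show "transp L2_rel"
    unfolding transp_def L2_rel_def by (intro allI impI conjI) (auto elim: AE_mp)
qed

lemma L2_relI_bounded_linear:
  "L2_rel f g \<Longrightarrow> bounded_linear \<phi> \<Longrightarrow> L2_rel (\<lambda>t. \<phi> (f t)) (\<lambda>t. \<phi> (g t))"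
  unfolding L2_rel_def by (auto intro: square_integrable_bounded_linear elim: AE_mp)

lemma L2_rel_cinner:
  fixes f f' g g' :: "'g::locally_compact_group \<Rightarrow> 'h::complex_hilbert_space"
  assumes "L2_rel f f'" "L2_rel g g'"
  shows "(LINT t|haar. cinner (f t) (g t)) = (LINT t|haar. cinner (f' t) (g' t))"
proof (rule integral_cong_AE)
  have f: "f \<in> square_integrable haar" "f' \<in> square_integrable haar" "AE t in haar. f t = f' t"
    and g: "g \<in> square_integrable haar" "g' \<in> square_integrable haar" "AE t in haar. g t = g' t"
    using assms by (auto simp: L2_rel_def)
  show "(\<lambda>t. cinner (f t) (g t)) \<in> borel_measurable haar"
    "(\<lambda>t. cinner (f' t) (g' t)) \<in> borel_measurable haar"
    using integrable_cinner[OF f(1) g(1)] integrable_cinner[OF f(2) g(2)] by auto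
  show "AE t in haar. cinner (f t) (g t) = cinner (f' t) (g' t)"
    using f(3) g(3) by eventually_elim simp
qed

lift_definition cinner_L2_fun :: "('g::locally_compact_group, 'h::complex_hilbert_space) L2 \<Rightarrow> ('g, 'h) L2 \<Rightarrow> complex"
  is "\<lambda>f g. LINT t|haar. cinner (f t) (g t)"
  by (rule L2_rel_cinner)

lemma L2_rel_refl: "L2_rel f f \<longleftrightarrow> f \<in> square_integrable haar"
  by (simp add: L2_rel_def)

lemma L2_ex_rep:
  obtains f where "L2_rel f f" "x = abs_L2 f"
  using Quotient_rep_reflp[OF Quotient_L2, of x] Quotient_abs_rep[OF Quotient_L2, of x] by metis

lemma Re_cinner_L2_self:
  fixes f :: "'g::locally_compact_group \<Rightarrow> 'h::complex_hilbert_space"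
  assumes "f \<in> square_integrable haar"
  shows "ennreal (Re (LINT t|haar. cinner (f t) (f t))) = (\<integral>\<^sup>+ t. ennreal ((norm (f t))\<^sup>2) \<partial>haar)"
    and "0 \<le> Re (LINT t|haar. cinner (f t) (f t))"
proof -
  have "integrable haar (\<lambda>t. Re (cinner (f t) (f t)))"
    by (intro integrable_Re integrable_cinner assms)
  then have int: "integrable haar (\<lambda>t. (norm (f t))\<^sup>2)" by (simp add: cinner_self)
  have eq: "Re (LINT t|haar. cinner (f t) (f t)) = (LINT t|haar. (norm (f t))\<^sup>2)"
    using integral_Re[OF integrable_cinner[OF assms assms]] by (simp add: cinner_self)
  show "ennreal (Re (LINT t|haar. cinner (f t) (f t))) = (\<integral>\<^sup>+ t. ennreal ((norm (f t))\<^sup>2) \<partial>haar)"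
    unfolding eq by (rule nn_integral_eq_integral[symmetric, OF int]) simp
  show "0 \<le> Re (LINT t|haar. cinner (f t) (f t))"
    unfolding eq by simp
qed

instantiation L2 :: (locally_compact_group, complex_hilbert_space) real_vector
begin

lift_definition zero_L2 :: "('a, 'b) L2" is "\<lambda>t. 0"
  by (simp add: L2_rel_def square_integrable_zero)

lift_definition plus_L2 :: "('a, 'b) L2 \<Rightarrow> ('a, 'b) L2 \<Rightarrow> ('a, 'b) L2" is "\<lambda>f g t. f t + g t"
proof -
  fix f f' g g' :: "'a \<Rightarrow> 'b"
  assume "L2_rel f f'" "L2_rel g g'"
  then show "L2_rel (\<lambda>t. f t + g t) (\<lambda>t. f' t + g' t)"
    unfolding L2_rel_def by (intro conjI square_integrable_add) auto
qed

lift_definition minus_L2 :: "('a, 'b) L2 \<Rightarrow> ('a, 'b) L2 \<Rightarrow> ('a, 'b) L2" is "\<lambda>f g t. f t - g t"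
proof -
  fix f f' g g' :: "'a \<Rightarrow> 'b"
  assume "L2_rel f f'" "L2_rel g g'"
  then show "L2_rel (\<lambda>t. f t - g t) (\<lambda>t. f' t - g' t)"
    unfolding L2_rel_def by (intro conjI square_integrable_diff) auto
qed

lift_definition uminus_L2 :: "('a, 'b) L2 \<Rightarrow> ('a, 'b) L2" is "\<lambda>f t. - f t"
  by (rule L2_relI_bounded_linear) (simp_all add: bounded_linear_minus[OF bounded_linear_ident])

lift_definition scaleR_L2 :: "real \<Rightarrow> ('a, 'b) L2 \<Rightarrow> ('a, 'b) L2" is "\<lambda>r f t. r *\<^sub>R f t"
  by (rule L2_relI_bounded_linear) (simp_all add: bounded_linear_scaleR_right)

lemma L2_abs_simps:
  "L2_rel f f \<Longrightarrow> L2_rel g g \<Longrightarrow> abs_L2 f + abs_L2 g = abs_L2 (\<lambda>t. f t + g t)"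
  "L2_rel f f \<Longrightarrow> L2_rel g g \<Longrightarrow> abs_L2 f - abs_L2 g = abs_L2 (\<lambda>t. f t - g t)"
  "L2_rel f f \<Longrightarrow> - abs_L2 f = abs_L2 (\<lambda>t. - f t)"
  "L2_rel f f \<Longrightarrow> r *\<^sub>R abs_L2 f = abs_L2 (\<lambda>t. r *\<^sub>R f t)"
  by (simp_all add: plus_L2.abs_eq minus_L2.abs_eq uminus_L2.abs_eq scaleR_L2.abs_eq)

lemma L2_rel_ops:
  "L2_rel (\<lambda>t. 0 :: 'b) (\<lambda>t. 0)"
  "L2_rel f f \<Longrightarrow> L2_rel g g \<Longrightarrow> L2_rel (\<lambda>t. f t + g t) (\<lambda>t. f t + g t)"
  "L2_rel f f \<Longrightarrow> L2_rel g g \<Longrightarrow> L2_rel (\<lambda>t. f t - g t) (\<lambda>t. f t - g t)"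
  "L2_rel f f \<Longrightarrow> L2_rel (\<lambda>t. - f t) (\<lambda>t. - f t)"
  "L2_rel f f \<Longrightarrow> L2_rel (\<lambda>t. r *\<^sub>R f t) (\<lambda>t. r *\<^sub>R f t)"
  "L2_rel f f \<Longrightarrow> L2_rel (\<lambda>t. c *\<^sub>C f t) (\<lambda>t. c *\<^sub>C f t)"
  by (simp_all add: L2_rel_refl square_integrable_zero square_integrable_add square_integrable_diff
      square_integrable_bounded_linear[OF _ bounded_linear_scaleR_right]
      square_integrable_bounded_linear[OF _ bounded_linear_scaleC]
      square_integrable_bounded_linear[OF _ bounded_linear_minus[OF bounded_linear_ident]])

instance
proof
  fix x y z :: "('a, 'b) L2" and r s :: real
  obtain f where f: "L2_rel f f" "x = abs_L2 f" by (rule L2_ex_rep)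
  obtain g where g: "L2_rel g g" "y = abs_L2 g" by (rule L2_ex_rep)
  obtain h where h: "L2_rel h h" "z = abs_L2 h" by (rule L2_ex_rep)
  note simps = f g h L2_abs_simps L2_rel_ops zero_L2_def
  show "x + y + z = x + (y + z)" "x + y = y + x" "0 + x = x" "- x + x = 0" "x - y = x + - y"
    by (simp_all add: simps ac_simps)
  show "r *\<^sub>R (x + y) = r *\<^sub>R x + r *\<^sub>R y" "(r + s) *\<^sub>R x = r *\<^sub>R x + s *\<^sub>R x"
    "r *\<^sub>R s *\<^sub>R x = (r * s) *\<^sub>R x" "1 *\<^sub>R x = x"
    by (simp_all add: simps scaleR_add_right scaleR_add_left)
qed

end

instantiation L2 :: (locally_compact_group, complex_hilbert_space) complex_vector_space
begin

lift_definition scaleC_L2 :: "complex \<Rightarrow> ('a, 'b) L2 \<Rightarrow> ('a, 'b) L2" is "\<lambda>c f t. c *\<^sub>C f t"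
  by (rule L2_relI_bounded_linear) (simp_all add: bounded_linear_scaleC)

instance
proof
  fix x y :: "('a, 'b) L2" and r :: real and c d :: complex
  obtain f where f: "L2_rel f f" "x = abs_L2 f" by (rule L2_ex_rep)
  obtain g where g: "L2_rel g g" "y = abs_L2 g" by (rule L2_ex_rep)
  show "c *\<^sub>C (x + y) = c *\<^sub>C x + c *\<^sub>C y" "(c + d) *\<^sub>C x = c *\<^sub>C x + d *\<^sub>C x"
    "c *\<^sub>C d *\<^sub>C x = (c * d) *\<^sub>C x" "r *\<^sub>R x = complex_of_real r *\<^sub>C x"
    by (simp_all add: f g L2_abs_simps L2_rel_ops scaleC_L2.abs_eq
        scaleC_add_right scaleC_add_left scaleC_scaleC scaleR_scaleC)
qed

end

lemma cinner_L2_fun_commute: "cinner_L2_fun x y = cnj (cinner_L2_fun y x)"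
proof -
  obtain f where f: "L2_rel f f" "x = abs_L2 f" by (rule L2_ex_rep)
  obtain g where g: "L2_rel g g" "y = abs_L2 g" by (rule L2_ex_rep)
  have "cinner_L2_fun x y = (LINT t|haar. cnj (cinner (g t) (f t)))"
    by (simp add: f g cinner_L2_fun.abs_eq flip: cinner_commute)
  also have "\<dots> = cnj (cinner_L2_fun y x)"
    by (simp add: f g cinner_L2_fun.abs_eq)
  finally show ?thesis .
qed

lemma cinner_L2_fun_add_left: "cinner_L2_fun (x + y) z = cinner_L2_fun x z + cinner_L2_fun y z"
proof -
  obtain f where f: "L2_rel f f" "x = abs_L2 f" by (rule L2_ex_rep)
  obtain g where g: "L2_rel g g" "y = abs_L2 g" by (rule L2_ex_rep)
  obtain h where h: "L2_rel h h" "z = abs_L2 h" by (rule L2_ex_rep)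
  have "integrable haar (\<lambda>t. cinner (f t) (h t))" "integrable haar (\<lambda>t. cinner (g t) (h t))"
    using f g h by (auto simp: L2_rel_refl intro: integrable_cinner)
  then show ?thesis
    by (simp add: f g h cinner_L2_fun.abs_eq L2_abs_simps L2_rel_ops cinner_add_left)
qed

lemma cinner_L2_fun_scaleC_left: "cinner_L2_fun (c *\<^sub>C x) y = c * cinner_L2_fun x y"
proof -
  obtain f where f: "L2_rel f f" "x = abs_L2 f" by (rule L2_ex_rep)
  obtain g where g: "L2_rel g g" "y = abs_L2 g" by (rule L2_ex_rep)
  show ?thesis
    by (simp add: f g cinner_L2_fun.abs_eq scaleC_L2.abs_eq L2_rel_ops cinner_scaleC_left)
qed

lemma cinner_L2_fun_self_ge: "0 \<le> Re (cinner_L2_fun x x)"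
proof -
  obtain f where f: "L2_rel f f" "x = abs_L2 f" by (rule L2_ex_rep)
  then show ?thesis using Re_cinner_L2_self(2)[of f] by (simp add: cinner_L2_fun.abs_eq L2_rel_refl)
qed

lemma cinner_L2_fun_self_eq_0: "Re (cinner_L2_fun x x) = 0 \<longleftrightarrow> x = 0"
proof
  assume "x = 0"
  then have "cinner_L2_fun x x = cinner_L2_fun (0 *\<^sub>C x) x" by (simp add: scaleC_zero_right)
  then show "Re (cinner_L2_fun x x) = 0" by (simp add: cinner_L2_fun_scaleC_left)
next
  assume 0: "Re (cinner_L2_fun x x) = 0"
  obtain f where rf: "L2_rel f f" and x: "x = abs_L2 f" by (rule L2_ex_rep)
  then have f: "f \<in> square_integrable haar" by (simp add: L2_rel_refl)
  have "(\<integral>\<^sup>+ t. ennreal ((norm (f t))\<^sup>2) \<partial>haar) = 0"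
    using 0 rf Re_cinner_L2_self(1)[OF f] by (simp add: x cinner_L2_fun.abs_eq)
  moreover have "(\<lambda>t. ennreal ((norm (f t))\<^sup>2)) \<in> borel_measurable haar"
    using f borel_measurable_norm_strongly[of haar f]
    by (auto simp: square_integrable_def)
  ultimately have "AE t in haar. ennreal ((norm (f t))\<^sup>2) = 0"
    by (simp add: nn_integral_0_iff_AE)
  then have "AE t in haar. f t = 0" by eventually_elim (simp add: ennreal_eq_0_iff)
  then have "L2_rel f (\<lambda>t. 0)" using f by (simp add: L2_rel_def square_integrable_zero)
  then show "x = 0" unfolding x zero_L2_def
    using Quotient_rel_abs[OF Quotient_L2] by blast
qed

instantiation L2 :: (locally_compact_group, complex_hilbert_space) real_inner
begin

definition inner_L2 :: "('a, 'b) L2 \<Rightarrow> ('a, 'b) L2 \<Rightarrow> real" where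
  "inner_L2 x y = Re (cinner_L2_fun x y)"
definition norm_L2 :: "('a, 'b) L2 \<Rightarrow> real" where "norm_L2 x = sqrt (inner x x)"
definition dist_L2 :: "('a, 'b) L2 \<Rightarrow> ('a, 'b) L2 \<Rightarrow> real" where "dist_L2 x y = norm (x - y)"
definition sgn_L2 :: "('a, 'b) L2 \<Rightarrow> ('a, 'b) L2" where "sgn_L2 x = scaleR (inverse (norm x)) x"
definition uniformity_L2 :: "(('a, 'b) L2 \<times> ('a, 'b) L2) filter" where
  "uniformity_L2 = (INF e\<in>{0<..}. principal {(x, y). dist x y < e})"
definition open_L2 :: "('a, 'b) L2 set \<Rightarrow> bool" where
  "open_L2 U = (\<forall>x\<in>U. \<forall>\<^sub>F (x', y) in uniformity. x' = x \<longrightarrow> y \<in> U)"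

instance
proof
  fix x y z :: "('a, 'b) L2" and r :: real
  show "dist x y = norm (x - y)" by (simp add: dist_L2_def)
  show "sgn x = inverse (norm x) *\<^sub>R x" by (simp add: sgn_L2_def)
  show "uniformity = (INF e\<in>{0<..}. principal {(x, y :: ('a, 'b) L2). dist x y < e})"
    by (simp add: uniformity_L2_def)
  show "open U = (\<forall>x\<in>U. \<forall>\<^sub>F (x', y) in uniformity. x' = x \<longrightarrow> y \<in> U)" for U :: "('a, 'b) L2 set"
    by (simp add: open_L2_def)
  show "inner x y = inner y x"
    unfolding inner_L2_def cinner_L2_fun_commute[of x y] by simp
  show "inner (x + y) z = inner x z + inner y z"
    unfolding inner_L2_def by (simp add: cinner_L2_fun_add_left)
  show "inner (r *\<^sub>R x) y = r * inner x y"
    unfolding inner_L2_def scaleR_scaleC by (simp add: cinner_L2_fun_scaleC_left)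
  show "0 \<le> inner x x" "inner x x = 0 \<longleftrightarrow> x = 0"
    unfolding inner_L2_def by (rule cinner_L2_fun_self_ge cinner_L2_fun_self_eq_0)+
  show "norm x = sqrt (inner x x)" by (simp add: norm_L2_def)
qed

end

lemma dist_L2_le_iff:
  assumes f: "L2_rel f f" and g: "L2_rel g g" and e: "e \<ge> 0"
  shows "dist (abs_L2 f) (abs_L2 g) \<le> e \<longleftrightarrow>
    (\<integral>\<^sup>+ t. ennreal ((norm (f t - g t))\<^sup>2) \<partial>haar) \<le> ennreal (e\<^sup>2)"
proof -
  have d: "(\<lambda>t. f t - g t) \<in> square_integrable haar"
    using f g by (simp add: L2_rel_refl square_integrable_diff)
  have "(dist (abs_L2 f) (abs_L2 g))\<^sup>2 = Re (LINT t|haar. cinner (f t - g t) (f t - g t))"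
    using f g by (simp add: dist_norm power2_norm_eq_inner inner_L2_def L2_abs_simps
        cinner_L2_fun.abs_eq L2_rel_ops)
  then have "ennreal ((dist (abs_L2 f) (abs_L2 g))\<^sup>2) = (\<integral>\<^sup>+ t. ennreal ((norm (f t - g t))\<^sup>2) \<partial>haar)"
    using Re_cinner_L2_self(1)[OF d] by simp
  then show ?thesis
    using e by (metis abs_le_square_iff abs_of_nonneg ennreal_le_iff zero_le_dist zero_le_power2)
qed

instance L2 :: (locally_compact_group, complex_hilbert_space) banach
proof
  fix X :: "nat \<Rightarrow> ('a, 'b) L2"
  assume X: "Cauchy X"
  have "\<forall>n. \<exists>f. L2_rel f f \<and> X n = abs_L2 f"
  proof
    fix n
    obtain f where "L2_rel f f" "X n = abs_L2 f" by (rule L2_ex_rep)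
    then show "\<exists>f. L2_rel f f \<and> X n = abs_L2 f" by blast
  qed
  then obtain x where x: "\<And>n. L2_rel (x n) (x n)" "\<And>n. X n = abs_L2 (x n)"
    unfolding choice_iff by blast
  have sq: "x n \<in> square_integrable haar" for n using x(1) by (simp add: L2_rel_refl)
  have "\<exists>N. \<forall>m\<ge>N. \<forall>n\<ge>N. (\<integral>\<^sup>+ t. ennreal ((norm (x m t - x n t))\<^sup>2) \<partial>haar) \<le> ennreal e"
    if e: "e > 0" for e :: real
  proof -
    have "sqrt e > 0" using e by simp
    then obtain N where N: "\<And>m n. m \<ge> N \<Longrightarrow> n \<ge> N \<Longrightarrow> dist (X m) (X n) < sqrt e"
      using X unfolding Cauchy_def by blast
    have "(\<integral>\<^sup>+ t. ennreal ((norm (x m t - x n t))\<^sup>2) \<partial>haar) \<le> ennreal ((sqrt e)\<^sup>2)"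
      if "m \<ge> N" "n \<ge> N" for m n
      using N[OF that] e by (subst dist_L2_le_iff[OF x(1) x(1), symmetric]) (simp_all add: x(2))
    then show ?thesis using e by auto
  qed
  from square_integrable_complete[OF sq this] obtain y where y: "y \<in> square_integrable haar"
    and lim: "\<And>e. e > 0 \<Longrightarrow> \<exists>N. \<forall>n\<ge>N. (\<integral>\<^sup>+ t. ennreal ((norm (x n t - y t))\<^sup>2) \<partial>haar) \<le> ennreal e"
    by blast
  have ry: "L2_rel y y" using y by (simp add: L2_rel_refl)
  have "X \<longlonglongrightarrow> abs_L2 y"
  proof (rule metric_LIMSEQ_I)
    fix e :: real assume e: "e > 0"
    then have "(e/2)\<^sup>2 > 0" by simp
    from lim[OF this] obtain N where
      N: "\<And>n. n \<ge> N \<Longrightarrow> (\<integral>\<^sup>+ t. ennreal ((norm (x n t - y t))\<^sup>2) \<partial>haar) \<le> ennreal ((e/2)\<^sup>2)"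
      by blast
    have "dist (X n) (abs_L2 y) < e" if "n \<ge> N" for n
    proof -
      have "dist (X n) (abs_L2 y) \<le> e/2"
        unfolding x(2) using N[OF that] e by (subst dist_L2_le_iff[OF x(1) ry]) simp_all
      then show ?thesis using e by simp
    qed
    then show "\<exists>N. \<forall>n\<ge>N. dist (X n) (abs_L2 y) < e" by blast
  qed
  then show "convergent X" by (auto simp: convergent_def)
qed

instantiation L2 :: (locally_compact_group, complex_hilbert_space) complex_hilbert_space
begin

definition cinner_L2 :: "('a, 'b) L2 \<Rightarrow> ('a, 'b) L2 \<Rightarrow> complex" where
  "cinner_L2 = cinner_L2_fun"

instance
  by standard
    (simp_all add: cinner_L2_def inner_L2_def cinner_L2_fun_add_left cinner_L2_fun_scaleC_left
      flip: cinner_L2_fun_commute)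

end


section \<open>C*-dynamical systems and reduced crossed products\<close>

definition star_homomorphism :: "('a::cstar_algebra \<Rightarrow> 'b::cstar_algebra) \<Rightarrow> bool" where
  "star_homomorphism \<pi> \<longleftrightarrow>
     (\<forall>a b. \<pi> (a + b) = \<pi> a + \<pi> b) \<and> (\<forall>c a. \<pi> (c *\<^sub>C a) = c *\<^sub>C \<pi> a) \<and>
     (\<forall>a b. \<pi> (a * b) = \<pi> a * \<pi> b) \<and> (\<forall>a. \<pi> (star a) = star (\<pi> a))"

definition faithful_representation :: "('a::cstar_algebra \<Rightarrow> 'h::complex_hilbert_space bop) \<Rightarrow> bool" where
  "faithful_representation \<pi> \<longleftrightarrow> star_homomorphism \<pi> \<and> inj \<pi>"

definition cstar_dynamical_system :: "('g::locally_compact_group \<Rightarrow> 'a::cstar_algebra \<Rightarrow> 'a) \<Rightarrow> bool" where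
  "cstar_dynamical_system \<alpha> \<longleftrightarrow>
     (\<forall>t. star_homomorphism (\<alpha> t) \<and> bij (\<alpha> t)) \<and>
     (\<forall>s t. \<alpha> (s + t) = \<alpha> s \<circ> \<alpha> t) \<and>
     (\<forall>a. continuous_on UNIV (\<lambda>t. \<alpha> t a))"

text \<open>The operator on the space of square-integrable functions induced by a map \<open>\<Phi>\<close> on
  representatives.\<close>

definition L2_operator ::
  "(('g::locally_compact_group \<Rightarrow> 'h::complex_hilbert_space) \<Rightarrow> ('g \<Rightarrow> 'h)) \<Rightarrow> ('g, 'h) L2 bop" where
  "L2_operator \<Phi> = (THE T. \<forall>\<xi>\<in>square_integrable haar.
     \<Phi> \<xi> \<in> square_integrable haar \<and> bop_apply T (abs_L2 \<xi>) = abs_L2 (\<Phi> \<xi>))"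

text \<open>\<open>regular_rep \<pi> \<alpha> a\<close> is the operator usually written as \<open>a\<close> under \<open>\<pi>\<close> with a tilde,
  and \<open>translation s\<close> is \<open>\<lambda>\<close> at \<open>s\<close>.\<close>

definition regular_rep ::
  "('a::cstar_algebra \<Rightarrow> 'h::complex_hilbert_space bop) \<Rightarrow> ('g::locally_compact_group \<Rightarrow> 'a \<Rightarrow> 'a)
    \<Rightarrow> 'a \<Rightarrow> ('g, 'h) L2 bop" where
  "regular_rep \<pi> \<alpha> a = L2_operator (\<lambda>\<xi> t. bop_apply (\<pi> (\<alpha> (- t) a)) (\<xi> t))"

definition translation :: "'g::locally_compact_group \<Rightarrow> ('g, 'h::complex_hilbert_space) L2 bop" where
  "translation s = L2_operator (\<lambda>\<xi> t. \<xi> (- s + t))"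

definition compactly_supported_continuous :: "('g::topological_space \<Rightarrow> complex) set" where
  "compactly_supported_continuous =
     {f. continuous_on UNIV f \<and> (\<exists>K. compact K \<and> (\<forall>t. t \<notin> K \<longrightarrow> f t = 0))}"

text \<open>\<open>has_weak_integral M F X\<close>: the operator \<open>X\<close> is the weak (equivalently, for the integrands
  used here, strong) integral of the operator-valued function \<open>F\<close>. The functions
  \<open>\<lambda>s. translation s\<close> are in general not norm continuous, so this is not a Bochner integral
  in operator norm.\<close>

definition has_weak_integral :: "'g measure \<Rightarrow> ('g \<Rightarrow> 'h::complex_hilbert_space bop) \<Rightarrow> 'h bop \<Rightarrow> bool" where
  "has_weak_integral M F X \<longleftrightarrow>
     (\<forall>\<xi> \<eta>. integrable M (\<lambda>s. cinner (bop_apply (F s) \<xi>) \<eta>) \<and>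
             cinner (bop_apply X \<xi>) \<eta> = (LINT s|M. cinner (bop_apply (F s) \<xi>) \<eta>))"

definition complex_span :: "'a::complex_vector_space set \<Rightarrow> 'a set" where
  "complex_span S = {\<Sum>x\<in>F. c x *\<^sub>C x | F c. finite F \<and> F \<subseteq> S}"

definition reduced_crossed_product ::
  "('a::cstar_algebra \<Rightarrow> 'h::complex_hilbert_space bop) \<Rightarrow> ('g::locally_compact_group \<Rightarrow> 'a \<Rightarrow> 'a)
    \<Rightarrow> ('g, 'h) L2 bop set" where
  "reduced_crossed_product \<pi> \<alpha> = closure (complex_span
     {X. \<exists>f\<in>compactly_supported_continuous. \<exists>a.
         has_weak_integral haar (\<lambda>s. f s *\<^sub>C (regular_rep \<pi> \<alpha> a * translation s)) X})"

definition Ad_translation ::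
  "'g::locally_compact_group \<Rightarrow> ('g, 'h::complex_hilbert_space) L2 bop \<Rightarrow> ('g, 'h) L2 bop" where
  "Ad_translation g x = translation g * x * star (translation g)"

definition invariant_under :: "'g::group_add \<Rightarrow> 'g set \<Rightarrow> bool" where
  "invariant_under g N \<longleftrightarrow> (\<lambda>x. g + x - g) ` N = N"


section \<open>Completely positive contractions through matrix algebras\<close>

text \<open>An \<open>n \<times> n\<close> matrix over an algebra is a function of two indices, of which only the values
  at indices below \<open>n\<close> matter. The next three predicates state positivity of such a matrix:
  in the C*-algebra of \<open>n \<times> n\<close> matrices over \<open>B\<close>, where \<open>B\<close> is (the carrier of) a C*-algebra, the
  positive elements being those of the form \<open>y\<^sup>*y\<close>; over the bounded operators on a Hilbert space
  \<open>K\<close>, as an operator on the direct sum of \<open>n\<close> copies of \<open>K\<close>; and over the algebra of \<open>m \<times> m\<close>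
  complex matrices, as an operator on the direct sum of \<open>n\<close> copies of \<open>m\<close>-dimensional space.\<close>

definition positive_matrix :: "'b::cstar_algebra set \<Rightarrow> nat \<Rightarrow> (nat \<Rightarrow> nat \<Rightarrow> 'b) \<Rightarrow> bool" where
  "positive_matrix B n x \<longleftrightarrow>
     (\<exists>y. (\<forall>i<n. \<forall>j<n. y i j \<in> B) \<and> (\<forall>i<n. \<forall>j<n. x i j = (\<Sum>k<n. star (y k i) * y k j)))"

definition positive_matrix_bop :: "nat \<Rightarrow> (nat \<Rightarrow> nat \<Rightarrow> 'k::complex_hilbert_space bop) \<Rightarrow> bool" where
  "positive_matrix_bop n x \<longleftrightarrow>
     (\<forall>v. (\<Sum>i<n. \<Sum>j<n. cinner (bop_apply (x i j) (v j)) (v i)) \<in> \<real>\<^sub>\<ge>\<^sub>0)"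

definition positive_matrix_mat :: "nat \<Rightarrow> nat \<Rightarrow> (nat \<Rightarrow> nat \<Rightarrow> complex mat) \<Rightarrow> bool" where
  "positive_matrix_mat m n x \<longleftrightarrow>
     (\<forall>i<n. \<forall>j<n. x i j \<in> carrier_mat m m) \<and>
     (\<forall>v. (\<forall>i<n. v i \<in> carrier_vec m) \<longrightarrow> (\<Sum>i<n. \<Sum>j<n. (x i j *\<^sub>v v j) \<bullet>c v i) \<in> \<real>\<^sub>\<ge>\<^sub>0)"

definition vec_norm2 :: "complex vec \<Rightarrow> real" where
  "vec_norm2 v = sqrt (Re (v \<bullet>c v))"

definition mat_norm :: "complex mat \<Rightarrow> real" where
  "mat_norm A = (SUP v\<in>{v \<in> carrier_vec (dim_col A). vec_norm2 v \<le> 1}. vec_norm2 (A *\<^sub>v v))"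

definition cp_contraction_to_mat :: "'b::cstar_algebra set \<Rightarrow> nat \<Rightarrow> ('b \<Rightarrow> complex mat) \<Rightarrow> bool" where
  "cp_contraction_to_mat B m \<phi> \<longleftrightarrow>
     (\<forall>b\<in>B. \<phi> b \<in> carrier_mat m m) \<and>
     (\<forall>b\<in>B. \<forall>c\<in>B. \<phi> (b + c) = \<phi> b + \<phi> c) \<and>
     (\<forall>z. \<forall>b\<in>B. \<phi> (z *\<^sub>C b) = z \<cdot>\<^sub>m \<phi> b) \<and>
     (\<forall>n x. positive_matrix B n x \<longrightarrow> positive_matrix_mat m n (\<lambda>i j. \<phi> (x i j))) \<and>
     (\<forall>b\<in>B. mat_norm (\<phi> b) \<le> norm b)"

definition cp_contraction_from_mat :: "nat \<Rightarrow> (complex mat \<Rightarrow> 'k::complex_hilbert_space bop) \<Rightarrow> bool" where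
  "cp_contraction_from_mat m \<psi> \<longleftrightarrow>
     (\<forall>A\<in>carrier_mat m m. \<forall>C\<in>carrier_mat m m. \<psi> (A + C) = \<psi> A + \<psi> C) \<and>
     (\<forall>z. \<forall>A\<in>carrier_mat m m. \<psi> (z \<cdot>\<^sub>m A) = z *\<^sub>C \<psi> A) \<and>
     (\<forall>n x. positive_matrix_mat m n x \<longrightarrow> positive_matrix_bop n (\<lambda>i j. \<psi> (x i j))) \<and>
     (\<forall>A\<in>carrier_mat m m. norm (\<psi> A) \<le> mat_norm A)"

text \<open>\<open>cp_approximable B \<rho> \<omega> \<delta> m\<close>: on the finite set \<open>\<omega>\<close> the representation \<open>\<rho>\<close> of the
  C*-algebra \<open>B\<close> factors up to \<open>\<delta>\<close> through the \<open>m \<times> m\<close> matrices by completely positive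
  contractions. The case of a concrete algebra of operators \<open>B\<close> is that of the identity
  representation \<open>\<rho> = (\<lambda>x. x)\<close>.\<close>

definition cp_approximable ::
  "'b::cstar_algebra set \<Rightarrow> ('b \<Rightarrow> 'k::complex_hilbert_space bop) \<Rightarrow> 'b set \<Rightarrow> real \<Rightarrow> nat \<Rightarrow> bool" where
  "cp_approximable B \<rho> \<omega> \<delta> m \<longleftrightarrow>
     (\<exists>\<phi> \<psi>. cp_contraction_to_mat B m \<phi> \<and> cp_contraction_from_mat m \<psi> \<and>
            (\<forall>b\<in>\<omega>. norm (\<psi> (\<phi> b) - \<rho> b) < \<delta>))"

text \<open>A C*-algebra is exact if it has a nuclear faithful representation (Brown and Ozawa,
  C*-Algebras and Finite-Dimensional Approximations, Definition 2.3.2). As types cannot be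
  quantified inside a formula, the type of the Hilbert space is a parameter; where the predicate
  is assumed with a type variable occurring nowhere else, that type is existentially
  quantified.\<close>

definition exact_cstar_algebra :: "'a::cstar_algebra itself \<Rightarrow> 'k::complex_hilbert_space itself \<Rightarrow> bool" where
  "exact_cstar_algebra _ _ \<longleftrightarrow>
     (\<exists>\<rho> :: 'a \<Rightarrow> 'k bop. faithful_representation \<rho> \<and>
        (\<forall>\<omega> \<delta>. finite \<omega> \<longrightarrow> \<delta> > 0 \<longrightarrow> (\<exists>m>0. cp_approximable UNIV \<rho> \<omega> \<delta> m)))"


section \<open>Topological entropy\<close>

definition rcp ::
  "'b::cstar_algebra set \<Rightarrow> ('b \<Rightarrow> 'k::complex_hilbert_space bop) \<Rightarrow> 'b set \<Rightarrow> real \<Rightarrow> enat" where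
  "rcp B \<rho> \<omega> \<delta> = Inf {enat m | m. m > 0 \<and> cp_approximable B \<rho> \<omega> \<delta> m}"

definition ln_enat :: "enat \<Rightarrow> ereal" where
  "ln_enat k = (case k of enat m \<Rightarrow> ereal (ln (real m)) | \<infinity> \<Rightarrow> \<infinity>)"

definition topological_entropy ::
  "'b::cstar_algebra set \<Rightarrow> ('b \<Rightarrow> 'k::complex_hilbert_space bop) \<Rightarrow> ('b \<Rightarrow> 'b) \<Rightarrow> ereal" where
  "topological_entropy B \<rho> \<beta> =
     (SUP \<omega>\<in>{\<omega>. finite \<omega> \<and> \<omega> \<subseteq> B}. SUP \<delta>\<in>{0<..}.
        limsup (\<lambda>n. ereal (1 / real n) * ln_enat (rcp B \<rho> (\<Union>i<n. (\<beta> ^^ i) ` \<omega>) \<delta>)))"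

end

theory Submission
  imports Defs
begin

text \<open>The map \<open>\<Phi> a = \<lambda>(f)\<^sup>* a \<lambda>(f)\<close>, with \<open>f\<close> a positive function of integral one supported near the
  identity, is completely positive and contractive from the algebra into the crossed product. If \<open>f\<close> is
  invariant under conjugation by \<open>g\<close>, then \<open>\<Phi>\<close> intertwines \<open>\<alpha>\<^sub>g\<close> and the inner automorphism; this uses that
  conjugation by \<open>g\<close> preserves Haar measure, which follows from the invariant neighbourhoods by the
  usual uniqueness argument for Haar measure. Compressing operators on \<open>L\<^sup>2(G, H)\<close> to \<open>H\<close> along a unit vector of \<open>L\<^sup>2(G)\<close>
  supported in a small invariant set maps \<open>\<Phi> a\<close> close to \<open>a\<close>, uniformly along the orbit of \<open>a\<close> under \<open>\<alpha>\<^sub>g\<close>. So an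
  approximate factorization of the image of an orbit segment through a matrix algebra yields one
  of the same size for the segment itself.\<close>

text \<open>Unless \<open>G\<close> is discrete, neither the operators
  \<open>regular_rep \<pi> \<alpha> a\<close> nor the translations need lie in the crossed product,
  so the entropy cannot simply be restricted to an invariant subalgebra. Multiplying by a
  convolution operator on one side already leads into the crossed product, but destroys positivity;
  the adjoint factor on the other side restores it. That adjoint is never written as a convolution,
  so the modular function does not appear. The entropy fixes \<delta> before the length of the orbit
  segment, hence one \<open>f\<close> and one compression must serve all iterates; here the
  invariant neighbourhoods enter a second time. Two scales occur: the set carrying the unit vector
  is small relative to the oscillation of the orbit maps, and the support of \<open>f\<close> is
  small relative to that set, so \<open>f\<close> is chosen last. Neither second countability nor
  \<sigma>-compactness of the group nor separability of the Hilbert spaces is assumed.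
  Measurability, Fubini and the continuity of translations therefore rest on compactness and on the
  regularity of Haar measure.\<close>

section \<open>Star homomorphisms are contractive\<close>

lemma star_zero: "star (0 :: 'a::cstar_algebra) = 0"
  using star_add[of "0::'a" 0] by simp

lemma star_minus: "star (- x) = - star (x :: 'a::cstar_algebra)"
  using star_add[of x "- x"] by (simp add: star_zero minus_unique)

lemma star_diff: "star (x - y) = star x - star (y :: 'a::cstar_algebra)"
  using star_add[of x "- y"] by (simp add: star_minus)

lemma star_scaleR: "star (r *\<^sub>R x) = r *\<^sub>R star (x :: 'a::cstar_algebra)"
  by (simp add: scaleR_scaleC star_scaleC)

lemma norm_star: "norm (star x) = norm (x :: 'a::cstar_algebra)"
proof -
  have le: "norm y \<le> norm (star y)" for y :: 'a
  proof -
    have "norm y * norm y \<le> norm (star y) * norm y"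
      using norm_mult_ineq[of "star y" y] by (simp add: norm_star_mult_self power2_eq_square)
    then show ?thesis by (cases "y = 0") (auto simp: mult_le_cancel_right)
  qed
  show ?thesis using le[of x] le[of "star x"] by (simp add: star_star)
qed

text \<open>With a unit, \<open>1 - c\<close> is the square root of \<open>1 - a\<^sup>2\<close>; the equation below avoids the unit.\<close>

lemma ex_sqrt_one_minus_square:
  fixes a :: "'a::cstar_algebra"
  assumes sa: "star a = a" and norm: "norm a < 1"
  shows "\<exists>c. star c = c \<and> 2 *\<^sub>R c - c * c = a * a"
proof -
  define q where "q = (norm a)\<^sup>2"
  \<comment> \<open>The smaller root of \<open>x = (q + x\<^sup>2) / 2\<close>. The ball of this
    radius is mapped into itself by \<open>F\<close> below, and as \<open>r < 1\<close> the radius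
    is also the contraction constant. A fixed point of \<open>F\<close> solves the required
    equation.\<close>
  define r where "r = 1 - sqrt (1 - q)"
  have q: "0 \<le> q" "q < 1"
    using norm by (auto simp: q_def power_less_one_iff)
  have r: "0 \<le> r" "r < 1" using q by (auto simp: r_def)
  have rq: "(q + r\<^sup>2) / 2 = r"
  proof -
    have "(sqrt (1 - q))\<^sup>2 = 1 - q" using q by simp
    moreover have "r\<^sup>2 = 1 - 2 * sqrt (1 - q) + (sqrt (1 - q))\<^sup>2"
      by (simp add: r_def power2_diff)
    ultimately show ?thesis by (simp add: r_def)
  qed
  define S where "S = {c :: 'a. star c = c \<and> norm c \<le> r}"
  define F where "F c = (1/2) *\<^sub>R (a * a + c * c)" for c
  have "continuous_on UNIV (star :: 'a \<Rightarrow> 'a)"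
    unfolding continuous_on_iff
    by (metis UNIV_I dist_norm norm_star star_diff)
  then have "closed {c :: 'a. star c = c}"
    by (intro closed_Collect_eq continuous_on_id)
  moreover have "closed {c :: 'a. norm c \<le> r}"
    by (intro closed_Collect_le continuous_intros)
  ultimately have "closed S" unfolding S_def by (simp add: closed_Collect_conj)
  have nF: "norm (F c) \<le> r" if "norm c \<le> r" for c
  proof -
    have "norm (a * a + c * c) \<le> norm a * norm a + norm c * norm c"
      by (rule order_trans[OF norm_triangle_ineq add_mono[OF norm_mult_ineq norm_mult_ineq]])
    also have "\<dots> \<le> q + r\<^sup>2"
      using mult_mono[OF that that] r by (simp add: q_def power2_eq_square)
    finally show ?thesis using rq by (simp add: F_def)
  qed
  have "\<exists>!c. c \<in> S \<and> F c = c"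
  proof (rule Banach_fix[where c = r])
    show "complete S" using \<open>closed S\<close> by (simp add: complete_eq_closed)
    show "S \<noteq> {}" using r by (auto simp: S_def star_zero intro!: exI[of _ 0])
    show "F ` S \<subseteq> S"
      using nF by (auto simp: S_def F_def star_scaleR star_add star_mult sa)
    fix x y assume "x \<in> S" "y \<in> S"
    then have xy: "norm x \<le> r" "norm y \<le> r" by (auto simp: S_def)
    have "F x - F y = (1/2) *\<^sub>R (x * x - y * y)"
      by (simp add: F_def scaleR_diff_right[symmetric])
    also have "x * x - y * y = x * (x - y) + (x - y) * y" by (simp add: algebra_simps)
    finally have "norm (F x - F y) \<le> (norm x * norm (x - y) + norm (x - y) * norm y) / 2"
      using norm_triangle_ineq[of "x * (x - y)" "(x - y) * y"]
        norm_mult_ineq[of x "x - y"] norm_mult_ineq[of "x - y" y] by simp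
    also have "\<dots> \<le> (r * norm (x - y) + norm (x - y) * r) / 2"
      using xy by (intro divide_right_mono add_mono mult_right_mono mult_left_mono) auto
    finally show "dist (F x) (F y) \<le> r * dist x y" by (simp add: dist_norm)
  qed (use r in auto)
  then obtain c where c: "star c = c" "F c = c" by (auto simp: S_def)
  have "2 *\<^sub>R c = 2 *\<^sub>R F c" by (simp add: c(2))
  also have "\<dots> = a * a + c * c" by (simp add: F_def)
  finally have "2 *\<^sub>R c - c * c = a * a" by simp
  with c(1) show ?thesis by blast
qed

text \<open>For self-adjoint \<open>b\<close> of norm below one, the equation
  \<open>2c - c\<^sup>2 = b\<^sup>2\<close> survives the representation and reads
  \<open>P\<^sup>2 + (1 - Q)\<^sup>2 = 1\<close> for self-adjoint \<open>P\<close> and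
  \<open>Q\<close>, which forces \<open>norm (P x) \<le> norm x\<close>. Scaling gives all
  self-adjoint elements, and the C*-identity reduces \<open>a\<close> to
  \<open>star a * a\<close>.\<close>

lemma norm_star_homomorphism_le:
  fixes \<pi> :: "'a::cstar_algebra \<Rightarrow> 'h::complex_hilbert_space bop"
  assumes hom: "star_homomorphism \<pi>"
  shows "norm (\<pi> a) \<le> norm a"
proof -
  have add: "\<pi> (x + y) = \<pi> x + \<pi> y" and mult: "\<pi> (x * y) = \<pi> x * \<pi> y"
    and star: "\<pi> (star x) = star (\<pi> x)" and scC: "\<pi> (c *\<^sub>C x) = c *\<^sub>C \<pi> x" for x y c
    using hom by (auto simp: star_homomorphism_def)
  have sc: "\<pi> (r *\<^sub>R x) = r *\<^sub>R \<pi> x" for r x by (simp add: scaleR_scaleC scC)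
  have diff: "\<pi> (x - y) = \<pi> x - \<pi> y" for x y using add[of "x - y" y] by simp
  have sa1: "norm (\<pi> b) \<le> 1" if b: "star b = b" "norm b < 1" for b
  proof -
    obtain c where c: "star c = c" "2 *\<^sub>R c - c * c = b * b"
      using ex_sqrt_one_minus_square[OF b] by blast
    define P where "P = bop_apply (\<pi> b)"
    define Q where "Q = bop_apply (\<pi> c)"
    have "star (\<pi> b) = \<pi> b" "star (\<pi> c) = \<pi> c" using b(1) c(1) star by metis+
    then have PP: "cinner (P x) y = cinner x (P y)" and QQ: "cinner (Q x) y = cinner x (Q y)" for x y
      unfolding P_def Q_def using cinner_star_bop by metis+
    have "2 *\<^sub>R \<pi> c - \<pi> c * \<pi> c = \<pi> b * \<pi> b"
      using arg_cong[OF c(2), of \<pi>] by (simp add: diff mult sc)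
    then have eq: "P (P x) = 2 *\<^sub>R Q x - Q (Q x)" for x
      unfolding P_def Q_def
      by (metis minus_bop.rep_eq times_bop.rep_eq scaleR_bop.rep_eq)
    show ?thesis
    proof (rule norm_bop_bound)
      fix x
      have "inner (P x) (P x) = inner x (P (P x))" and QQr: "inner (Q x) (Q x) = inner x (Q (Q x))"
        using PP[of x "P x"] QQ[of x "Q x"] by (simp_all add: inner_eq_Re_cinner)
      then have "(norm (P x))\<^sup>2 = (norm x)\<^sup>2 - (norm (x - Q x))\<^sup>2"
        by (simp add: eq power2_norm_eq_inner inner_diff_left inner_diff_right inner_commute)
      then have "(norm (P x))\<^sup>2 \<le> (norm x)\<^sup>2" by simp
      then show "norm (bop_apply (\<pi> b) x) \<le> 1 * norm x"
        by (simp add: P_def)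
    qed simp
  qed
  have sa: "norm (\<pi> b) \<le> norm b" if b: "star b = b" for b
  proof (rule field_le_epsilon)
    fix e :: real assume e: "e > 0"
    define k where "k = norm b + e"
    have k: "k > 0" using e by (simp add: k_def add_nonneg_pos)
    have "norm (\<pi> (inverse k *\<^sub>R b)) \<le> 1"
    proof (rule sa1)
      show "star (inverse k *\<^sub>R b) = inverse k *\<^sub>R b" using b by (simp add: star_scaleR)
      have "norm b < k" using e by (simp add: k_def)
      then show "norm (inverse k *\<^sub>R b) < 1" using k by (simp add: field_simps)
    qed
    then show "norm (\<pi> b) \<le> norm b + e" using k by (simp add: sc k_def field_simps)
  qed
  have "(norm (\<pi> a))\<^sup>2 = norm (\<pi> (star a * a))"
    by (simp add: mult star norm_star_mult_self)
  also have "\<dots> \<le> norm (star a * a)" by (rule sa) (simp add: star_mult star_star)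
  also have "\<dots> = (norm a)\<^sup>2" by (rule norm_star_mult_self)
  finally show ?thesis by (rule power2_le_imp_le) simp
qed

section \<open>Operators given by bounded sesquilinear forms\<close>

text \<open>Riesz representation of the real part of the form for fixed \<open>x\<close>; the
  imaginary part is the real part taken at \<open>\<i> *\<^sub>C y\<close>. Convolution operators
  and compressions are obtained this way.\<close>

lemma sesquilinear_form_bop:
  fixes B :: "'h::complex_hilbert_space \<Rightarrow> 'h \<Rightarrow> complex"
  assumes addl: "\<And>x x' y. B (x + x') y = B x y + B x' y"
    and addr: "\<And>x y y'. B x (y + y') = B x y + B x y'"
    and scl: "\<And>c x y. B (c *\<^sub>C x) y = c * B x y"
    and scr: "\<And>c x y. B x (c *\<^sub>C y) = cnj c * B x y"
    and bound: "\<And>x y. cmod (B x y) \<le> C * norm x * norm y" and C: "C \<ge> 0"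
  shows "\<exists>T. (\<forall>x y. cinner (bop_apply T x) y = B x y) \<and> norm T \<le> C"
proof -
  have "\<exists>z. \<forall>y. Re (B x y) = inner y z" for x
  proof (rule riesz_real, rule bounded_linear_intro[where K = "C * norm x"])
    show "norm (Re (B x y)) \<le> norm y * (C * norm x)" for y
      using order_trans[OF abs_Re_le_cmod bound[of x y]] by (simp add: ac_simps)
  qed (simp_all add: addr scr scaleR_scaleC)
  then obtain T where T: "\<And>x y. Re (B x y) = inner y (T x)" by metis
  have cT: "cinner (T x) y = B x y" for x y
  proof (rule complex_eqI)
    show re: "Re (cinner (T x) y) = Re (B x y)" for x y
      by (simp add: T inner_commute flip: inner_eq_Re_cinner)
    have "Im (cinner (T x) y) = Re (cinner (T x) (\<i> *\<^sub>C y))"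
      by (simp add: cinner_scaleC_right)
    also have "\<dots> = Re (B x (\<i> *\<^sub>C y))" by (rule re)
    finally show "Im (cinner (T x) y) = Im (B x y)" by (simp add: scr)
  qed
  have cT': "cinner y (T x) = cnj (B x y)" for x y
    by (subst cinner_commute) (simp add: cT)
  have add: "T (x + y) = T x + T y" for x y
    by (rule cinner_eqI) (simp add: cinner_add_right cT' addl)
  have sc: "T (c *\<^sub>C x) = c *\<^sub>C T x" for c x
    by (rule cinner_eqI) (simp add: cinner_scaleC_right cT' scl)
  have nT: "norm (T x) \<le> C * norm x" for x
  proof -
    have "norm (T x) * norm (T x) = cmod (B x (T x))"
      by (simp add: cinner_self norm_mult power2_eq_square flip: cT)
    also have "\<dots> \<le> C * norm x * norm (T x)" by (rule bound)
    finally show ?thesis using C by (cases "T x = 0") (auto simp: mult_le_cancel_right)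
  qed
  have "bounded_linear T"
    by (rule bounded_linear_intro[where K = C])
      (use nT in \<open>simp_all add: add sc scaleR_scaleC mult.commute\<close>)
  then have "bop_apply (Bop T) = T" by (intro Bop_inverse) (simp add: sc)
  then show ?thesis using cT nT C by (intro exI[of _ "Bop T"]) (auto intro: norm_bop_bound)
qed

lemma cinner_diff_left: "cinner (x - y) z = cinner x z - cinner y (z :: 'h::complex_hilbert_space)"
  using cinner_add_left[of "x - y" y z] by simp

lemma cinner_diff_right: "cinner x (y - z) = cinner x y - cinner x (z :: 'h::complex_hilbert_space)"
  using cinner_add_right[of x "y - z" z] by simp

lemma cinner_sum_left: "cinner (sum f A) y = (\<Sum>i\<in>A. cinner (f i) (y :: 'h::complex_hilbert_space))"
proof -
  have "cinner 0 y = 0" using cinner_add_left[of 0 0 y] by simp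
  then show ?thesis by (induction A rule: infinite_finite_induct) (simp_all add: cinner_add_left)
qed

lemma norm_bop_le_cinner:
  assumes "\<And>x y. cmod (cinner (bop_apply T x) y) \<le> C * norm x * norm y" and C: "C \<ge> 0"
  shows "norm T \<le> C"
proof (rule norm_bop_bound[OF _ C])
  fix x
  have "norm (bop_apply T x) * norm (bop_apply T x) = cmod (cinner (bop_apply T x) (bop_apply T x))"
    by (simp add: cinner_self norm_mult power2_eq_square)
  also have "\<dots> \<le> C * norm x * norm (bop_apply T x)" by (rule assms)
  finally show "norm (bop_apply T x) \<le> C * norm x"
    using C by (cases "bop_apply T x = 0") (auto simp: mult_le_cancel_right)
qed

lemma bop_eqI_cinner:
  assumes "\<And>x y. cinner (bop_apply S x) y = cinner (bop_apply T x) y"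
  shows "S = T"
proof (rule bop_eqI, rule cinner_eqI)
  fix x y
  show "cinner y (bop_apply S x) = cinner y (bop_apply T x)"
    by (subst (1 2) cinner_commute) (simp add: assms)
qed

section \<open>Integration on locally compact groups\<close>

lemmas group_add_assoc_simps = diff_conv_add_uminus minus_add add.assoc

declare sets_haar_borel [measurable_cong]

lemma space_haar [simp]: "space (haar :: 'g::locally_compact_group measure) = UNIV"
  using sets_eq_imp_space_eq[OF sets_haar_borel[where 'g='g]] by simp

lemma measurable_haar_continuous:
  "continuous_on UNIV f \<Longrightarrow> f \<in> borel_measurable (haar :: 'g::locally_compact_group measure)"
  using borel_measurable_continuous_onI[of f] measurable_cong_sets[OF sets_haar_borel refl] by blast

lemma sets_haar_compact: "compact K \<Longrightarrow> K \<in> sets (haar :: 'g::locally_compact_group measure)"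
  by (simp add: sets_haar_borel borel_closed compact_imp_closed)

lemma sets_haar_open: "open U \<Longrightarrow> U \<in> sets (haar :: 'g::locally_compact_group measure)"
  by (simp add: sets_haar_borel)

lemma measurable_translation:
  "(\<lambda>t. s + t) \<in> haar \<rightarrow>\<^sub>M (haar :: 'g::locally_compact_group measure)"
proof -
  have "(\<lambda>t. s + t) \<in> borel \<rightarrow>\<^sub>M (borel :: 'g measure)"
    by (intro borel_measurable_continuous_onI continuous_intros)
  then show ?thesis using measurable_cong_sets[OF sets_haar_borel sets_haar_borel] by blast
qed

lemma image_translation_eq_vimage: "(\<lambda>t. s + t) ` A = (\<lambda>t. - s + t) -` (A :: 'g::group_add set)"
  by (force simp: image_iff)

lemma sets_haar_translation:
  assumes "A \<in> sets haar"
  shows "(\<lambda>t. s + t) ` A \<in> sets (haar :: 'g::locally_compact_group measure)"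
  using measurable_sets[OF measurable_translation assms, of "- s"]
  by (simp add: image_translation_eq_vimage)

lemma distr_haar_translation:
  "distr haar haar (\<lambda>t. s + t) = (haar :: 'g::locally_compact_group measure)"
proof (rule measure_eqI)
  fix A :: "'g set" assume "A \<in> sets (distr haar haar (\<lambda>t. s + t))"
  then have A: "A \<in> sets haar" by simp
  have "emeasure (distr haar haar (\<lambda>t. s + t)) A = emeasure haar ((\<lambda>t. - s + t) ` A)"
    using A by (simp add: emeasure_distr[OF measurable_translation] image_translation_eq_vimage)
  then show "emeasure (distr haar haar (\<lambda>t. s + t)) A = emeasure haar A"
    by (simp add: haar_left_invariant[OF A])
qed simp

lemma integral_haar_translation:
  fixes f :: "'g::locally_compact_group \<Rightarrow> 'b::{banach, second_countable_topology}"
  assumes "f \<in> borel_measurable haar"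
  shows "(LINT t|haar. f (s + t)) = integral\<^sup>L haar f"
  using integral_distr[OF measurable_translation assms, of s] by (simp add: distr_haar_translation)

lemma nn_integral_haar_translation:
  assumes "f \<in> borel_measurable (haar :: 'g::locally_compact_group measure)"
  shows "(\<integral>\<^sup>+ t. f (s + t) \<partial>haar) = (\<integral>\<^sup>+ t. f t \<partial>haar)"
  using nn_integral_distr[OF measurable_translation, of f s] assms by (simp add: distr_haar_translation)

text \<open>Only the majorant has to be integrable: the integral of a non-integrable function is 0
  by convention, and the bound is nonnegative.\<close>

lemma norm_integral_le:
  fixes f :: "'a \<Rightarrow> 'b::{banach, second_countable_topology}"
  assumes g: "integrable M g" and le: "\<And>x. x \<in> space M \<Longrightarrow> norm (f x) \<le> g x"
  shows "norm (integral\<^sup>L M f) \<le> (LINT x|M. g x)"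
proof (cases "integrable M f")
  case True
  have "norm (integral\<^sup>L M f) \<le> (LINT x|M. norm (f x))" by (rule integral_norm_bound)
  also have "\<dots> \<le> (LINT x|M. g x)" using True g le by (intro integral_mono) auto
  finally show ?thesis .
next
  case False
  have "0 \<le> (LINT x|M. g x)"
    by (rule Bochner_Integration.integral_nonneg) (use le norm_ge_zero order_trans in blast)
  then show ?thesis using not_integrable_integral_eq[OF False] by simp
qed

lemma integrable_haar_compact_support:
  fixes f :: "'g::locally_compact_group \<Rightarrow> 'b::{banach, second_countable_topology}"
  assumes f: "continuous_on UNIV f" and K: "compact K" "\<And>t. t \<notin> K \<Longrightarrow> f t = 0"
  shows "integrable haar f"
proof -
  have "compact (f ` K)"
    by (rule compact_continuous_image[OF continuous_on_subset[OF f] K(1)]) simp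
  then obtain B where "\<forall>x\<in>f ` K. norm x \<le> B"
    using compact_imp_bounded bounded_iff by metis
  then show ?thesis
    by (intro integrableI_bounded_set[where A=K and B=B])
      (auto simp: K sets_haar_compact haar_compact_finite[simplified] intro: measurable_haar_continuous[OF f])
qed

text \<open>A compact set is covered by finitely many translates of \<open>U\<close>. If
  \<open>U\<close> were null, all compact sets would be null, and inner regularity on the open set
  \<open>UNIV\<close> would make the measure zero.\<close>

lemma haar_open_pos:
  fixes U :: "'g::locally_compact_group set"
  assumes U: "open U" "U \<noteq> {}"
  shows "emeasure haar U > 0"
proof (rule ccontr)
  assume "\<not> emeasure haar U > 0"
  then have 0: "emeasure haar U = 0" by simp
  obtain u where u: "u \<in> U" using U by blast
  have "emeasure haar K = 0" if K: "compact K" for K :: "'g set"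
  proof -
    define V where "V x = (\<lambda>t. (x - u) + t) ` U" for x
    have V: "open (V x)" for x
      unfolding V_def image_translation_eq_vimage
      by (intro open_vimage U continuous_intros)
    have "K \<subseteq> (\<Union>x\<in>K. V x)"
      using u by (force simp: V_def)
    then obtain T where T: "T \<subseteq> K" "finite T" "K \<subseteq> (\<Union>x\<in>T. V x)"
      using compactE_image[OF K, of K V] V by blast
    have "emeasure haar K \<le> emeasure haar (\<Union>x\<in>T. V x)"
      using T V by (intro emeasure_mono) (auto intro!: sets_haar_open)
    also have "\<dots> \<le> (\<Sum>x\<in>T. emeasure haar (V x))"
      using T V by (intro emeasure_subadditive_finite) (auto intro!: sets_haar_open)
    also have "\<dots> = 0"
      using 0 by (simp add: V_def haar_left_invariant sets_haar_open U)
    finally show ?thesis by simp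
  qed
  then have "(SUP K\<in>{K. compact K \<and> K \<subseteq> (UNIV :: 'g set)}. emeasure haar K) = 0"
    by (intro antisym SUP_least) auto
  then show False using haar_inner_regular[of "UNIV :: 'g set"] haar_nonzero[where 'a='g] by simp
qed

text \<open>Outer regularity encloses \<open>M\<close> in an open set of nearly the same measure,
  and by the tube lemma small translations keep \<open>M\<close> inside it. All continuity of
  translations, on indicator functions and in \<open>L2\<close>, comes from this estimate.\<close>

lemma translation_measure_diff:
  fixes M :: "'g::locally_compact_group set"
  assumes M: "compact M" and e: "e > 0"
  shows "\<exists>W. open W \<and> 0 \<in> W \<and>
    (\<forall>w\<in>W. measure haar ((\<lambda>t. w + t) ` M - M) \<le> e \<and> measure haar (M - (\<lambda>t. w + t) ` M) \<le> e)"
proof -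
  have Ms: "M \<in> sets haar" by (rule sets_haar_compact[OF M])
  have fin: "emeasure haar M < \<infinity>" by (rule haar_compact_finite[OF M])
  have "(INF U\<in>{U. open U \<and> M \<subseteq> U}. emeasure haar U) < emeasure haar M + ennreal e"
    using fin e ennreal_add_left_cancel_less[of "emeasure haar M" 0 "ennreal e"]
    by (simp add: haar_outer_regular[OF Ms, symmetric])
  then obtain U where U: "open U" "M \<subseteq> U" "emeasure haar U < emeasure haar M + ennreal e"
    unfolding INF_less_iff by auto
  define Q where "Q = (\<lambda>p. fst p + snd p) -` U"
  have "open Q" unfolding Q_def
    by (rule open_vimage[OF U(1)]) (intro continuous_intros)
  moreover have "{0} \<times> M \<subseteq> Q" using U(2) by (auto simp: Q_def)
  ultimately have "\<exists>X. 0 \<in> X \<and> open X \<and> X \<times> M \<subseteq> Q"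
    by (rule Elementary_Topology.tube_lemma[OF M])
  then obtain X where X: "0 \<in> X" "open X" "X \<times> M \<subseteq> Q"
    by blast
  have Us: "U \<in> sets haar" by (rule sets_haar_open[OF U(1)])
  have diff: "measure haar ((\<lambda>t. w + t) ` M - M) \<le> e" if "w \<in> X" for w
  proof -
    have "(\<lambda>t. w + t) ` M \<subseteq> U" using X(3) that by (auto simp: Q_def)
    then have "emeasure haar ((\<lambda>t. w + t) ` M - M) \<le> emeasure haar (U - M)"
      using Us Ms by (intro emeasure_mono) auto
    also have "\<dots> = emeasure haar U - emeasure haar M"
      using Us Ms U fin by (intro emeasure_Diff) auto
    also have "\<dots> \<le> ennreal e"
      using U(3) fin by (intro ennreal_minus_le_iff[THEN iffD2]) (auto simp: less_imp_le)
    finally show ?thesis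
      using e by (simp add: measure_def enn2real_leI)
  qed
  \<comment> \<open>Symmetric, because the second difference is a translate of the first one for
    \<open>- w\<close>.\<close>
  define W where "W = X \<inter> uminus -` X"
  have "open W" unfolding W_def
    by (intro open_Int X open_vimage continuous_intros)
  moreover have "0 \<in> W" using X by (simp add: W_def)
  moreover have "measure haar (M - (\<lambda>t. w + t) ` M) \<le> e" if "w \<in> W" for w
  proof -
    have "M - (\<lambda>t. w + t) ` M = (\<lambda>t. w + t) ` ((\<lambda>t. - w + t) ` M - M)"
      by (auto simp: image_translation_eq_vimage)
    moreover have "(\<lambda>t. - w + t) ` M - M \<in> sets haar"
      using Ms by (intro sets.Diff sets_haar_translation)
    ultimately have "measure haar (M - (\<lambda>t. w + t) ` M) = measure haar ((\<lambda>t. - w + t) ` M - M)"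
      by (simp add: measure_def haar_left_invariant)
    then show ?thesis using diff[of "- w"] that by (simp add: W_def)
  qed
  moreover have "W \<subseteq> X" by (simp add: W_def)
  ultimately show ?thesis using diff by blast
qed

section \<open>Riemann sums and iterated integrals of compactly supported functions\<close>

lemma compact_borel_partition:
  fixes K :: "'g::t2_space set"
  assumes K: "compact K" and U: "\<And>s. s \<in> K \<Longrightarrow> open (U s) \<and> s \<in> U s"
  obtains T E where "finite T" "T \<subseteq> K" "disjoint_family_on E T" "(\<Union>t\<in>T. E t) = K"
    "\<forall>t\<in>T. E t \<in> sets borel \<and> E t \<subseteq> U t"
proof -
  have K': "K \<in> sets borel" by (simp add: borel_closed compact_imp_closed K)
  have part: "\<exists>E. disjoint_family_on E T \<and> (\<Union>t\<in>T. E t) = K \<inter> (\<Union>t\<in>T. U t) \<and>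
      (\<forall>t\<in>T. E t \<in> sets borel \<and> E t \<subseteq> U t)" if "finite T" "T \<subseteq> K" for T
    using that
  proof (induction T)
    case (insert x T)
    then obtain E where E: "disjoint_family_on E T" "(\<Union>t\<in>T. E t) = K \<inter> (\<Union>t\<in>T. U t)"
      "\<forall>t\<in>T. E t \<in> sets borel \<and> E t \<subseteq> U t" by auto
    define E' where "E' = E(x := K \<inter> U x - (\<Union>t\<in>T. U t))"
    have E'T: "E' t = E t" if "t \<in> T" for t using that insert.hyps by (auto simp: E'_def)
    have E'x: "E' x = K \<inter> U x - (\<Union>t\<in>T. U t)" by (simp add: E'_def)
    have "open (\<Union>t\<in>T. U t)" using U insert.prems by auto
    then have "E' x \<in> sets borel" using U insert.prems K' unfolding E'x
      by (intro sets.Diff sets.Int) auto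
    moreover have "disjoint_family_on E' (insert x T)"
    proof -
      have "E' x \<inter> E t = {}" if "t \<in> T" for t using E(2) that unfolding E'x by blast
      then show ?thesis
        using E(1) insert.hyps by (auto simp: disjoint_family_on_def E'T)
    qed
    moreover have "(\<Union>t\<in>insert x T. E' t) = K \<inter> (\<Union>t\<in>insert x T. U t)"
      using E(2) E'x E'T by auto
    ultimately show ?case
      using E(3) E'T E'x by (intro exI[of _ E']) auto
  qed (auto simp: disjoint_family_on_def)
  have "K \<subseteq> (\<Union>s\<in>K. U s)" using U by blast
  then obtain T where T: "T \<subseteq> K" "finite T" "K \<subseteq> (\<Union>s\<in>T. U s)"
    using compactE_image[OF K, of K U] U by blast
  then have "K \<inter> (\<Union>t\<in>T. U t) = K" by blast
  with part[OF T(2,1)] obtain E where "disjoint_family_on E T" "(\<Union>t\<in>T. E t) = K"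
    "\<forall>t\<in>T. E t \<in> sets borel \<and> E t \<subseteq> U t" by auto
  with T show ?thesis by (intro that) auto
qed

text \<open>The sum is the integral of a step function that differs from \<open>h\<close> by at most
  \<open>e\<close> on \<open>K\<close> and vanishes off \<open>K\<close>. The tag \<open>t\<close>
  need not belong to its piece \<open>E t\<close>, as making a cover disjoint may remove it; hence
  the hypothesis compares \<open>h s\<close> with \<open>h t\<close> directly.\<close>

lemma riemann_sum_estimate:
  fixes h :: "'g::locally_compact_group \<Rightarrow> 'b::{banach, second_countable_topology}"
  assumes K: "compact K" and T: "finite T" and dis: "disjoint_family_on E T" and un: "(\<Union>t\<in>T. E t) = K"
    and E: "\<And>t. t \<in> T \<Longrightarrow> E t \<in> sets haar"
    and h: "integrable haar h" "\<And>s. s \<notin> K \<Longrightarrow> h s = 0"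
    and e: "\<And>s t. t \<in> T \<Longrightarrow> s \<in> E t \<Longrightarrow> norm (h s - h t) \<le> e"
  shows "norm (integral\<^sup>L haar h - (\<Sum>t\<in>T. measure haar (E t) *\<^sub>R h t)) \<le> e * measure haar K"
proof -
  have Ef: "emeasure haar (E t) < \<infinity>" if "t \<in> T" for t
  proof -
    have "emeasure haar (E t) \<le> emeasure haar K"
      using un that sets_haar_compact[OF K] by (intro emeasure_mono) auto
    then show ?thesis using haar_compact_finite[OF K] by (rule le_less_trans)
  qed
  define q where "q s = (\<Sum>t\<in>T. indicat_real (E t) s *\<^sub>R h t)" for s
  have int1: "integrable haar (\<lambda>s. indicat_real (E t) s *\<^sub>R h t)" if "t \<in> T" for t
    using that E Ef by (intro integrable_scaleR_left) (auto intro!: integrable_real_indicator)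
  then have q: "integrable haar q" unfolding q_def by (intro Bochner_Integration.integrable_sum)
  have Iq: "integral\<^sup>L haar q = (\<Sum>t\<in>T. measure haar (E t) *\<^sub>R h t)"
    unfolding q_def using int1 E Ef
    by (subst Bochner_Integration.integral_sum)
      (auto intro!: sum.cong simp: integrable_real_indicator)
  have le: "norm (h s - q s) \<le> e * indicat_real K s" for s
  proof (cases "s \<in> K")
    case True
    then obtain t where t: "t \<in> T" "s \<in> E t" using un by blast
    have "q s = (\<Sum>t'\<in>{t}. indicat_real (E t') s *\<^sub>R h t')"
      unfolding q_def using t dis T
      by (intro sum.mono_neutral_right) (auto simp: disjoint_family_on_def indicator_def)
    then show ?thesis using e[OF t] t True by simp
  next
    case False
    then have "q s = 0" unfolding q_def using un by (intro sum.neutral) (auto simp: indicator_def)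
    then show ?thesis using False h(2) by simp
  qed
  have intK: "integrable haar (\<lambda>s. e * indicat_real K s)"
    using haar_compact_finite[OF K] sets_haar_compact[OF K]
    by (intro integrable_mult_right integrable_real_indicator) auto
  have "norm (LINT s|haar. h s - q s) \<le> (LINT s|haar. e * indicat_real K s)"
    by (rule norm_integral_le[OF intK le])
  then show ?thesis using h q Iq sets_haar_compact[OF K] by simp
qed


lemma uniform_neighbourhood:
  fixes F :: "'a::topological_space \<times> 'b::topological_space \<Rightarrow> 'c::real_normed_vector"
  assumes F: "continuous_on UNIV F" and L: "compact L" and e: "e > 0"
  shows "\<exists>U. open U \<and> s \<in> U \<and> (\<forall>s'\<in>U. \<forall>t\<in>L. norm (F (s', t) - F (s, t)) \<le> e)"
proof -
  have "continuous_on (UNIV \<times> L) F" by (rule continuous_on_subset[OF F]) simp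
  from continuous_on_prod_compactE[OF this L UNIV_I e] obtain U where
    "s \<in> U" "open U" "\<forall>x\<in>U \<inter> UNIV. \<forall>t\<in>L. dist (F (x, t)) (F (s, t)) \<le> e" .
  then show ?thesis by (intro exI[of _ U]) (simp add: dist_norm)
qed

lemma continuous_on_UNIV_normI:
  fixes f :: "'a::topological_space \<Rightarrow> 'b::real_normed_vector"
  assumes "\<And>s e. e > 0 \<Longrightarrow> \<exists>U. open U \<and> s \<in> U \<and> (\<forall>s'\<in>U. norm (f s' - f s) \<le> e)"
  shows "continuous_on UNIV f"
proof -
  have "(f \<longlongrightarrow> f s) (at s)" for s
  proof (rule tendstoI)
    fix e :: real assume "e > 0"
    then obtain U where U: "open U" "s \<in> U" "\<forall>s'\<in>U. norm (f s' - f s) \<le> e/2"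
      using assms[of "e/2" s] by auto
    then have "\<forall>s'\<in>U. dist (f s') (f s) < e" using \<open>e > 0\<close> by (auto simp: dist_norm)
    then show "\<forall>\<^sub>F x in at s. dist (f x) (f s) < e"
      using U by (auto simp: eventually_at_topological)
  qed
  then show ?thesis by (simp add: continuous_on_def)
qed

lemma norm_integral_le_compact:
  fixes f :: "'g::locally_compact_group \<Rightarrow> 'b::{banach, second_countable_topology}"
  assumes K: "compact K" and f: "\<And>t. t \<in> K \<Longrightarrow> norm (f t) \<le> e" "\<And>t. t \<notin> K \<Longrightarrow> f t = 0"
  shows "norm (integral\<^sup>L haar f) \<le> e * measure haar K"
proof -
  have "norm (integral\<^sup>L haar f) \<le> (LINT t|haar. e * indicat_real K t)"
  proof (rule norm_integral_le)
    show "integrable haar (\<lambda>s. e * indicat_real K s)"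
      using haar_compact_finite[OF K] sets_haar_compact[OF K]
      by (intro integrable_mult_right integrable_real_indicator) auto
  qed (use f in \<open>auto simp: indicator_def\<close>)
  then show ?thesis using sets_haar_compact[OF K] by simp
qed

lemma continuous_integral_compact_support:
  fixes F :: "'a::topological_space \<times> 'g::locally_compact_group \<Rightarrow> 'b::{banach, second_countable_topology}"
  assumes F: "continuous_on UNIV F" and L: "compact L" "\<And>s t. t \<notin> L \<Longrightarrow> F (s, t) = 0"
  shows "continuous_on UNIV (\<lambda>s. LINT t|haar. F (s, t))"
proof (rule continuous_on_UNIV_normI)
  fix s and e :: real assume e: "e > 0"
  \<comment> \<open>The summand 1 keeps the divisor positive when \<open>L\<close> is a null set;
    the same device recurs below.\<close>
  define d where "d = e / (measure haar L + 1)"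
  have pos: "measure haar L + 1 > 0" by (simp add: add_nonneg_pos)
  then have d: "d > 0" using e by (simp add: d_def)
  have "d * measure haar L \<le> d * (measure haar L + 1)" using d by simp
  also have "\<dots> = e" using pos by (simp add: d_def)
  finally have dL: "d * measure haar L \<le> e" .
  obtain U where U: "open U" "s \<in> U" "\<forall>s'\<in>U. \<forall>t\<in>L. norm (F (s', t) - F (s, t)) \<le> d"
    using uniform_neighbourhood[OF F L(1) d] by blast
  have int: "integrable haar (\<lambda>t. F (s', t))" for s'
    by (rule integrable_haar_compact_support[OF _ L(1) L(2)])
      (rule continuous_on_compose2[OF F], auto intro!: continuous_intros)
  have "norm ((LINT t|haar. F (s', t)) - (LINT t|haar. F (s, t))) \<le> e" if "s' \<in> U" for s'
  proof -
    have "norm (LINT t|haar. F (s', t) - F (s, t)) \<le> d * measure haar L"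
      by (rule norm_integral_le_compact[OF L(1)]) (use U(3) that L(2) in auto)
    then show ?thesis using dL int by simp
  qed
  then show "\<exists>U. open U \<and> s \<in> U \<and> (\<forall>s'\<in>U. norm ((LINT t|haar. F (s', t)) - (LINT t|haar. F (s, t))) \<le> e)"
    using U by blast
qed

text \<open>As \<open>G\<close> need not be second countable, a continuous function on \<open>G \<times> G\<close> need not be measurable
  for the product of the Borel algebras, and \<open>haar\<close> need not be \<open>\<sigma>\<close>-finite: the general Fubini
  theorem does not apply. Riemann sums in the first variable give the result directly.\<close>

lemma Fubini_compact_support:
  fixes F :: "'g::locally_compact_group \<times> 'g \<Rightarrow> 'b::{banach, second_countable_topology}"
  assumes F: "continuous_on UNIV F" and K: "compact K" and L: "compact L"
    and supp: "\<And>s t. s \<notin> K \<or> t \<notin> L \<Longrightarrow> F (s, t) = 0"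
  shows "(LINT s|haar. LINT t|haar. F (s, t)) = (LINT t|haar. LINT s|haar. F (s, t))"
proof -
  define H1 where "H1 s = (LINT t|haar. F (s, t))" for s
  define H2 where "H2 t = (LINT s|haar. F (s, t))" for t
  have F': "continuous_on UNIV (\<lambda>(t, s). F (s, t))"
    unfolding case_prod_beta
    by (rule continuous_on_compose2[OF F]) (auto intro!: continuous_intros)
  have cF: "continuous_on UNIV (\<lambda>t. F (s, t))" "continuous_on UNIV (\<lambda>s. F (s, t))" for s t
    by (rule continuous_on_compose2[OF F]; auto intro!: continuous_intros)+
  have intF: "integrable haar (\<lambda>t. F (s, t))" "integrable haar (\<lambda>s. F (s, t))" for s t
    by (rule integrable_haar_compact_support[OF cF(1) L] integrable_haar_compact_support[OF cF(2) K],
        simp add: supp)+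
  have H1: "integrable haar H1"
  proof (rule integrable_haar_compact_support[OF _ K])
    show "continuous_on UNIV H1"
      unfolding H1_def by (rule continuous_integral_compact_support[OF F L]) (simp add: supp)
  qed (simp add: H1_def supp)
  have H2: "integrable haar H2"
  proof (rule integrable_haar_compact_support[OF _ L])
    show "continuous_on UNIV H2"
      using continuous_integral_compact_support[OF F' K] supp by (simp add: H2_def[abs_def])
  qed (simp add: H2_def supp)
  define m where "m = measure haar K * measure haar L"
  have bound: "norm (integral\<^sup>L haar H1 - integral\<^sup>L haar H2) \<le> 2 * (d * m)" if d: "d > 0" for d
  proof -
    have "\<exists>U. open U \<and> s \<in> U \<and> (\<forall>s'\<in>U. \<forall>t\<in>L. norm (F (s', t) - F (s, t)) \<le> d)" for s
      by (rule uniform_neighbourhood[OF F L d])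
    then have "\<forall>s. \<exists>U. open U \<and> s \<in> U \<and> (\<forall>s'\<in>U. \<forall>t\<in>L. norm (F (s', t) - F (s, t)) \<le> d)" by blast
    from choice[OF this] obtain U where U: "\<And>s. open (U s)" "\<And>s. s \<in> U s"
      "\<And>s s' t. s' \<in> U s \<Longrightarrow> t \<in> L \<Longrightarrow> norm (F (s', t) - F (s, t)) \<le> d" by blast
    have "\<And>s. s \<in> K \<Longrightarrow> open (U s) \<and> s \<in> U s" using U by simp
    \<comment> \<open>The neighbourhood \<open>U s\<close> is good for all \<open>t\<close> at once,
      so a single partition of \<open>K\<close> gives Riemann sums that are uniformly accurate in
      \<open>t\<close>.\<close>
    from compact_borel_partition[OF K this] obtain T E where T: "finite T" and "T \<subseteq> K"
      and T': "disjoint_family_on E T" "(\<Union>t\<in>T. E t) = K"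
      and TE: "\<forall>t\<in>T. E t \<in> sets borel \<and> E t \<subseteq> U t" .
    then have E: "E t \<in> sets borel" "E t \<subseteq> U t" if "t \<in> T" for t using that by simp_all
    have E': "\<And>t. t \<in> T \<Longrightarrow> E t \<in> sets haar" using E(1) by (simp add: sets_haar_borel)
    note riemann = riemann_sum_estimate[OF K T T' E']
    have d1: "norm (F (s', t) - F (s, t)) \<le> d" if "s \<in> T" "s' \<in> E s" for s s' t
      using U(3)[of s' s t] E(2) that supp d by (cases "t \<in> L") auto
    have A: "norm (H2 t - (\<Sum>s\<in>T. measure haar (E s) *\<^sub>R F (s, t))) \<le> d * measure haar K" for t
      unfolding H2_def by (rule riemann[OF _ intF(2)]) (use supp d1 in auto)
    have "norm (LINT t|haar. H2 t - (\<Sum>s\<in>T. measure haar (E s) *\<^sub>R F (s, t)))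
        \<le> d * measure haar K * measure haar L"
      by (rule norm_integral_le_compact[OF L A]) (simp add: supp H2_def)
    \<comment> \<open>Integrating the Riemann sums of \<open>H2\<close> over \<open>t\<close> yields
      the Riemann sum of \<open>H1\<close> for the same partition; this common value links the two
      iterated integrals.\<close>
    then have B: "norm (integral\<^sup>L haar H2 - (\<Sum>s\<in>T. measure haar (E s) *\<^sub>R H1 s)) \<le> d * m"
      using H2 intF by (simp add: H1_def m_def mult.assoc)
    have "norm (H1 s' - H1 s) \<le> d * measure haar L" if "s \<in> T" "s' \<in> E s" for s s'
    proof -
      have "norm (LINT t|haar. F (s', t) - F (s, t)) \<le> d * measure haar L"
        by (rule norm_integral_le_compact[OF L d1]) (use that supp in auto)
      then show ?thesis using intF by (simp add: H1_def)
    qed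
    then have "norm (integral\<^sup>L haar H1 - (\<Sum>s\<in>T. measure haar (E s) *\<^sub>R H1 s))
        \<le> d * measure haar L * measure haar K"
      by (intro riemann[OF _ H1]) (auto simp: H1_def supp)
    then have "norm (integral\<^sup>L haar H1 - (\<Sum>s\<in>T. measure haar (E s) *\<^sub>R H1 s)) \<le> d * m"
      by (simp add: m_def ac_simps)
    from norm_diff_triangle_le[OF this B[unfolded norm_minus_commute[of "integral\<^sup>L haar H2"]]]
    show ?thesis by simp
  qed
  have "norm (integral\<^sup>L haar H1 - integral\<^sup>L haar H2) \<le> 0"
  proof (rule field_le_epsilon)
    fix e :: real assume e: "e > 0"
    have m: "m \<ge> 0" by (simp add: m_def)
    have "norm (integral\<^sup>L haar H1 - integral\<^sup>L haar H2) \<le> 2 * (e / (2 * (m + 1)) * m)"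
      using e m by (intro bound) auto
    also have "\<dots> \<le> 0 + e" using e m by (simp add: field_simps)
    finally show "norm (integral\<^sup>L haar H1 - integral\<^sup>L haar H2) \<le> 0 + e" .
  qed
  then show ?thesis by (simp add: H1_def[abs_def] H2_def[abs_def])
qed

lemma compact_sum_set:
  fixes K L :: "'g::topological_group_add set"
  assumes "compact K" "compact L"
  shows "compact {x + y | x y. x \<in> K \<and> y \<in> L}" and "compact {x - y | x y. x \<in> K \<and> y \<in> L}"
proof -
  have "compact ((\<lambda>p. fst p + snd p) ` (K \<times> L))" "compact ((\<lambda>p. fst p - snd p) ` (K \<times> L))"
    by (intro compact_continuous_image compact_Times assms continuous_intros)+
  moreover have "(\<lambda>p. fst p + snd p) ` (K \<times> L) = {x + y | x y. x \<in> K \<and> y \<in> L}"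
    "(\<lambda>p. fst p - snd p) ` (K \<times> L) = {x - y | x y. x \<in> K \<and> y \<in> L}"
    by (auto simp: image_iff Bex_def) blast+
  ultimately show "compact {x + y | x y. x \<in> K \<and> y \<in> L}" "compact {x - y | x y. x \<in> K \<and> y \<in> L}"
    by simp_all
qed

lemma uniformly_continuous_compact_support:
  fixes u :: "'g::locally_compact_group \<Rightarrow> 'b::real_normed_vector"
  assumes u: "continuous_on UNIV u" and K: "compact K" "\<And>t. t \<notin> K \<Longrightarrow> u t = 0" and e: "e > 0"
  shows "\<exists>X. open X \<and> 0 \<in> X \<and> (\<forall>x t. - t + x \<in> X \<longrightarrow> norm (u x - u t) \<le> e)"
proof -
  obtain V N where N: "open V" "(0::'g) \<in> V" "V \<subseteq> N" "compact N"
    using locally_compact_group[of "0::'g"] by blast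
  \<comment> \<open>If \<open>t\<close> lies outside \<open>C\<close> and \<open>- t + x\<close>
    lies in \<open>N\<close>, then both \<open>t\<close> and \<open>x\<close> lie outside
    \<open>K\<close>, so only \<open>t\<close> in the compact set \<open>C\<close> needs an
    estimate.\<close>
  define C where "C = {x - y | x y. x \<in> K \<and> y \<in> insert 0 N}"
  have C: "compact C" unfolding C_def by (rule compact_sum_set[OF K(1)]) (use N in auto)
  have "continuous_on UNIV (\<lambda>(w, t). u (t + w))"
    unfolding case_prod_beta
    by (rule continuous_on_compose2[OF u]) (auto intro!: continuous_intros)
  from uniform_neighbourhood[OF this C e, of 0] obtain U where
    U: "open U" "0 \<in> U" "\<forall>w\<in>U. \<forall>t\<in>C. norm (u (t + w) - u t) \<le> e" by auto
  have "norm (u x - u t) \<le> e" if x: "- t + x \<in> U \<inter> V" for x t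
  proof (cases "t \<in> C")
    case True
    then show ?thesis using U(3)[rule_format, of "- t + x" t] x by simp
  next
    case False
    have "t = x - (- t + x)" by (simp add: group_add_assoc_simps del: add_uminus_conv_diff)
    moreover have "- t + x \<in> N" using x N by auto
    ultimately have "x \<notin> K" using False unfolding C_def by blast
    moreover have "t = t - 0" by simp
    then have "t \<notin> K" using False unfolding C_def by blast
    ultimately show ?thesis using K(2) e by simp
  qed
  then show ?thesis using U N by (intro exI[of _ "U \<inter> V"]) auto
qed

section \<open>Invariance of Haar measure under the conjugation\<close>

definition invariant_neighbourhood_basis :: "'g::locally_compact_group \<Rightarrow> bool" where
  "invariant_neighbourhood_basis g \<longleftrightarrow> (\<forall>U. open U \<and> 0 \<in> U \<longrightarrow>
      (\<exists>N. compact N \<and> 0 \<in> interior N \<and> N \<subseteq> U \<and> invariant_under g N))"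

lemma invariant_neighbourhood_basisE:
  assumes "invariant_neighbourhood_basis g" "open U" "0 \<in> U"
  obtains N where "compact N" "0 \<in> interior N" "N \<subseteq> U" "invariant_under g N"
  using assms unfolding invariant_neighbourhood_basis_def by metis

lemma invariant_under_iff: "invariant_under g N \<longleftrightarrow> (\<forall>t. g + t - g \<in> N \<longleftrightarrow> t \<in> N)"
proof
  assume "invariant_under g N"
  then have N: "N = (\<lambda>x. g + x - g) ` N" by (simp add: invariant_under_def)
  show "\<forall>t. g + t - g \<in> N \<longleftrightarrow> t \<in> N"
    by (subst (1) N) (auto simp: image_iff group_add_assoc_simps simp del: add_uminus_conv_diff)
next
  assume *: "\<forall>t. g + t - g \<in> N \<longleftrightarrow> t \<in> N"
  have inv: "g + (- g + t + g) - g = t" for t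
    by (simp add: group_add_assoc_simps del: add_uminus_conv_diff)
  have "t \<in> (\<lambda>x. g + x - g) ` N" if "t \<in> N" for t
    using *[rule_format, of "- g + t + g"] that inv by (metis imageI)
  then show "invariant_under g N" using * by (auto simp: invariant_under_def)
qed

text \<open>This set is a subgroup; using it in place of the powers of \<open>g\<close> avoids integer multiples.\<close>

definition conjugators :: "'g::locally_compact_group \<Rightarrow> 'g set" where
  "conjugators g = {x. \<forall>N. compact N \<and> invariant_under g N \<longrightarrow> invariant_under x N}"

lemma conjugators_self: "g \<in> conjugators g"
  by (simp add: conjugators_def)

lemma conjugators_zero: "0 \<in> conjugators g"
  by (simp add: conjugators_def invariant_under_def)

lemma conjugators_add: "x \<in> conjugators g \<Longrightarrow> y \<in> conjugators g \<Longrightarrow> x + y \<in> conjugators g"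
proof -
  assume x: "x \<in> conjugators g" and y: "y \<in> conjugators g"
  have "x + y + t - (x + y) = x + (y + t - y) - x" for t
    by (simp add: group_add_assoc_simps del: add_uminus_conv_diff)
  then show ?thesis using x y by (simp add: conjugators_def invariant_under_iff)
qed

text \<open>Together with closure under sums, this makes adding \<open>g\<close> on the right a
  permutation of \<open>conjugators g\<close>, the reason why suprema over this set are invariant
  under conjugation by \<open>g\<close>.\<close>

lemma conjugators_diff_self: "x \<in> conjugators g \<Longrightarrow> x - g \<in> conjugators g"
proof -
  assume x: "x \<in> conjugators g"
  have e: "x - g + t - (x - g) = x + (- g + t + g) - x" "g + (- g + t + g) - g = t" for t
    by (simp_all add: group_add_assoc_simps del: add_uminus_conv_diff)
  have "invariant_under (x - g) N" if N: "compact N" "invariant_under g N" for N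
  proof -
    have "- g + t + g \<in> N \<longleftrightarrow> t \<in> N" for t
      using N(2) e(2)[of t] unfolding invariant_under_iff by metis
    then show ?thesis using x N unfolding conjugators_def by (simp add: invariant_under_iff e(1))
  qed
  then show ?thesis by (simp add: conjugators_def)
qed

lemma conjugators_invariant:
  "x \<in> conjugators g \<Longrightarrow> compact N \<Longrightarrow> invariant_under g N \<Longrightarrow> x + t - x \<in> N \<longleftrightarrow> t \<in> N"
  by (simp add: conjugators_def invariant_under_iff)

text \<open>The measure \<open>m t\<close> of \<open>M \<inter> (t + M)\<close> is continuous, even
  and supported near 0. Its invariance under conjugation would follow if conjugation preserved Haar
  measure, but that is still to be proved with the help of this lemma. So \<open>k\<close> is the
  supremum of \<open>m\<close> over all conjugates by \<open>conjugators g\<close>; the invariant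
  neighbourhoods make this family equicontinuous, which keeps the supremum continuous.\<close>

lemma invariant_bump:
  fixes g :: "'g::locally_compact_group"
  assumes basis: "invariant_neighbourhood_basis g" and W: "open W" "0 \<in> W"
  obtains k :: "'g \<Rightarrow> real" and N where "continuous_on UNIV k" "\<forall>t. 0 \<le> k t" "\<forall>t. k (- t) = k t"
    "\<forall>t. k (g + t - g) = k t" "compact N" "N \<subseteq> W" "\<forall>t. t \<notin> N \<longrightarrow> k t = 0" "integral\<^sup>L haar k > 0"
proof -
  obtain N where N: "compact N" "0 \<in> interior N" "N \<subseteq> W" "invariant_under g N"
    using invariant_neighbourhood_basisE[OF basis W] .
  \<comment> \<open>Continuity of subtraction at \<open>(0, 0)\<close> yields an \<open>M\<close>
    whose differences stay in \<open>N\<close>, so that \<open>m\<close> vanishes off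
    \<open>N\<close>.\<close>
  define Q where "Q = (\<lambda>p :: 'g \<times> 'g. fst p - snd p) -` interior N"
  have "open Q" unfolding Q_def
    by (rule open_vimage[OF open_interior]) (intro continuous_intros)
  moreover have "(0, 0) \<in> Q" using N by (simp add: Q_def)
  ultimately obtain A B where AB: "open A" "open B" "(0, 0) \<in> A \<times> B" "A \<times> B \<subseteq> Q"
    by (rule open_prod_elim)
  have AB': "open (A \<inter> B)" "0 \<in> A \<inter> B" using AB by auto
  obtain M where M: "compact M" "0 \<in> interior M" "M \<subseteq> A \<inter> B" "invariant_under g M"
    using invariant_neighbourhood_basisE[OF basis AB'] .
  have MN: "x - y \<in> N" if "x \<in> M" "y \<in> M" for x y
  proof -
    have "(x, y) \<in> Q" using that M(3) AB(4) by blast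
    then show ?thesis using interior_subset[of N] by (auto simp: Q_def)
  qed
  have Ms: "M \<in> sets haar" by (rule sets_haar_compact[OF M(1)])
  have Mf: "emeasure haar M < \<infinity>" by (rule haar_compact_finite[OF M(1)])
  define tr where "tr t = (\<lambda>s. t + s) ` M" for t
  have trs: "tr t \<in> sets haar" for t
    unfolding tr_def by (rule sets_haar_translation[OF Ms])
  have trf: "emeasure haar (tr t) < \<infinity>" for t
    unfolding tr_def using Mf Ms by (simp add: haar_left_invariant)
  define m where "m t = measure haar (M \<inter> tr t)" for t
  have m0: "0 \<le> m t" for t by (simp add: m_def)
  have mM: "m t \<le> measure haar M" for t
    unfolding m_def by (rule measure_mono_fmeasurable) (use Ms Mf trs in \<open>auto simp: fmeasurable_def\<close>)
  have m_minus: "m (- t) = m t" for t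
  proof -
    have "M \<inter> tr t = (\<lambda>s. t + s) ` (M \<inter> tr (- t))"
      by (auto simp: tr_def image_translation_eq_vimage)
    moreover have "M \<inter> tr (- t) \<in> sets haar" using Ms trs by auto
    ultimately show ?thesis by (simp add: m_def measure_def haar_left_invariant)
  qed
  have mN: "m t = 0" if "t \<notin> N" for t
  proof -
    have "M \<inter> tr t = {}"
    proof (rule ccontr)
      assume "M \<inter> tr t \<noteq> {}"
      then obtain s where "s \<in> M" "t + s \<in> M" by (auto simp: tr_def)
      then show False using MN[of "t + s" s] that by simp
    qed
    then show ?thesis by (simp add: m_def)
  qed
  have "emeasure haar M > 0"
  proof -
    have "0 < emeasure haar (interior M)" using M(2) by (intro haar_open_pos) auto
    also have "\<dots> \<le> emeasure haar M" by (rule emeasure_mono[OF interior_subset Ms])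
    finally show ?thesis .
  qed
  then have "measure haar M > 0" using Mf by (simp add: measure_def enn2real_positive_iff)
  moreover have "m 0 = measure haar M" by (simp add: m_def tr_def)
  ultimately have m00: "m 0 > 0" by simp
  \<comment> \<open>The change of \<open>m\<close> is at most the measure of a difference of
    \<open>t + M\<close> and \<open>t' + M\<close>; left invariance moves this back to a difference
    of \<open>M\<close> and its translate by \<open>- t + t'\<close>.\<close>
  have m_diff: "\<bar>m t' - m t\<bar> \<le> e"
    if w: "measure haar (tr (- t + t') - M) \<le> e" "measure haar (M - tr (- t + t')) \<le> e" for t t' e
  proof -
    have fm: "A \<in> fmeasurable haar" if "A \<in> sets haar" "A \<subseteq> tr s" for A s
      using trs trf that emeasure_mono[OF that(2) trs] by (auto simp: fmeasurable_def intro: le_less_trans)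
    have le: "measure haar A \<le> measure haar B + measure haar C"
      if "A \<subseteq> B \<union> C" "A \<in> sets haar" "B \<in> fmeasurable haar" "C \<in> fmeasurable haar" for A B C :: "'g set"
    proof -
      have "measure haar A \<le> measure haar (B \<union> C)"
        by (rule measure_mono_fmeasurable) (use that in auto)
      also have "\<dots> \<le> measure haar B + measure haar C"
        by (rule measure_Un_le) (use that in auto)
      finally show ?thesis .
    qed
    have sh: "measure haar ((\<lambda>s. t + s) ` A) = measure haar A" if "A \<in> sets haar" for A
      using that by (simp add: measure_def haar_left_invariant)
    have tt: "tr t' = (\<lambda>s. t + s) ` tr (- t + t')"
      by (simp add: tr_def image_image group_add_assoc_simps del: add_uminus_conv_diff)
    have 1: "tr t' - tr t = (\<lambda>s. t + s) ` (tr (- t + t') - M)"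
      "tr t - tr t' = (\<lambda>s. t + s) ` (M - tr (- t + t'))"
      unfolding tt tr_def[of t] by (simp_all add: image_set_diff[symmetric])
    have 2: "measure haar (tr t' - tr t) \<le> e" "measure haar (tr t - tr t') \<le> e"
      unfolding 1 using w trs Ms by (simp_all add: sh sets.Diff)
    have "m t' \<le> m t + measure haar (tr t' - tr t)" "m t \<le> m t' + measure haar (tr t - tr t')"
      unfolding m_def by (rule le; use trs Ms in \<open>auto intro: fm\<close>)+
    then show ?thesis using 2 by simp
  qed
  define S where "S = conjugators g"
  define k where "k t = (SUP x\<in>S. m (x + t - x))" for t
  have S0: "S \<noteq> {}" using conjugators_self[of g] by (auto simp: S_def)
  have bdd: "bdd_above ((\<lambda>x. m (x + t - x)) ` S)" for t
    by (rule bdd_aboveI2[OF mM])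
  have up: "m (x + t - x) \<le> k t" if "x \<in> S" for x t
    unfolding k_def by (rule cSUP_upper[OF that bdd])
  have k0: "0 \<le> k t" for t using S0 up m0 order_trans by blast
  have "\<exists>U. open U \<and> t \<in> U \<and> (\<forall>t'\<in>U. norm (k t' - k t) \<le> e)" if e: "e > 0" for t e
  proof -
    obtain X where X: "open X" "0 \<in> X"
      "\<forall>w\<in>X. measure haar (tr w - M) \<le> e \<and> measure haar (M - tr w) \<le> e"
      using translation_measure_diff[OF M(1) e] unfolding tr_def by blast
    \<comment> \<open>Invariance of \<open>N'\<close> puts the conjugate of \<open>- t + t'\<close>
      by every \<open>x\<close> in \<open>S\<close> back into \<open>N'\<close>, so one
      neighbourhood serves all members of the family.\<close>
    obtain N' where N': "compact N'" "0 \<in> interior N'" "N' \<subseteq> X" "invariant_under g N'"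
      using invariant_neighbourhood_basisE[OF basis X(1,2)] .
    have le: "\<bar>m (x + t' - x) - m (x + t - x)\<bar> \<le> e" if "- t + t' \<in> N'" "x \<in> S" for t t' x
    proof -
      have "- (x + t - x) + (x + t' - x) = x + (- t + t') - x"
        by (simp add: group_add_assoc_simps del: add_uminus_conv_diff)
      then have "- (x + t - x) + (x + t' - x) \<in> X"
        using conjugators_invariant[OF _ N'(1,4)] that N'(3) by (auto simp: S_def)
      then show ?thesis using X(3) by (intro m_diff) auto
    qed
    have le2: "k t' \<le> k t + e" "k t \<le> k t' + e" if t': "- t + t' \<in> N'" for t'
    proof -
      have "m (x + t' - x) \<le> k t + e" "m (x + t - x) \<le> k t' + e" if "x \<in> S" for x
        using le[OF t' that] up[OF that, of t] up[OF that, of t'] by linarith+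
      then show "k t' \<le> k t + e" "k t \<le> k t' + e"
        unfolding k_def[of t'] k_def[of t] using S0 by (auto simp: k_def intro!: cSUP_least)
    qed
    define U where "U = (\<lambda>t'. - t + t') -` interior N'"
    have "open U" unfolding U_def by (intro open_vimage open_interior continuous_intros)
    moreover have "t \<in> U" using N' by (simp add: U_def)
    moreover have "norm (k t' - k t) \<le> e" if "t' \<in> U" for t'
      using le2[of t'] that interior_subset[of N'] by (auto simp: U_def abs_le_iff)
    ultimately show ?thesis by blast
  qed
  then have k_cont: "continuous_on UNIV k" by (rule continuous_on_UNIV_normI)
  have k_minus: "k (- t) = k t" for t
  proof -
    have "x + - t - x = - (x + t - x)" for x
      by (simp add: group_add_assoc_simps del: add_uminus_conv_diff)
    then have "m (x + - t - x) = m (x + t - x)" for x by (metis m_minus)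
    then show ?thesis unfolding k_def by simp
  qed
  have k_conj: "k (g + t - g) = k t" for t
  proof -
    have c: "x + (g + t - g) - x = (x + g) + t - (x + g)" for x
      by (simp add: group_add_assoc_simps del: add_uminus_conv_diff)
    \<comment> \<open>Replacing \<open>t\<close> by \<open>g + t - g\<close> only reindexes the
      supremum by \<open>x + g\<close>.\<close>
    have "(\<lambda>x. x + g) ` S = S"
    proof (intro equalityI subsetI)
      fix x assume "x \<in> S"
      then have "x - g \<in> S" "x = (x - g) + g" by (auto simp: S_def conjugators_diff_self)
      then show "x \<in> (\<lambda>x. x + g) ` S" by blast
    qed (auto simp: S_def conjugators_add conjugators_self)
    then have "(\<lambda>x. m (x + t - x)) ` S = (\<lambda>x. m (x + t - x)) ` (\<lambda>x. x + g) ` S" by (rule arg_cong[OF sym])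
    also have "\<dots> = (\<lambda>x. m (x + (g + t - g) - x)) ` S" unfolding c image_image ..
    finally show ?thesis by (simp add: k_def)
  qed
  have kN: "k t = 0" if "t \<notin> N" for t
  proof -
    have "m (x + t - x) = 0" if "x \<in> S" for x
      using conjugators_invariant[OF _ N(1,4)] that \<open>t \<notin> N\<close> by (intro mN) (auto simp: S_def)
    then show ?thesis unfolding k_def using S0 by (simp cong: SUP_cong)
  qed
  have "k 0 > 0"
    using up[of 0 0] m00 conjugators_zero[of g] by (simp add: S_def)
  have "integral\<^sup>L haar k > 0"
  proof -
    define P where "P = {t. k t > k 0 / 2}"
    have P: "open P" unfolding P_def by (intro open_Collect_less continuous_intros k_cont)
    have "P \<noteq> {}" using \<open>k 0 > 0\<close> by (auto simp: P_def intro!: exI[of _ 0])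
    have PN: "P \<subseteq> N" using kN \<open>k 0 > 0\<close> by (force simp: P_def)
    have Pf: "emeasure haar P < \<infinity>"
      using emeasure_mono[OF PN sets_haar_compact[OF N(1)]] haar_compact_finite[OF N(1)] by (rule le_less_trans)
    then have "measure haar P > 0"
      using haar_open_pos[OF P \<open>P \<noteq> {}\<close>] by (simp add: measure_def enn2real_positive_iff)
    then have "0 < k 0 / 2 * measure haar P" using \<open>k 0 > 0\<close> by simp
    also have "\<dots> = (LINT t|haar. k 0 / 2 * indicat_real P t)" using sets_haar_open[OF P] by simp
    also have "\<dots> \<le> integral\<^sup>L haar k"
    proof (rule integral_mono)
      show "integrable haar (\<lambda>t. k 0 / 2 * indicat_real P t)"
        using Pf sets_haar_open[OF P] by (intro integrable_mult_right integrable_real_indicator) auto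
      show "integrable haar k" by (rule integrable_haar_compact_support[OF k_cont N(1) kN])
    qed (auto simp: indicator_def k0 P_def)
    finally show ?thesis .
  qed
  with k_cont k0 k_minus k_conj N kN show ?thesis by (intro that[of k N]) auto
qed

text \<open>Write \<open>c\<close> for the conjugation and integrate
  \<open>k (- c s + t) u (c s)\<close> over \<open>s\<close> and \<open>t\<close>. Integration in
  \<open>t\<close> first gives \<open>I\<close> times the integral of \<open>u\<close> along
  \<open>c\<close>. Integration in \<open>s\<close> first gives almost \<open>I\<close> times the
  integral of \<open>u\<close>, because \<open>k\<close> vanishes unless \<open>c s\<close> is close
  to \<open>t\<close>. Fubini equates the two, up to an error that tends to 0 as the support of
  \<open>k\<close> shrinks.\<close>

lemma integral_haar_conjugation:
  fixes g :: "'g::locally_compact_group" and u :: "'g \<Rightarrow> 'b::{banach, second_countable_topology}"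
  assumes basis: "invariant_neighbourhood_basis g"
    and u: "continuous_on UNIV u" and K: "compact K" "\<And>t. t \<notin> K \<Longrightarrow> u t = 0"
  shows "(LINT s|haar. u (g + s - g)) = integral\<^sup>L haar u"
proof -
  define c where "c s = g + s - g" for s
  define c' where "c' s = - g + s + g" for s
  have cc': "c (c' s) = s" "c' (c s) = s" for s
    by (simp_all add: c_def c'_def group_add_assoc_simps del: add_uminus_conv_diff)
  have cont_c: "continuous_on UNIV c" "continuous_on UNIV c'"
    unfolding c_def c'_def by (intro continuous_intros)+
  obtain N0 where N0: "compact N0" "0 \<in> interior N0" "N0 \<subseteq> UNIV" "invariant_under g N0"
    using invariant_neighbourhood_basisE[OF basis open_UNIV UNIV_I] .
  \<comment> \<open>This set contains the support in \<open>t\<close> for every kernel carried by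
    \<open>N0\<close>. It is fixed before \<open>e\<close>, so the bound below tends to 0 with
    \<open>e\<close>.\<close>
  define L where "L = {x + y | x y. x \<in> K \<and> y \<in> N0} \<union> K"
  have L: "compact L" unfolding L_def by (intro compact_Un compact_sum_set K N0)
  have c'K: "compact (c' ` K)"
    by (rule compact_continuous_image[OF continuous_on_subset[OF cont_c(2)] K(1)]) simp
  have uc: "continuous_on UNIV (\<lambda>s. u (c s))"
    by (rule continuous_on_compose2[OF u cont_c(1)]) simp
  have intu: "integrable haar u" by (rule integrable_haar_compact_support[OF u K])
  have bound: "norm ((LINT s|haar. u (c s)) - integral\<^sup>L haar u) \<le> e * measure haar L" if e: "e > 0" for e
  proof -
    obtain X where X: "open X" "0 \<in> X" "\<forall>x t. - t + x \<in> X \<longrightarrow> norm (u x - u t) \<le> e"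
      using uniformly_continuous_compact_support[OF u K e] by blast
    have "open (X \<inter> interior N0)" "0 \<in> X \<inter> interior N0" using X N0 by auto
    then obtain k :: "'g \<Rightarrow> real" and N where k: "continuous_on UNIV k" "\<forall>t. 0 \<le> k t"
      "\<forall>t. k (- t) = k t" "\<forall>t. k (g + t - g) = k t" "compact N" "N \<subseteq> X \<inter> interior N0"
      "\<forall>t. t \<notin> N \<longrightarrow> k t = 0" "integral\<^sup>L haar k > 0"
      by (rule invariant_bump[OF basis]) (rule that)
    define I where "I = integral\<^sup>L haar k"
    define F where "F = (\<lambda>p. k (- c (fst p) + snd p) *\<^sub>R u (c (fst p)))"
    have NX: "N \<subseteq> X" and NN0: "N \<subseteq> N0" using k(6) interior_subset[of N0] by auto
    have kint: "integrable haar k" using k by (intro integrable_haar_compact_support[OF k(1) k(5)]) auto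
    have kmeas: "k \<in> borel_measurable haar" using kint by simp
    \<comment> \<open>Evenness and invariance of \<open>k\<close> exhibit the kernel as a left
      translate in \<open>s\<close> as well, so by left invariance its integral is \<open>I\<close>
      in either variable. This is where the invariance of \<open>k\<close> is used.\<close>
    have kc: "k (- c s + t) = k (- c' t + s)" for s t
    proof -
      have "- c s + t = - c (- c' t + s)"
        by (simp add: c_def c'_def group_add_assoc_simps del: add_uminus_conv_diff)
      then show ?thesis using k(3,4) by (metis c_def)
    qed
    have tr_int: "integrable haar (\<lambda>t. k (s + t))" for s
    proof -
      have "compact ((\<lambda>t. - s + t) ` N)"
        by (intro compact_continuous_image continuous_intros k)
      moreover have "continuous_on UNIV (\<lambda>t. k (s + t))"
        by (rule continuous_on_compose2[OF k(1)]) (auto intro!: continuous_intros)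
      moreover have "k (s + t) = 0" if "t \<notin> (\<lambda>t. - s + t) ` N" for t
        using that k(7) by (auto simp: image_translation_eq_vimage)
      ultimately show ?thesis by (intro integrable_haar_compact_support)
    qed
    have tr_I: "(LINT t|haar. k (s + t)) = I" for s
      unfolding I_def by (rule integral_haar_translation[OF kmeas])
    have F0: "F (s, t) = 0" if "s \<notin> c' ` K \<or> t \<notin> L" for s t
    proof (rule ccontr)
      assume "F (s, t) \<noteq> 0"
      then have 1: "c s \<in> K" "- c s + t \<in> N" using K k(7) by (auto simp: F_def)
      then have "s \<in> c' ` K" by (metis cc'(2) imageI)
      moreover have "t = c s + (- c s + t)" by simp
      then have "t \<in> L" using 1 NN0 unfolding L_def by blast
      ultimately show False using that by simp
    qed
    have "continuous_on UNIV F"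
      unfolding F_def
      by (intro continuous_on_scaleR continuous_on_compose2[OF k(1)] continuous_on_compose2[OF uc]
          continuous_intros continuous_on_compose2[OF cont_c(1)]) auto
    from Fubini_compact_support[OF this c'K L F0]
    have Fub: "(LINT s|haar. LINT t|haar. F (s, t)) = (LINT t|haar. LINT s|haar. F (s, t))" .
    have "(LINT s|haar. LINT t|haar. F (s, t)) = (LINT s|haar. I *\<^sub>R u (c s))"
      using tr_int by (simp add: F_def tr_I)
    then have left: "(LINT s|haar. LINT t|haar. F (s, t)) = I *\<^sub>R (LINT s|haar. u (c s))"
      by simp
    have F2c: "continuous_on UNIV (\<lambda>t. LINT s|haar. F (s, t))"
      using continuous_integral_compact_support[of "\<lambda>(t, s). F (s, t)", OF _ c'K] F0
        continuous_on_compose2[OF \<open>continuous_on UNIV F\<close>, of UNIV "\<lambda>p. (snd p, fst p)"]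
      by (simp add: case_prod_beta continuous_on_Pair continuous_on_fst continuous_on_snd continuous_on_id)
    have F2: "integrable haar (\<lambda>t. LINT s|haar. F (s, t))"
      by (rule integrable_haar_compact_support[OF F2c L]) (simp add: F0)
    have intF: "integrable haar (\<lambda>s. F (s, t))" for t
      by (rule integrable_haar_compact_support[OF _ c'K])
        (auto simp: F0 intro!: continuous_on_compose2[OF \<open>continuous_on UNIV F\<close>] continuous_intros)
    have "norm ((LINT s|haar. F (s, t)) - I *\<^sub>R u t) \<le> e * I" for t
    proof -
      have "I *\<^sub>R u t = (LINT s|haar. k (- c s + t) *\<^sub>R u t)"
        unfolding kc using tr_int by (simp add: tr_I)
      then have "(LINT s|haar. F (s, t)) - I *\<^sub>R u t = (LINT s|haar. F (s, t) - k (- c s + t) *\<^sub>R u t)"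
        using intF tr_int by (simp add: kc)
      also have "norm \<dots> \<le> (LINT s|haar. e * k (- c s + t))"
      proof (rule norm_integral_le)
        show "integrable haar (\<lambda>s. e * k (- c s + t))" unfolding kc by (intro integrable_mult_right tr_int)
        fix s
        have "norm (F (s, t) - k (- c s + t) *\<^sub>R u t) = k (- c s + t) * norm (u (c s) - u t)"
          using k(2) by (simp add: F_def flip: scaleR_diff_right)
        also have "\<dots> \<le> k (- c s + t) * e"
        proof (cases "- c s + t \<in> N")
          case True
          then have "norm (u t - u (c s)) \<le> e" using X(3) NX by blast
          then show ?thesis using k(2) by (intro mult_left_mono) (auto simp: norm_minus_commute)
        qed (use k(7) in simp)
        finally show "norm (F (s, t) - k (- c s + t) *\<^sub>R u t) \<le> e * k (- c s + t)" by (simp add: mult.commute)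
      qed
      also have "\<dots> = e * I" unfolding kc by (simp add: tr_I)
      finally show ?thesis .
    qed
    moreover have "(LINT s|haar. F (s, t)) - I *\<^sub>R u t = 0" if "t \<notin> L" for t
      using that F0 K(2)[of t] by (simp add: L_def)
    ultimately have "norm (LINT t|haar. (LINT s|haar. F (s, t)) - I *\<^sub>R u t) \<le> e * I * measure haar L"
      by (intro norm_integral_le_compact[OF L])
    then have "norm (I *\<^sub>R (LINT s|haar. u (c s)) - I *\<^sub>R integral\<^sup>L haar u) \<le> e * I * measure haar L"
      using F2 intu by (simp add: Fub[symmetric] left)
    then have "I * norm ((LINT s|haar. u (c s)) - integral\<^sup>L haar u) \<le> I * (e * measure haar L)"
      using k(8) by (simp add: I_def ac_simps flip: scaleR_diff_right)
    then show ?thesis using k(8) by (simp add: I_def)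
  qed
  have "norm ((LINT s|haar. u (c s)) - integral\<^sup>L haar u) \<le> 0"
  proof (rule field_le_epsilon)
    fix e :: real assume e: "e > 0"
    have pos: "measure haar L + 1 > 0" by (simp add: add_nonneg_pos)
    have "norm ((LINT s|haar. u (c s)) - integral\<^sup>L haar u) \<le> e / (measure haar L + 1) * measure haar L"
      using e pos by (intro bound) simp
    also have "\<dots> \<le> e / (measure haar L + 1) * (measure haar L + 1)"
      using e pos by (intro mult_left_mono) auto
    also have "\<dots> = 0 + e" using pos by simp
    finally show "norm ((LINT s|haar. u (c s)) - integral\<^sup>L haar u) \<le> 0 + e" .
  qed
  then show ?thesis by (simp add: c_def)
qed

section \<open>Operators on square-integrable functions\<close>

lemma cinner_abs_L2:
  assumes "f \<in> square_integrable haar" "g \<in> square_integrable haar"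
  shows "cinner (abs_L2 f) (abs_L2 g) = (LINT t|haar. cinner (f t) (g t))"
  using assms by (simp add: cinner_L2_def cinner_L2_fun.abs_eq L2_rel_refl)

lemma norm_abs_L2:
  assumes "f \<in> square_integrable haar"
  shows "ennreal ((norm (abs_L2 f))\<^sup>2) = (\<integral>\<^sup>+ t. ennreal ((norm (f t))\<^sup>2) \<partial>haar)"
  using Re_cinner_L2_self(1)[OF assms] cinner_abs_L2[OF assms assms]
  by (simp add: power2_norm_eq_inner inner_eq_Re_cinner)

lemma norm_abs_L2_le:
  assumes "f \<in> square_integrable haar" "(\<integral>\<^sup>+ t. ennreal ((norm (f t))\<^sup>2) \<partial>haar) \<le> ennreal (e\<^sup>2)" "e \<ge> 0"
  shows "norm (abs_L2 f) \<le> e"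
proof -
  have "ennreal ((norm (abs_L2 f))\<^sup>2) \<le> ennreal (e\<^sup>2)" using assms norm_abs_L2 by metis
  then show ?thesis using assms(3) by (simp add: power2_le_iff_abs_le)
qed

lemma abs_L2_add:
  "f \<in> square_integrable haar \<Longrightarrow> g \<in> square_integrable haar \<Longrightarrow>
    abs_L2 (\<lambda>t. f t + g t) = abs_L2 f + abs_L2 g"
  by (simp add: L2_abs_simps L2_rel_refl)

lemma abs_L2_diff:
  "f \<in> square_integrable haar \<Longrightarrow> g \<in> square_integrable haar \<Longrightarrow>
    abs_L2 (\<lambda>t. f t - g t) = abs_L2 f - abs_L2 g"
  by (simp add: L2_abs_simps L2_rel_refl)

lemma abs_L2_scaleC:
  "f \<in> square_integrable haar \<Longrightarrow> abs_L2 (\<lambda>t. c *\<^sub>C f t) = c *\<^sub>C abs_L2 f"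
  by (simp add: scaleC_L2.abs_eq L2_rel_refl)

lemma L2_repE:
  obtains f where "f \<in> square_integrable haar" "x = abs_L2 f"
  by (metis L2_ex_rep L2_rel_refl)

lemma square_integrable_scaleC:
  fixes f :: "'a \<Rightarrow> 'b::complex_hilbert_space"
  shows "f \<in> square_integrable M \<Longrightarrow> (\<lambda>t. c *\<^sub>C f t) \<in> square_integrable M"
  by (rule square_integrable_bounded_linear[OF _ bounded_linear_scaleC])

text \<open>\<open>L2_operator\<close> is a definite description, so existence and uniqueness both
  have to be shown. The operator is built from chosen representatives; the bound makes it
  independent of the choice, because two representatives of one class differ by a function of norm
  0.\<close>

lemma L2_operator_apply:
  fixes \<Phi> :: "('g::locally_compact_group \<Rightarrow> 'h::complex_hilbert_space) \<Rightarrow> 'g \<Rightarrow> 'h"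
  assumes SI: "\<And>f. f \<in> square_integrable haar \<Longrightarrow> \<Phi> f \<in> square_integrable haar"
    and add: "\<And>f g. \<Phi> (\<lambda>t. f t + g t) = (\<lambda>t. \<Phi> f t + \<Phi> g t)"
    and sc: "\<And>c f. \<Phi> (\<lambda>t. c *\<^sub>C f t) = (\<lambda>t. c *\<^sub>C \<Phi> f t)"
    and bound: "\<And>f. f \<in> square_integrable haar \<Longrightarrow>
      (\<integral>\<^sup>+ t. ennreal ((norm (\<Phi> f t))\<^sup>2) \<partial>haar) \<le> ennreal (C\<^sup>2) * (\<integral>\<^sup>+ t. ennreal ((norm (f t))\<^sup>2) \<partial>haar)"
    and C: "C \<ge> 0"
  shows "f \<in> square_integrable haar \<Longrightarrow> bop_apply (L2_operator \<Phi>) (abs_L2 f) = abs_L2 (\<Phi> f)"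
    and "norm (L2_operator \<Phi>) \<le> C"
proof -
  have n: "norm (abs_L2 (\<Phi> f)) \<le> C * norm (abs_L2 f)" if "f \<in> square_integrable haar" for f
  proof (rule norm_abs_L2_le[OF SI[OF that]])
    show "(\<integral>\<^sup>+ t. ennreal ((norm (\<Phi> f t))\<^sup>2) \<partial>haar) \<le> ennreal ((C * norm (abs_L2 f))\<^sup>2)"
      using bound[OF that] C by (simp add: power_mult_distrib ennreal_mult norm_abs_L2[OF that, symmetric])
  qed (use C in simp)
  have diff: "\<Phi> (\<lambda>t. f t - g t) = (\<lambda>t. \<Phi> f t - \<Phi> g t)" for f g
    using add[of "\<lambda>t. f t - g t" g] by (auto simp: fun_eq_iff algebra_simps)
  define r where "r x = (SOME f. f \<in> square_integrable haar \<and> x = abs_L2 f)" for x :: "('g, 'h) L2"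
  have r: "r x \<in> square_integrable haar" "abs_L2 (r x) = x" for x
  proof -
    have "\<exists>f. f \<in> square_integrable haar \<and> x = abs_L2 f" by (metis L2_repE)
    from someI_ex[OF this] show "r x \<in> square_integrable haar" "abs_L2 (r x) = x"
      by (simp_all add: r_def)
  qed
  define T where "T x = abs_L2 (\<Phi> (r x))" for x
  have T: "T (abs_L2 f) = abs_L2 (\<Phi> f)" if f: "f \<in> square_integrable haar" for f
  proof -
    define q where "q = r (abs_L2 f)"
    have q: "q \<in> square_integrable haar" "abs_L2 q = abs_L2 f" by (simp_all add: q_def r)
    have "norm (abs_L2 (\<Phi> (\<lambda>t. q t - f t))) \<le> C * norm (abs_L2 (\<lambda>t. q t - f t))"
      by (rule n) (intro square_integrable_diff q f)
    also have "abs_L2 (\<lambda>t. q t - f t) = 0" using q f by (simp add: abs_L2_diff)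
    finally have "abs_L2 (\<Phi> q) - abs_L2 (\<Phi> f) = 0"
      using q f by (simp add: diff abs_L2_diff SI)
    then show ?thesis by (simp add: T_def q_def)
  qed
  have Tadd: "T (x + y) = T x + T y" for x y
  proof -
    obtain f g where "f \<in> square_integrable haar" "x = abs_L2 f" "g \<in> square_integrable haar" "y = abs_L2 g"
      by (metis L2_repE)
    then show ?thesis
      by (simp add: T SI add abs_L2_add[symmetric] square_integrable_add)
  qed
  have Tsc: "T (c *\<^sub>C x) = c *\<^sub>C T x" for c x
  proof -
    obtain f where "f \<in> square_integrable haar" "x = abs_L2 f" by (metis L2_repE)
    then show ?thesis
      by (simp add: T SI sc abs_L2_scaleC[symmetric] square_integrable_scaleC)
  qed
  have Tn: "norm (T x) \<le> C * norm x" for x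
    using n[OF r(1)[of x]] by (simp add: T_def r)
  have "bounded_linear T"
    by (rule bounded_linear_intro[where K = C])
      (use Tn in \<open>simp_all add: Tadd Tsc scaleR_scaleC mult.commute\<close>)
  then have B: "bop_apply (Bop T) = T" by (intro Bop_inverse) (simp add: Tsc)
  have "L2_operator \<Phi> = Bop T"
    unfolding L2_operator_def
  proof (rule the_equality)
    show "\<forall>\<xi>\<in>square_integrable haar. \<Phi> \<xi> \<in> square_integrable haar \<and> bop_apply (Bop T) (abs_L2 \<xi>) = abs_L2 (\<Phi> \<xi>)"
      by (simp add: B SI T)
    fix S assume S: "\<forall>\<xi>\<in>square_integrable haar. \<Phi> \<xi> \<in> square_integrable haar \<and> bop_apply S (abs_L2 \<xi>) = abs_L2 (\<Phi> \<xi>)"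
    show "S = Bop T"
    proof (rule bop_eqI)
      fix x
      show "bop_apply S x = bop_apply (Bop T) x"
        using S r[of x] unfolding B by (metis T)
    qed
  qed
  then show "f \<in> square_integrable haar \<Longrightarrow> bop_apply (L2_operator \<Phi>) (abs_L2 f) = abs_L2 (\<Phi> f)"
    "norm (L2_operator \<Phi>) \<le> C"
    using Tn C by (auto simp: B T intro: norm_bop_bound)
qed

subsection \<open>Translations\<close>

lemma square_integrable_translation:
  fixes f :: "'g::locally_compact_group \<Rightarrow> 'h::real_normed_vector"
  assumes f: "f \<in> square_integrable haar"
  shows "(\<lambda>t. f (s + t)) \<in> square_integrable haar"
    and "(\<integral>\<^sup>+ t. ennreal ((norm (f (s + t)))\<^sup>2) \<partial>haar) = (\<integral>\<^sup>+ t. ennreal ((norm (f t))\<^sup>2) \<partial>haar)"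
proof -
  have sm: "strongly_measurable haar f" using f by (simp add: square_integrable_def)
  have "(\<lambda>t. norm (f t)) \<in> borel_measurable haar" by (rule borel_measurable_norm_strongly[OF sm])
  then have "(\<lambda>t. ennreal ((norm (f t))\<^sup>2)) \<in> borel_measurable haar" by measurable
  from nn_integral_haar_translation[OF this]
  show eq: "(\<integral>\<^sup>+ t. ennreal ((norm (f (s + t)))\<^sup>2) \<partial>haar) = (\<integral>\<^sup>+ t. ennreal ((norm (f t))\<^sup>2) \<partial>haar)" .
  have "strongly_measurable haar (\<lambda>t. f (s + t))"
    using sm measurable_compose[OF measurable_translation, of f borel s]
    unfolding strongly_measurable_def by blast
  then show "(\<lambda>t. f (s + t)) \<in> square_integrable haar"
    using f eq by (simp add: square_integrable_def)
qed

lemma translation_abs_L2: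
  fixes f :: "'g::locally_compact_group \<Rightarrow> 'h::complex_hilbert_space"
  assumes "f \<in> square_integrable haar"
  shows "bop_apply (translation s) (abs_L2 f) = abs_L2 (\<lambda>t. f (- s + t))"
  unfolding translation_def
  by (rule L2_operator_apply(1)[where C = 1])
    (simp_all add: square_integrable_translation assms)

lemma translation_translation:
  "bop_apply (translation s) (bop_apply (translation t) x) = bop_apply (translation (s + t)) x"
proof -
  obtain f where "f \<in> square_integrable haar" "x = abs_L2 f" by (rule L2_repE)
  then show ?thesis
    by (simp add: translation_abs_L2 square_integrable_translation group_add_assoc_simps del: add_uminus_conv_diff)
qed

lemma translation_zero: "bop_apply (translation 0) x = x"
proof -
  obtain f where "f \<in> square_integrable haar" "x = abs_L2 f" by (rule L2_repE)
  then show ?thesis by (simp add: translation_abs_L2)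
qed

lemma norm_translation_apply: "norm (bop_apply (translation s) x) = norm x"
proof -
  obtain f where f: "f \<in> square_integrable haar" "x = abs_L2 f" by (rule L2_repE)
  have "ennreal ((norm (bop_apply (translation s) x))\<^sup>2) = ennreal ((norm x)\<^sup>2)"
    unfolding f(2) translation_abs_L2[OF f(1)]
    by (simp add: norm_abs_L2 square_integrable_translation f)
  then show ?thesis by simp
qed

lemma cinner_translation:
  "cinner (bop_apply (translation s) x) (bop_apply (translation s) y) = cinner x y"
proof -
  obtain f where f: "f \<in> square_integrable haar" "x = abs_L2 f" by (rule L2_repE)
  obtain g where g: "g \<in> square_integrable haar" "y = abs_L2 g" by (rule L2_repE)
  have "(\<lambda>t. cinner (f t) (g t)) \<in> borel_measurable haar"
    using integrable_cinner[OF f(1) g(1)] by simp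
  from integral_haar_translation[OF this]
  show ?thesis
    by (simp add: f g translation_abs_L2 cinner_abs_L2 square_integrable_translation)
qed

lemma star_translation: "star (translation s) = translation (- s)"
proof (rule star_bop_eqI)
  fix x y :: "('a, 'b) L2"
  have "cinner x (bop_apply (translation (- s)) y)
      = cinner (bop_apply (translation s) x) (bop_apply (translation s) (bop_apply (translation (- s)) y))"
    by (simp only: cinner_translation)
  then show "cinner x (bop_apply (translation (- s)) y) = cinner (bop_apply (translation s) x) y"
    by (simp add: translation_translation translation_zero)
qed

subsection \<open>Indicator functions and density\<close>

text \<open>The elementary tensor of the indicator function of \<open>A\<close> with
  \<open>h\<close>.\<close>

definition L2_indicator :: "'g::locally_compact_group set \<Rightarrow> 'h::complex_hilbert_space \<Rightarrow> ('g, 'h) L2" where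
  "L2_indicator A h = abs_L2 (\<lambda>t. indicat_real A t *\<^sub>R h)"

lemma square_integrable_indicator:
  fixes h :: "'h::complex_hilbert_space"
  assumes A: "A \<in> sets haar" "emeasure haar A < \<infinity>"
  shows "(\<lambda>t. indicat_real A t *\<^sub>R h) \<in> square_integrable (haar :: 'g::locally_compact_group measure)"
proof -
  have "(\<integral>\<^sup>+ t. ennreal ((norm (indicat_real A t *\<^sub>R h))\<^sup>2) \<partial>haar) = (\<integral>\<^sup>+ t. ennreal ((norm h)\<^sup>2) * indicator A t \<partial>haar)"
    by (intro nn_integral_cong) (auto simp: indicator_def)
  also have "\<dots> = ennreal ((norm h)\<^sup>2) * emeasure haar A" using A by (simp add: nn_integral_cmult_indicator)
  also have "\<dots> < \<infinity>" using A by (simp add: ennreal_mult_less_top)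
  finally show ?thesis
    by (simp add: square_integrable_def strongly_measurable_indicator[OF strongly_measurable_const A(1)])
qed

lemma norm_L2_indicator_diff:
  fixes A B :: "'g::locally_compact_group set"
  assumes A: "A \<in> sets haar" "emeasure haar A < \<infinity>" and B: "B \<in> sets haar" "emeasure haar B < \<infinity>"
  shows "(norm (L2_indicator A h - L2_indicator B h))\<^sup>2
    = (measure haar (A - B) + measure haar (B - A)) * (norm h)\<^sup>2"
proof -
  note SI = square_integrable_indicator[OF A, of h] square_integrable_indicator[OF B, of h]
  have fin: "emeasure haar (A - B) < \<infinity>" "emeasure haar (B - A) < \<infinity>"
    using emeasure_mono[OF Diff_subset A(1)] A(2) emeasure_mono[OF Diff_subset B(1)] B(2)
    by (auto intro: le_less_trans)
  have "ennreal ((norm (L2_indicator A h - L2_indicator B h))\<^sup>2)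
      = (\<integral>\<^sup>+ t. ennreal ((norm (indicat_real A t *\<^sub>R h - indicat_real B t *\<^sub>R h))\<^sup>2) \<partial>haar)"
    unfolding L2_indicator_def using SI by (simp add: norm_abs_L2 square_integrable_diff flip: abs_L2_diff)
  also have "\<dots> = (\<integral>\<^sup>+ t. ennreal ((norm h)\<^sup>2) * indicator (A - B) t + ennreal ((norm h)\<^sup>2) * indicator (B - A) t \<partial>haar)"
    by (intro nn_integral_cong) (auto simp: indicator_def)
  also have "\<dots> = ennreal ((norm h)\<^sup>2) * emeasure haar (A - B) + ennreal ((norm h)\<^sup>2) * emeasure haar (B - A)"
    using A B by (subst nn_integral_add) (auto simp: nn_integral_cmult_indicator)
  also have "\<dots> = ennreal ((norm h)\<^sup>2) * ennreal (measure haar (A - B)) + ennreal ((norm h)\<^sup>2) * ennreal (measure haar (B - A))"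
    using fin by (simp add: emeasure_eq_ennreal_measure)
  also have "\<dots> = ennreal ((measure haar (A - B) + measure haar (B - A)) * (norm h)\<^sup>2)"
    by (simp add: ennreal_mult distrib_right distrib_left mult.commute)
  finally show ?thesis by (simp add: add_nonneg_nonneg)
qed

lemma norm_L2_indicator:
  fixes A :: "'g::locally_compact_group set" and h :: "'h::complex_hilbert_space"
  assumes A: "A \<in> sets haar" "emeasure haar A < \<infinity>"
  shows "(norm (L2_indicator A h))\<^sup>2 = measure haar A * (norm h)\<^sup>2"
proof -
  have "L2_indicator {} h = (0 :: ('g, 'h) L2)" by (simp add: L2_indicator_def zero_L2_def)
  then show ?thesis using norm_L2_indicator_diff[OF A, of "{}" h] by simp
qed

lemma L2_indicator_add:
  assumes "A \<in> sets haar" "emeasure haar A < \<infinity>"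
  shows "L2_indicator A (x + y) = L2_indicator A x + L2_indicator A y"
  using assms by (simp add: L2_indicator_def abs_L2_add[symmetric] square_integrable_indicator scaleR_add_right)

lemma L2_indicator_scaleC:
  assumes "A \<in> sets haar" "emeasure haar A < \<infinity>"
  shows "L2_indicator A (c *\<^sub>C x) = c *\<^sub>C L2_indicator A x"
  using assms by (simp add: L2_indicator_def abs_L2_scaleC[symmetric] square_integrable_indicator scaleC_scaleR)

lemma translation_L2_indicator:
  assumes "A \<in> sets haar" "emeasure haar A < \<infinity>"
  shows "bop_apply (translation s) (L2_indicator A x) = L2_indicator ((\<lambda>t. s + t) ` A) x"
  using assms
  by (simp add: L2_indicator_def translation_abs_L2 square_integrable_indicator image_translation_eq_vimage indicator_vimage)

text \<open>The approximants take the value nearest to \<open>f t\<close> among the first \<open>n + 1\<close> points of a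
  countable set which contains \<open>0\<close>, so their distance to \<open>f t\<close> is at most \<open>norm (f t)\<close>.\<close>

lemma L2_indicators_dense:
  fixes S :: "('g::locally_compact_group, 'h::complex_hilbert_space) L2 set"
  assumes S: "closed S" "subspace S"
    and ind: "\<And>A h. A \<in> sets haar \<Longrightarrow> emeasure haar A < \<infinity> \<Longrightarrow> L2_indicator A h \<in> S"
  shows "x \<in> S"
proof -
  obtain f where f: "f \<in> square_integrable haar" "x = abs_L2 f" by (rule L2_repE)
  have sm: "strongly_measurable haar f" and fin: "(\<integral>\<^sup>+ t. ennreal ((norm (f t))\<^sup>2) \<partial>haar) < \<infinity>"
    using f(1) by (auto simp: square_integrable_def)
  obtain D where D: "countable D" "range f \<subseteq> closure D" using sm by (auto simp: strongly_measurable_def)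
  define d where "d = from_nat_into (insert 0 D)"
  \<comment> \<open>Shifted so that index 0 carries the vector 0, which is then a candidate for
    every \<open>n\<close>.\<close>
  define d' where "d' i = (if i = 0 then 0 else d (i - 1))" for i :: nat
  have range_d: "D \<subseteq> range d'"
  proof
    fix y assume "y \<in> D"
    then obtain i where "d i = y" using from_nat_into_surj[of "insert 0 D" y] D by (auto simp: d_def)
    then have "d' (Suc i) = y" by (simp add: d'_def)
    then show "y \<in> range d'" by blast
  qed
  have d0: "d' 0 = 0" by (simp add: d'_def)
  define P where "P n i t \<longleftrightarrow> i \<le> n \<and> (\<forall>j\<in>{..n}. norm (f t - d' i) \<le> norm (f t - d' j))" for n i :: nat and t
  \<comment> \<open>Ties are broken by the least index, which makes the choice measurable in
    \<open>t\<close>.\<close>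
  define w where "w n t = (LEAST i. P n i t)" for n t
  have P_ex: "\<exists>i. P n i t" for n t
  proof -
    obtain i where "is_arg_min (\<lambda>i. norm (f t - d' i)) (\<lambda>i. i \<in> {..n}) i"
      using ex_is_arg_min_if_finite[of "{..n}" "\<lambda>i. norm (f t - d' i)"] by auto
    then show ?thesis by (auto simp: P_def is_arg_min_linorder)
  qed
  have Pw: "P n (w n t) t" for n t unfolding w_def by (rule LeastI_ex[OF P_ex])
  have smd: "strongly_measurable haar (\<lambda>t. f t - c)" for c
    using strongly_measurable_image[OF sm, of "\<lambda>x. x - c"] by (simp add: continuous_intros)
  have [measurable]: "(\<lambda>t. norm (f t - c)) \<in> borel_measurable haar" for c
    by (rule borel_measurable_norm_strongly[OF smd])
  have [measurable]: "(\<lambda>t. norm (f t)) \<in> borel_measurable haar"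
    by (rule borel_measurable_norm_strongly[OF sm])
  have meas_P: "Measurable.pred haar (P n i)" for n i
    unfolding P_def by measurable
  have w_meas[measurable]: "w n \<in> haar \<rightarrow>\<^sub>M count_space UNIV" for n
    unfolding w_def by (rule measurable_Least[OF meas_P])
  define B where "B n i = {t. w n t = i}" for n i
  have B_meas: "B n i \<in> sets haar" for n i
  proof -
    have "w n -` {i} \<inter> space haar \<in> sets haar" by (rule measurable_sets[OF w_meas]) simp
    moreover have "w n -` {i} \<inter> space haar = B n i" by (auto simp: B_def)
    ultimately show ?thesis by simp
  qed
  have le_f: "norm (f t - d' (w n t)) \<le> norm (f t)" for n t
    using Pw[of n t] d0 by (force simp: P_def)
  \<comment> \<open>Chebyshev's inequality: where a nonzero \<open>d' i\<close> is at least as near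
    to \<open>f t\<close> as 0 is, the norm of \<open>f t\<close> is at least half that of
    \<open>d' i\<close>.\<close>
  have B_fin: "emeasure haar (B n i) < \<infinity>" if "d' i \<noteq> 0" for n i
  proof -
    define c where "c = ennreal ((norm (d' i) / 2)\<^sup>2)"
    have c: "c > 0" using that by (simp add: c_def)
    have "c * emeasure haar (B n i) = (\<integral>\<^sup>+ t. c * indicator (B n i) t \<partial>haar)"
      using B_meas by (simp add: nn_integral_cmult_indicator)
    also have "\<dots> \<le> (\<integral>\<^sup>+ t. ennreal ((norm (f t))\<^sup>2) \<partial>haar)"
    proof (rule nn_integral_mono)
      fix t
      show "c * indicator (B n i) t \<le> ennreal ((norm (f t))\<^sup>2)"
      proof (cases "t \<in> B n i")
        case True
        then have "norm (f t - d' i) \<le> norm (f t)" using le_f[of t n] by (simp add: B_def)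
        then have "norm (d' i) / 2 \<le> norm (f t)" using norm_triangle_ineq2[of "d' i" "f t"] by (simp add: norm_minus_commute)
        then have "(norm (d' i) / 2)\<^sup>2 \<le> (norm (f t))\<^sup>2" by (intro power_mono) auto
        then show ?thesis using True by (simp add: c_def ennreal_leI)
      qed simp
    qed
    finally have "c * emeasure haar (B n i) < \<infinity>" using fin by simp
    then show ?thesis using c by (auto simp: ennreal_mult_less_top)
  qed
  define s where "s n t = d' (w n t)" for n t
  \<comment> \<open>Indices with value 0 are left out: their sets may have infinite measure, and
    \<open>L2_indicator\<close> would not be meaningful on them.\<close>
  have s_sum: "s n = (\<lambda>t. \<Sum>i\<in>{i. i \<le> n \<and> d' i \<noteq> 0}. indicat_real (B n i) t *\<^sub>R d' i)" for n
  proof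
    fix t
    have "w n t \<le> n" using Pw[of n t] by (simp add: P_def)
    then have "s n t = (\<Sum>i\<in>{w n t} \<inter> {i. d' i \<noteq> 0}. indicat_real (B n i) t *\<^sub>R d' i)"
      by (cases "d' (w n t) = 0") (auto simp: s_def B_def)
    also have "\<dots> = (\<Sum>i\<in>{i. i \<le> n \<and> d' i \<noteq> 0}. indicat_real (B n i) t *\<^sub>R d' i)"
      using \<open>w n t \<le> n\<close> by (intro sum.mono_neutral_left) (auto simp: B_def indicator_def split: if_splits)
    finally show "s n t = (\<Sum>i\<in>{i. i \<le> n \<and> d' i \<noteq> 0}. indicat_real (B n i) t *\<^sub>R d' i)" .
  qed
  have "(\<lambda>t. \<Sum>i\<in>I. indicat_real (B n i) t *\<^sub>R d' i) \<in> square_integrable haar \<and>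
      abs_L2 (\<lambda>t. \<Sum>i\<in>I. indicat_real (B n i) t *\<^sub>R d' i) = (\<Sum>i\<in>I. L2_indicator (B n i) (d' i))"
    if "finite I" "I \<subseteq> {i. d' i \<noteq> 0}" for I n
    using that
  proof (induction I)
    case empty
    show ?case by (simp add: square_integrable_zero zero_L2_def)
  next
    case (insert i I)
    then have "(\<lambda>t. indicat_real (B n i) t *\<^sub>R d' i) \<in> square_integrable haar"
      by (intro square_integrable_indicator B_meas B_fin) auto
    with insert show ?case
      by (simp add: square_integrable_add abs_L2_add L2_indicator_def del: sum_indicator_scaleR)
  qed
  from this[of "{i. i \<le> n \<and> d' i \<noteq> 0}" n for n]
  have sn: "s n \<in> square_integrable haar"
    "abs_L2 (s n) = (\<Sum>i\<in>{i. i \<le> n \<and> d' i \<noteq> 0}. L2_indicator (B n i) (d' i))" for n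
    unfolding s_sum by auto
  have snS: "abs_L2 (s n) \<in> S" for n
    unfolding sn(2) by (intro subspace_sum[OF S(2)] ind B_meas B_fin) auto
  have lim: "(\<lambda>n. s n t) \<longlonglongrightarrow> f t" for t
  proof (rule metric_LIMSEQ_I)
    fix e :: real assume "e > 0"
    then obtain y where y: "y \<in> D" "dist y (f t) < e"
      using D(2) closure_approachable[of "f t" D] by blast
    then obtain j where j: "y = d' j" using range_d by blast
    have "dist (s n t) (f t) < e" if "n \<ge> j" for n
      using Pw[of n t] that y j by (force simp: P_def s_def dist_norm norm_minus_commute)
    then show "\<exists>N. \<forall>n\<ge>N. dist (s n t) (f t) < e" by blast
  qed
  have "(\<lambda>n. \<integral>\<^sup>+ t. ennreal ((norm (f t - s n t))\<^sup>2) \<partial>haar) \<longlonglongrightarrow> (\<integral>\<^sup>+ t. 0 \<partial>(haar :: 'g measure))"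
  proof (rule nn_integral_dominated_convergence[where w = "\<lambda>t. ennreal ((norm (f t))\<^sup>2)"])
    show "(\<lambda>t. ennreal ((norm (f t - s n t))\<^sup>2)) \<in> borel_measurable haar" for n
    proof -
      have "strongly_measurable haar (\<lambda>t. f t - s n t)"
        using square_integrable_diff[OF f(1) sn(1)] by (simp add: square_integrable_def)
      note [measurable] = borel_measurable_norm_strongly[OF this]
      show ?thesis by measurable
    qed
    show "AE t in haar. ennreal ((norm (f t - s n t))\<^sup>2) \<le> ennreal ((norm (f t))\<^sup>2)" for n
      using le_f by (intro AE_I2 ennreal_leI power_mono) (auto simp: s_def)
    have "(\<lambda>n. ennreal ((norm (f t - s n t))\<^sup>2)) \<longlonglongrightarrow> ennreal ((norm (f t - f t))\<^sup>2)" for t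
      by (intro tendsto_intros lim tendsto_ennrealI)
    then show "AE t in haar. (\<lambda>n. ennreal ((norm (f t - s n t))\<^sup>2)) \<longlonglongrightarrow> 0" by simp
  qed (use fin in auto)
  then have conv: "(\<lambda>n. \<integral>\<^sup>+ t. ennreal ((norm (f t - s n t))\<^sup>2) \<partial>haar) \<longlonglongrightarrow> 0" by simp
  have "x \<in> closure S"
    unfolding closure_approachable
  proof (intro allI impI)
    fix e :: real assume e: "e > 0"
    then have "ennreal ((e/2)\<^sup>2) > 0" by simp
    then have "\<forall>\<^sub>F n in sequentially. (\<integral>\<^sup>+ t. ennreal ((norm (f t - s n t))\<^sup>2) \<partial>haar) < ennreal ((e/2)\<^sup>2)"
      using conv by (rule order_tendstoD(2)[rotated])
    then obtain n where "(\<integral>\<^sup>+ t. ennreal ((norm (f t - s n t))\<^sup>2) \<partial>haar) < ennreal ((e/2)\<^sup>2)"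
      by (auto simp: eventually_sequentially)
    then have "norm (abs_L2 (\<lambda>t. f t - s n t)) \<le> e/2"
      using e by (intro norm_abs_L2_le square_integrable_diff f sn) auto
    then have "dist (abs_L2 (s n)) x < e"
      using e f sn by (simp add: abs_L2_diff dist_norm norm_minus_commute)
    then show "\<exists>y\<in>S. dist y x < e" using snS by blast
  qed
  then show ?thesis using S(1) by (simp add: closure_closed)
qed


text \<open>Since translations are isometric, the vectors at which they are continuous at the
  identity form a closed subspace. It contains the indicators of compact sets by
  \<open>translation_measure_diff\<close>, those of sets of finite measure by regularity, and then
  everything by density. Continuity elsewhere follows by translating.\<close>

lemma continuous_translation:
  fixes x :: "('g::locally_compact_group, 'h::complex_hilbert_space) L2"
  shows "continuous_on UNIV (\<lambda>s. bop_apply (translation s) x)"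
proof -
  define S where "S = {x :: ('g, 'h) L2. \<forall>e>0. \<exists>W. open W \<and> 0 \<in> W \<and>
    (\<forall>w\<in>W. norm (bop_apply (translation w) x - x) \<le> e)}"
  have SI: "x \<in> S" if near: "\<And>e. e > 0 \<Longrightarrow> \<exists>y\<in>S. norm (x - y) \<le> e" for x
    unfolding S_def mem_Collect_eq
  proof (intro allI impI)
    fix e :: real assume "e > 0"
    then obtain y where y: "y \<in> S" "norm (x - y) \<le> e/3" using near[of "e/3"] by auto
    then obtain W where W: "open W" "0 \<in> W" "\<forall>w\<in>W. norm (bop_apply (translation w) y - y) \<le> e/3"
      using \<open>e > 0\<close> unfolding S_def mem_Collect_eq by (meson divide_pos_pos zero_less_numeral)
    have "norm (bop_apply (translation w) x - x) \<le> e" if "w \<in> W" for w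
    proof -
      interpret T: bounded_linear "bop_apply (translation w :: ('g, 'h) L2 bop)" by (rule bounded_linear_bop_apply)
      have "bop_apply (translation w) x - x
          = bop_apply (translation w) (x - y) + (bop_apply (translation w) y - y) - (x - y)"
        by (simp add: T.diff)
      also have "norm \<dots> \<le> norm (bop_apply (translation w) (x - y) + (bop_apply (translation w) y - y)) + norm (x - y)"
        by (rule norm_triangle_ineq4)
      also have "\<dots> \<le> norm (x - y) + norm (bop_apply (translation w) y - y) + norm (x - y)"
        using norm_triangle_ineq[of "bop_apply (translation w) (x - y)" "bop_apply (translation w) y - y"]
        by (simp add: norm_translation_apply)
      also have "\<dots> \<le> e" using y(2) bspec[OF W(3) that] by linarith
      finally show ?thesis .
    qed
    then show "\<exists>W. open W \<and> 0 \<in> W \<and> (\<forall>w\<in>W. norm (bop_apply (translation w) x - x) \<le> e)"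
      using W(1,2) by blast
  qed
  have Scl: "closed S"
  proof -
    have "closure S \<subseteq> S"
    proof
      fix x assume x: "x \<in> closure S"
      show "x \<in> S"
      proof (rule SI)
        fix e :: real assume "e > 0"
        then obtain y where "y \<in> S" "dist y x < e" using x closure_approachable by blast
        then show "\<exists>y\<in>S. norm (x - y) \<le> e" by (auto simp: dist_norm norm_minus_commute intro!: bexI[of _ y])
      qed
    qed
    then show ?thesis by (simp add: closure_subset_eq)
  qed
  have Ssub: "subspace S"
    unfolding subspace_def
  proof (intro conjI ballI allI)
    have "bop_apply (T :: ('g, 'h) L2 bop) 0 = 0" for T
      by (rule linear_0[OF bounded_linear.linear[OF bounded_linear_bop_apply]])
    then show "0 \<in> S" by (auto simp: S_def intro!: exI[of _ UNIV])
  next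
    fix x y assume x: "x \<in> S" and y: "y \<in> S"
    show "x + y \<in> S"
      unfolding S_def mem_Collect_eq
    proof (intro allI impI)
      fix e :: real assume "e > 0"
      then have e: "e/2 > 0" by simp
      obtain W where W: "open W" "0 \<in> W" "\<forall>w\<in>W. norm (bop_apply (translation w) x - x) \<le> e/2"
        using x e unfolding S_def mem_Collect_eq by meson
      obtain W' where W': "open W'" "0 \<in> W'" "\<forall>w\<in>W'. norm (bop_apply (translation w) y - y) \<le> e/2"
        using y e unfolding S_def mem_Collect_eq by meson
      have "norm (bop_apply (translation w) (x + y) - (x + y)) \<le> e" if "w \<in> W \<inter> W'" for w
      proof -
        have "bop_apply (translation w) (x + y) - (x + y)
            = (bop_apply (translation w) x - x) + (bop_apply (translation w) y - y)"
          by (simp add: linear_add[OF bounded_linear.linear[OF bounded_linear_bop_apply]])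
        also have "norm \<dots> \<le> e/2 + e/2"
          by (rule norm_triangle_le, rule add_mono) (use W(3) W'(3) that in auto)
        finally show ?thesis by simp
      qed
      then show "\<exists>W. open W \<and> 0 \<in> W \<and> (\<forall>w\<in>W. norm (bop_apply (translation w) (x + y) - (x + y)) \<le> e)"
        using W W' by (intro exI[of _ "W \<inter> W'"]) auto
    qed
  next
    fix c and x assume x: "x \<in> S"
    show "c *\<^sub>R x \<in> S"
      unfolding S_def mem_Collect_eq
    proof (intro allI impI)
      fix e :: real assume "e > 0"
      then have e: "e / (\<bar>c\<bar> + 1) > 0" by simp
      obtain W where W: "open W" "0 \<in> W" "\<forall>w\<in>W. norm (bop_apply (translation w) x - x) \<le> e / (\<bar>c\<bar> + 1)"
        using x e unfolding S_def mem_Collect_eq by meson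
      have "norm (bop_apply (translation w) (c *\<^sub>R x) - c *\<^sub>R x) \<le> e" if "w \<in> W" for w
      proof -
        have "norm (bop_apply (translation w) (c *\<^sub>R x) - c *\<^sub>R x) = \<bar>c\<bar> * norm (bop_apply (translation w) x - x)"
          by (simp add: linear_scale[OF bounded_linear.linear[OF bounded_linear_bop_apply]] flip: scaleR_diff_right)
        also have "\<dots> \<le> (\<bar>c\<bar> + 1) * (e / (\<bar>c\<bar> + 1))"
          by (intro mult_mono) (use W(3) that in auto)
        also have "\<dots> = e" using abs_ge_zero[of c] by (simp add: add_nonneg_eq_0_iff)
        finally show ?thesis .
      qed
      then show "\<exists>W. open W \<and> 0 \<in> W \<and> (\<forall>w\<in>W. norm (bop_apply (translation w) (c *\<^sub>R x) - c *\<^sub>R x) \<le> e)"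
        using W by blast
    qed
  qed
  have cpt: "L2_indicator K h \<in> S" if K: "compact K" for K and h :: 'h
    unfolding S_def mem_Collect_eq
  proof (intro allI impI)
    fix e :: real assume e: "e > 0"
    define d where "d = e\<^sup>2 / (2 * ((norm h)\<^sup>2 + 1))"
    have pos: "(norm h)\<^sup>2 + 1 > 0" by (simp add: add_nonneg_pos)
    have d: "d > 0" using e pos by (simp add: d_def)
    have "2 * ((norm h)\<^sup>2 + 1) \<noteq> 0" using pos by simp
    then have dq: "d * (2 * ((norm h)\<^sup>2 + 1)) = e\<^sup>2" by (metis d_def nonzero_eq_divide_eq)
    obtain W where W: "open W" "0 \<in> W"
      "\<forall>w\<in>W. measure haar ((\<lambda>t. w + t) ` K - K) \<le> d \<and> measure haar (K - (\<lambda>t. w + t) ` K) \<le> d"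
      using translation_measure_diff[OF K d] by blast
    have Ks: "K \<in> sets haar" "emeasure haar K < \<infinity>"
      using K by (simp_all add: sets_haar_compact haar_compact_finite[simplified])
    have "norm (bop_apply (translation w) (L2_indicator K h) - L2_indicator K h) \<le> e" if "w \<in> W" for w
    proof -
      have tK: "(\<lambda>t. w + t) ` K \<in> sets haar" "emeasure haar ((\<lambda>t. w + t) ` K) < \<infinity>"
        using Ks by (simp_all add: sets_haar_translation haar_left_invariant)
      have "(norm (bop_apply (translation w) (L2_indicator K h) - L2_indicator K h))\<^sup>2
          = (measure haar ((\<lambda>t. w + t) ` K - K) + measure haar (K - (\<lambda>t. w + t) ` K)) * (norm h)\<^sup>2"
        unfolding translation_L2_indicator[OF Ks] by (rule norm_L2_indicator_diff[OF tK Ks])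
      also have "\<dots> \<le> (d + d) * ((norm h)\<^sup>2 + 1)"
        by (intro mult_mono add_mono) (use W(3) that d in auto)
      also have "\<dots> = e\<^sup>2" using dq by (simp add: algebra_simps)
      finally show ?thesis by (rule power2_le_imp_le) (use e in simp)
    qed
    then show "\<exists>W. open W \<and> 0 \<in> W \<and> (\<forall>w\<in>W. norm (bop_apply (translation w) (L2_indicator K h) - L2_indicator K h) \<le> e)"
      using W(1,2) by blast
  qed
  have "x \<in> S"
  proof (rule L2_indicators_dense[OF Scl Ssub])
    fix A :: "'g set" and h :: 'h
    assume A: "A \<in> sets haar" "emeasure haar A < \<infinity>"
    show "L2_indicator A h \<in> S"
    proof (rule SI)
      fix e :: real assume e: "e > 0"
      define d where "d = e\<^sup>2 / (2 * ((norm h)\<^sup>2 + 1))"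
      have pos: "(norm h)\<^sup>2 + 1 > 0" by (simp add: add_nonneg_pos)
      have d: "d > 0" using e pos by (simp add: d_def)
      have "2 * ((norm h)\<^sup>2 + 1) \<noteq> 0" using pos by simp
      then have dq: "d * (2 * ((norm h)\<^sup>2 + 1)) = e\<^sup>2" by (metis d_def nonzero_eq_divide_eq)
      have "(INF U\<in>{U. open U \<and> A \<subseteq> U}. emeasure haar U) < emeasure haar A + ennreal d"
        using A d ennreal_add_left_cancel_less[of "emeasure haar A" 0 "ennreal d"]
        by (simp add: haar_outer_regular[OF A(1), symmetric])
      then obtain U where U: "open U" "A \<subseteq> U" "emeasure haar U < emeasure haar A + ennreal d"
        unfolding INF_less_iff by auto
      have Us: "U \<in> sets haar" by (rule sets_haar_open[OF U(1)])
      have Uf: "emeasure haar U < \<infinity>" using U(3) A(2) by (auto intro: less_le_trans simp: less_top)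
      have "measure haar U < measure haar A + d"
        using U(3) A(2) Uf d by (simp add: emeasure_eq_ennreal_measure ennreal_less_iff flip: ennreal_plus)
      then have UA: "measure haar (U - A) \<le> d"
        using A Us Uf U(2) by (subst measure_Diff) (auto simp: fmeasurable_def)
      \<comment> \<open>Inner regularity concerns open sets, so \<open>K\<close> is found inside
        \<open>U\<close> and need not lie inside \<open>A\<close>; both differences of
        \<open>A\<close> and \<open>K\<close> are bounded through \<open>U\<close>.\<close>
      have "\<exists>K. compact K \<and> K \<subseteq> U \<and> measure haar U < measure haar K + d"
      proof (cases "measure haar U < d")
        case True
        then show ?thesis by (intro exI[of _ "{}"]) simp
      next
        case False
        then have "ennreal (measure haar U - d) < emeasure haar U"
          using Uf d by (simp add: emeasure_eq_ennreal_measure ennreal_less_iff)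
        then have "ennreal (measure haar U - d) < (SUP K\<in>{K. compact K \<and> K \<subseteq> U}. emeasure haar K)"
          by (simp add: haar_inner_regular[OF U(1), symmetric])
        then obtain K where K: "compact K" "K \<subseteq> U" "ennreal (measure haar U - d) < emeasure haar K"
          unfolding less_SUP_iff by auto
        then have "measure haar U - d < measure haar K"
          using haar_compact_finite[OF K(1)] False by (simp add: emeasure_eq_ennreal_measure ennreal_less_iff)
        then show ?thesis using K by (intro exI[of _ K]) auto
      qed
      then obtain K where K: "compact K" "K \<subseteq> U" "measure haar U < measure haar K + d" by blast
      have Ks: "K \<in> sets haar" "emeasure haar K < \<infinity>"
        using K(1) by (simp_all add: sets_haar_compact haar_compact_finite[simplified])
      have UK: "measure haar (U - K) \<le> d"
        using K Ks Us Uf by (subst measure_Diff) (auto simp: fmeasurable_def)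
      have mono: "measure haar B \<le> d" if "B \<subseteq> U - C" "measure haar (U - C) \<le> d" "B \<in> sets haar" "C \<in> sets haar" for B C
      proof -
        have "U - C \<in> fmeasurable haar"
          using Us Uf that(4) emeasure_mono[OF Diff_subset Us, of C] by (auto simp: fmeasurable_def intro: le_less_trans)
        then have "measure haar B \<le> measure haar (U - C)" using that by (intro measure_mono_fmeasurable) auto
        then show ?thesis using that(2) by simp
      qed
      have AK: "measure haar (A - K) \<le> d" "measure haar (K - A) \<le> d"
        using mono[OF _ UK, of "A - K"] mono[OF _ UA, of "K - A"] A Ks U(2) K(2) by auto
      have "(norm (L2_indicator A h - L2_indicator K h))\<^sup>2
          = (measure haar (A - K) + measure haar (K - A)) * (norm h)\<^sup>2"
        by (rule norm_L2_indicator_diff[OF A Ks])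
      also have "\<dots> \<le> (d + d) * ((norm h)\<^sup>2 + 1)"
        by (intro mult_mono add_mono AK) (use d in auto)
      also have "\<dots> = e\<^sup>2" using dq by (simp add: algebra_simps)
      finally have "norm (L2_indicator A h - L2_indicator K h) \<le> e" by (rule power2_le_imp_le) (use e in simp)
      then show "\<exists>y\<in>S. norm (L2_indicator A h - y) \<le> e" using cpt[OF K(1)] by blast
    qed
  qed
  show ?thesis
  proof (rule continuous_on_UNIV_normI)
    fix s :: 'g and e :: real assume "e > 0"
    then obtain W where W: "open W" "0 \<in> W" "\<forall>w\<in>W. norm (bop_apply (translation w) x - x) \<le> e"
      using \<open>x \<in> S\<close> unfolding S_def mem_Collect_eq by meson
    define U where "U = (\<lambda>t. - s + t) -` W"
    have "open U" unfolding U_def by (intro open_vimage W continuous_intros)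
    moreover have "s \<in> U" using W by (simp add: U_def)
    moreover have "norm (bop_apply (translation s') x - bop_apply (translation s) x) \<le> e" if "s' \<in> U" for s'
    proof -
      interpret T: bounded_linear "bop_apply (translation s :: ('g, 'h) L2 bop)" by (rule bounded_linear_bop_apply)
      have "bop_apply (translation s') x = bop_apply (translation s) (bop_apply (translation (- s + s')) x)"
        by (simp add: translation_translation)
      then have "norm (bop_apply (translation s') x - bop_apply (translation s) x)
          = norm (bop_apply (translation s) (bop_apply (translation (- s + s')) x - x))"
        by (simp add: T.diff)
      also have "\<dots> \<le> e" using W(3) that by (simp add: norm_translation_apply U_def)
      finally show ?thesis .
    qed
    ultimately show "\<exists>U. open U \<and> s \<in> U \<and> (\<forall>s'\<in>U. norm (bop_apply (translation s') x - bop_apply (translation s) x) \<le> e)"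
      by blast
  qed
qed

subsection \<open>The regular representation\<close>

text \<open>As open sets have positive measure, a set of finite measure contains only countably many
  disjoint open sets, so that separated families of values are countable.\<close>

lemma separable_image_finite_measure:
  fixes f :: "'g::locally_compact_group \<Rightarrow> 'm::metric_space"
  assumes f: "continuous_on UNIV f" and U: "open U" "emeasure haar U < \<infinity>"
  shows "\<exists>D. countable D \<and> f ` U \<subseteq> closure D"
proof -
  have net: "\<exists>T. countable T \<and> T \<subseteq> U \<and> (\<forall>u\<in>U. \<exists>t\<in>T. dist (f t) (f u) < e)" if e: "e > 0" for e
  proof -
    define Sep where "Sep = {T. T \<subseteq> U \<and> (\<forall>s\<in>T. \<forall>t\<in>T. s \<noteq> t \<longrightarrow> dist (f s) (f t) \<ge> e)}"
    \<comment> \<open>A maximal \<open>e\<close>-separated subset of \<open>U\<close> is an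
      \<open>e\<close>-net; it remains to see that it is countable.\<close>
    have "\<exists>T\<in>Sep. \<forall>X\<in>Sep. T \<subseteq> X \<longrightarrow> X = T"
    proof (rule subset_Zorn_nonempty)
      show "Sep \<noteq> {}" by (auto simp: Sep_def intro!: exI[of _ "{}"])
      fix C assume C: "subset.chain Sep C"
      show "\<Union>C \<in> Sep"
        unfolding Sep_def mem_Collect_eq
      proof (intro conjI ballI impI)
        show "\<Union>C \<subseteq> U" using C by (auto simp: subset.chain_def Sep_def)
        fix s t assume "s \<in> \<Union>C" "t \<in> \<Union>C" "s \<noteq> t"
        then obtain X Y where XY: "X \<in> C" "s \<in> X" "Y \<in> C" "t \<in> Y" by blast
        then have "X \<subseteq> Y \<or> Y \<subseteq> X" using C by (auto simp: subset_chain_def)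
        then obtain Z where "Z \<in> C" "s \<in> Z" "t \<in> Z" using XY by blast
        moreover have "Z \<in> Sep" using C \<open>Z \<in> C\<close> by (auto simp: subset_chain_def)
        ultimately show "e \<le> dist (f s) (f t)" using \<open>s \<noteq> t\<close> by (simp add: Sep_def)
      qed
    qed
    then obtain T where T: "T \<in> Sep" and max: "\<And>X. X \<in> Sep \<Longrightarrow> T \<subseteq> X \<Longrightarrow> X = T" by blast
    have TU: "T \<subseteq> U" using T by (simp add: Sep_def)
    have near: "\<exists>t\<in>T. dist (f t) (f u) < e" if u: "u \<in> U" for u
    proof (rule ccontr)
      assume *: "\<not> (\<exists>t\<in>T. dist (f t) (f u) < e)"
      then have "u \<notin> T" using e by (metis dist_self)
      have "insert u T \<in> Sep"
        using T u * unfolding Sep_def by (auto simp: not_less dist_commute)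
      from max[OF this] \<open>u \<notin> T\<close> show False by blast
    qed
    \<comment> \<open>Balls of half the separation have disjoint preimages. These are open sets of
      positive measure inside \<open>U\<close>, so their measures form a summable family with no
      zero member.\<close>
    define V where "V t = U \<inter> f -` ball (f t) (e/2)" for t
    have V: "open (V t)" for t
      unfolding V_def by (intro open_Int U open_vimage f) simp
    have Vpos: "measure haar (V t) > 0" if "t \<in> T" for t
    proof -
      have "t \<in> V t" using that TU e by (auto simp: V_def)
      then have "emeasure haar (V t) > 0" using haar_open_pos[OF V] by blast
      moreover have "emeasure haar (V t) < \<infinity>"
        using emeasure_mono[of "V t" U haar] U sets_haar_open[OF U(1)] by (auto simp: V_def intro: le_less_trans)
      ultimately show ?thesis by (simp add: measure_def enn2real_positive_iff)
    qed
    have disj: "V s \<inter> V t = {}" if "s \<in> T" "t \<in> T" "s \<noteq> t" for s t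
    proof (rule ccontr)
      assume "V s \<inter> V t \<noteq> {}"
      then obtain u where "dist (f s) (f u) < e/2" "dist (f t) (f u) < e/2" by (auto simp: V_def)
      then have "dist (f s) (f t) < e" using dist_triangle_half_r[of "f u"] by (metis dist_commute)
      then show False using T that by (force simp: Sep_def)
    qed
    have Vf: "V t \<in> fmeasurable haar" for t
      using emeasure_mono[of "V t" U haar] U sets_haar_open[OF U(1)] sets_haar_open[OF V]
      by (auto simp: V_def fmeasurable_def intro: le_less_trans)
    have "sum (\<lambda>t. measure haar (V t)) F \<le> measure haar U" if F: "finite F" "F \<subseteq> T" for F
    proof -
      have "pairwise (\<lambda>s t. disjnt (V s) (V t)) F"
        unfolding pairwise_def disjnt_def using disj F(2) by (meson subsetD)
      then have "sum (\<lambda>t. measure haar (V t)) F = measure haar (\<Union>t\<in>F. V t)"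
        using F Vf by (intro measure_UNION'[symmetric])
      also have "\<dots> \<le> measure haar U"
      proof (rule measure_mono_fmeasurable)
        show "(\<Union>t\<in>F. V t) \<subseteq> U" by (auto simp: V_def)
        show "(\<Union>t\<in>F. V t) \<in> sets haar" using F Vf by (intro sets.finite_UN) (auto simp: fmeasurable_def)
        show "U \<in> fmeasurable haar" using U sets_haar_open[OF U(1)] by (simp add: fmeasurable_def)
      qed
      finally show ?thesis .
    qed
    then have "(\<lambda>t. measure haar (V t)) summable_on T"
      by (intro nonneg_bdd_above_summable_on) (auto intro!: bdd_aboveI)
    then have "countable {t\<in>T. measure haar (V t) \<noteq> 0}" by (rule summable_countable_real)
    moreover have "{t\<in>T. measure haar (V t) \<noteq> 0} = T" using Vpos by force
    ultimately show ?thesis using TU near by (intro exI[of _ T]) auto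
  qed
  have "\<forall>n. \<exists>T. countable T \<and> T \<subseteq> U \<and> (\<forall>u\<in>U. \<exists>t\<in>T. dist (f t) (f u) < 1 / real (Suc n))"
    using net by simp
  from choice[OF this] obtain T where
    "\<forall>n. countable (T n) \<and> T n \<subseteq> U \<and> (\<forall>u\<in>U. \<exists>t\<in>T n. dist (f t) (f u) < 1 / real (Suc n))" ..
  then have T: "countable (T n)" "u \<in> U \<Longrightarrow> \<exists>t\<in>T n. dist (f t) (f u) < 1 / real (Suc n)" for n u
    by simp_all
  have "f u \<in> closure (\<Union>n. f ` T n)" if "u \<in> U" for u
    unfolding closure_approachable
  proof (intro allI impI)
    fix e :: real assume "e > 0"
    then obtain n where "1 / real (Suc n) < e" using nat_approx_posE by blast
    then show "\<exists>y\<in>\<Union>n. f ` T n. dist y (f u) < e" using T(2)[OF that, of n] by force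
  qed
  then show ?thesis using T(1) by (intro exI[of _ "\<Union>n. f ` T n"]) auto
qed

text \<open>The set where \<open>\<xi>\<close> does not vanish is a countable union of sets of
  finite measure, and outer regularity encloses each of them in an open set of finite
  measure.\<close>

lemma square_integrable_separable:
  fixes f :: "'g::locally_compact_group \<Rightarrow> 'm::metric_space" and \<xi> :: "'g \<Rightarrow> 'h::complex_hilbert_space"
  assumes f: "continuous_on UNIV f" and \<xi>: "\<xi> \<in> square_integrable haar"
  shows "\<exists>D. countable D \<and> (\<forall>t. \<xi> t \<noteq> 0 \<longrightarrow> f t \<in> closure D)"
proof -
  have sm: "strongly_measurable haar \<xi>" and fin: "(\<integral>\<^sup>+ t. ennreal ((norm (\<xi> t))\<^sup>2) \<partial>haar) < \<infinity>"
    using \<xi> by (auto simp: square_integrable_def)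
  note [measurable] = borel_measurable_norm_strongly[OF sm]
  define P where "P n = {t. norm (\<xi> t) \<ge> 1 / real (Suc n)}" for n
  have P: "P n \<in> sets haar" for n
  proof -
    have "{t\<in>space haar. norm (\<xi> t) \<ge> 1 / real (Suc n)} \<in> sets haar" by measurable
    then show ?thesis by (simp add: P_def)
  qed
  have "\<exists>D. countable D \<and> f ` P n \<subseteq> closure D" for n
  proof -
    define c where "c = ennreal ((1 / real (Suc n))\<^sup>2)"
    have "c * emeasure haar (P n) = (\<integral>\<^sup>+ t. c * indicator (P n) t \<partial>haar)"
      using P by (simp add: nn_integral_cmult_indicator)
    also have "\<dots> \<le> (\<integral>\<^sup>+ t. ennreal ((norm (\<xi> t))\<^sup>2) \<partial>haar)"
      by (intro nn_integral_mono) (auto simp: P_def indicator_def c_def intro!: ennreal_leI power_mono)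
    finally have "c * emeasure haar (P n) < \<infinity>" using fin by simp
    moreover have "c > 0" by (simp add: c_def)
    ultimately have "emeasure haar (P n) < \<infinity>" by (auto simp: ennreal_mult_less_top)
    then have "(INF U\<in>{U. open U \<and> P n \<subseteq> U}. emeasure haar U) < \<infinity>"
      by (simp add: haar_outer_regular[OF P, symmetric])
    then obtain U where U: "open U" "P n \<subseteq> U" "emeasure haar U < \<infinity>" unfolding INF_less_iff by auto
    then show ?thesis using separable_image_finite_measure[OF f U(1,3)] by blast
  qed
  then obtain D where D: "\<And>n. countable (D n)" "\<And>n. f ` P n \<subseteq> closure (D n)" by metis
  have "f t \<in> closure (\<Union>n. D n)" if "\<xi> t \<noteq> 0" for t
  proof -
    have "norm (\<xi> t) > 0" using that by simp
    then obtain n where "1 / real (Suc n) < norm (\<xi> t)" by (rule nat_approx_posE)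
    then have "f t \<in> closure (D n)" using D(2)[of n] by (auto simp: P_def)
    then show ?thesis using closure_mono[of "D n" "\<Union>n. D n"] by blast
  qed
  then show ?thesis using D(1) by (intro exI[of _ "\<Union>n. D n"]) auto
qed

text \<open>The operators \<open>A t\<close> need not form a separable set, but those at points with
  \<open>\<xi> t \<noteq> 0\<close> do. There \<open>A\<close> is a limit of functions with
  countably many values, and elsewhere the product is 0 in any case.\<close>

lemma strongly_measurable_bop_apply:
  fixes A :: "'g::locally_compact_group \<Rightarrow> 'h::complex_hilbert_space bop"
  assumes A: "continuous_on UNIV A" and \<xi>: "\<xi> \<in> square_integrable haar"
  shows "strongly_measurable haar (\<lambda>t. bop_apply (A t) (\<xi> t))"
proof -
  obtain D where D: "countable D" "\<And>t. \<xi> t \<noteq> 0 \<Longrightarrow> A t \<in> closure D"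
    using square_integrable_separable[OF A \<xi>] by blast
  define d where "d = from_nat_into (insert 0 D)"
  have d: "D \<subseteq> range d"
    using range_from_nat_into[of "insert 0 D"] D(1) by (auto simp: d_def)
  have sm: "strongly_measurable haar \<xi>" using \<xi> by (simp add: square_integrable_def)
  obtain D' where D': "countable D'" "range \<xi> \<subseteq> closure D'" using sm by (auto simp: strongly_measurable_def)
  have lin: "bounded_linear (bop_apply T)" for T :: "'h bop" by (rule bounded_linear_bop_apply)
  \<comment> \<open>Where no index qualifies, \<open>LEAST\<close> is an unspecified number. This
    can happen only at points with \<open>\<xi> t = 0\<close>, where every operator gives 0.\<close>
  define i where "i n t = (LEAST k. norm (A t - d k) < 1 / real (Suc n))" for n t
  have [measurable]: "(\<lambda>t. norm (A t - d k)) \<in> borel_measurable haar" for k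
    by (rule measurable_haar_continuous) (intro continuous_intros A)
  have i_meas: "i n \<in> haar \<rightarrow>\<^sub>M count_space UNIV" for n
    unfolding i_def by (rule measurable_Least) measurable
  show ?thesis
  proof (rule strongly_measurable_lim)
    fix n
    have smk: "strongly_measurable haar (\<lambda>t. bop_apply (d k) (\<xi> t))" for k
      by (rule strongly_measurable_image[OF sm linear_continuous_on[OF lin]])
    have "(\<lambda>t. bop_apply (d (i n t)) (\<xi> t)) \<in> borel_measurable haar"
      by (rule measurable_compose_countable[OF _ i_meas]) (use smk in \<open>simp add: strongly_measurable_def\<close>)
    moreover have "countable (\<Union>k. bop_apply (d k) ` D')" using D' by simp
    moreover have "bop_apply (d k) (\<xi> t) \<in> closure (\<Union>k. bop_apply (d k) ` D')" for k t
    proof -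
      have "bop_apply (d k) ` closure D' \<subseteq> closure (bop_apply (d k) ` D')"
        by (rule image_closure_subset) (auto intro: linear_continuous_on[OF lin] closure_subset[THEN subsetD])
      then have "bop_apply (d k) (\<xi> t) \<in> closure (bop_apply (d k) ` D')" using D'(2) by blast
      then show ?thesis using closure_mono[of "bop_apply (d k) ` D'" "\<Union>k. bop_apply (d k) ` D'"] by blast
    qed
    then have "range (\<lambda>t. bop_apply (d (i n t)) (\<xi> t)) \<subseteq> closure (\<Union>k. bop_apply (d k) ` D')" by blast
    ultimately show "strongly_measurable haar (\<lambda>t. bop_apply (d (i n t)) (\<xi> t))"
      unfolding strongly_measurable_def by blast
  next
    fix t
    show "(\<lambda>n. bop_apply (d (i n t)) (\<xi> t)) \<longlonglongrightarrow> bop_apply (A t) (\<xi> t)"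
    proof (cases "\<xi> t = 0")
      case True
      then show ?thesis by (simp add: linear_0[OF bounded_linear.linear[OF lin]])
    next
      case False
      have near: "norm (A t - d (i n t)) < 1 / real (Suc n)" for n
      proof -
        obtain y where "y \<in> D" "dist y (A t) < 1 / real (Suc n)"
          using D(2)[OF False] unfolding closure_approachable by (metis zero_less_divide_1_iff of_nat_0_less_iff zero_less_Suc)
        then obtain k where "norm (A t - d k) < 1 / real (Suc n)"
          using d by (auto simp: dist_norm norm_minus_commute)
        then show ?thesis unfolding i_def by (rule LeastI)
      qed
      have "norm (bop_apply (d (i n t)) (\<xi> t) - bop_apply (A t) (\<xi> t)) \<le> 1 / real (Suc n) * norm (\<xi> t)" for n
      proof -
        have "norm (bop_apply (d (i n t)) (\<xi> t) - bop_apply (A t) (\<xi> t)) = norm (bop_apply (A t - d (i n t)) (\<xi> t))"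
          by (simp add: minus_bop.rep_eq norm_minus_commute)
        also have "\<dots> \<le> norm (A t - d (i n t)) * norm (\<xi> t)" by (rule norm_bop_apply_le)
        also have "\<dots> \<le> 1 / real (Suc n) * norm (\<xi> t)"
          using near[of n] by (intro mult_right_mono) auto
        finally show ?thesis .
      qed
      moreover have "(\<lambda>n. 1 / real (Suc n) * norm (\<xi> t)) \<longlonglongrightarrow> 0 * norm (\<xi> t)"
        by (intro tendsto_intros LIMSEQ_inverse_real_of_nat[unfolded inverse_eq_divide])
      ultimately have "(\<lambda>n. bop_apply (d (i n t)) (\<xi> t) - bop_apply (A t) (\<xi> t)) \<longlonglongrightarrow> 0"
        using Lim_null_comparison[OF always_eventually] by (metis (no_types, lifting) mult_zero_left)
      then show ?thesis by (simp add: LIM_zero_iff)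
    qed
  qed
qed

section \<open>The regular representation as a star homomorphism, and its covariance with the
  translations\<close>

locale represented_system =
  fixes \<alpha> :: "'g::locally_compact_group \<Rightarrow> 'a::cstar_algebra \<Rightarrow> 'a"
    and \<pi> :: "'a \<Rightarrow> 'h::complex_hilbert_space bop"
  assumes system: "cstar_dynamical_system \<alpha>" and hom: "star_homomorphism \<pi>"
begin

lemma alpha_hom: "star_homomorphism (\<alpha> t)"
  using system by (simp add: cstar_dynamical_system_def)

lemma alpha_alpha: "\<alpha> s (\<alpha> t a) = \<alpha> (s + t) a"
  using system unfolding cstar_dynamical_system_def by (metis comp_apply)

text \<open>An injective idempotent map is the identity.\<close>

lemma alpha_zero: "\<alpha> 0 a = a"
proof -
  have "\<alpha> 0 (\<alpha> 0 a) = \<alpha> 0 a" using alpha_alpha[of 0 0 a] by simp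
  moreover have "inj (\<alpha> 0)" using system by (auto simp: cstar_dynamical_system_def bij_def)
  ultimately show ?thesis by (simp add: inj_eq)
qed

lemma alpha_continuous: "continuous_on UNIV (\<lambda>t. \<alpha> t a)"
  using system by (simp add: cstar_dynamical_system_def)

lemma alpha_simps:
  "\<alpha> t (a + b) = \<alpha> t a + \<alpha> t b" "\<alpha> t (c *\<^sub>C a) = c *\<^sub>C \<alpha> t a"
  "\<alpha> t (a * b) = \<alpha> t a * \<alpha> t b" "\<alpha> t (star a) = star (\<alpha> t a)"
  using alpha_hom[of t] by (simp_all add: star_homomorphism_def)

lemma pi_simps:
  "\<pi> (a + b) = \<pi> a + \<pi> b" "\<pi> (c *\<^sub>C a) = c *\<^sub>C \<pi> a"
  "\<pi> (a * b) = \<pi> a * \<pi> b" "\<pi> (star a) = star (\<pi> a)"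
  using hom by (simp_all add: star_homomorphism_def)

lemma pi_diff: "\<pi> (a - b) = \<pi> a - \<pi> b"
  using pi_simps(1)[of "a - b" b] by simp

lemma alpha_diff: "\<alpha> t (a - b) = \<alpha> t a - \<alpha> t b"
  using alpha_simps(1)[of t "a - b" b] by simp

lemma norm_pi_alpha_le: "norm (\<pi> (\<alpha> t a)) \<le> norm a"
proof -
  have "star_homomorphism (\<lambda>a. \<pi> (\<alpha> t a))"
    by (simp add: star_homomorphism_def alpha_simps pi_simps)
  then show ?thesis by (rule norm_star_homomorphism_le)
qed

lemma pi_alpha_continuous: "continuous_on UNIV (\<lambda>t. \<pi> (\<alpha> (- t) a))"
proof -
  have "continuous_on UNIV \<pi>"
    unfolding continuous_on_iff dist_norm pi_diff[symmetric]
    using norm_star_homomorphism_le[OF hom] by (meson le_less_trans)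
  moreover have "continuous_on UNIV (\<lambda>t. \<alpha> (- t) a)"
    by (rule continuous_on_compose2[OF alpha_continuous]) (auto intro!: continuous_intros)
  ultimately show ?thesis by (rule continuous_on_compose2) simp
qed

text \<open>The bound \<open>C\<close> is a parameter because the image of
  \<open>\<alpha> s a\<close> has to be bounded by the norm of \<open>a\<close>. Contractivity was
  shown for star homomorphisms into operators, so it applies to \<open>\<pi>\<close> composed with
  \<open>\<alpha> t\<close> rather than to \<open>\<alpha> t\<close> alone.\<close>

lemma regular_rep_aux:
  fixes a :: 'a
  defines "\<Phi> \<equiv> \<lambda>\<xi> t. bop_apply (\<pi> (\<alpha> (- t) a)) (\<xi> t)"
  assumes C: "\<And>t. norm (\<pi> (\<alpha> t a)) \<le> C"
  shows "f \<in> square_integrable haar \<Longrightarrow> \<Phi> f \<in> square_integrable haar"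
    and "f \<in> square_integrable haar \<Longrightarrow> bop_apply (regular_rep \<pi> \<alpha> a) (abs_L2 f) = abs_L2 (\<Phi> f)"
    and "norm (regular_rep \<pi> \<alpha> a) \<le> C"
proof -
  have C0: "C \<ge> 0" using C order_trans norm_ge_zero by blast
  have bound: "(\<integral>\<^sup>+ t. ennreal ((norm (\<Phi> f t))\<^sup>2) \<partial>haar) \<le> ennreal (C\<^sup>2) * (\<integral>\<^sup>+ t. ennreal ((norm (f t))\<^sup>2) \<partial>haar)"
    if f: "f \<in> square_integrable haar" for f
  proof -
    have [measurable]: "(\<lambda>t. norm (f t)) \<in> borel_measurable haar"
      using f by (intro borel_measurable_norm_strongly) (simp add: square_integrable_def)
    have "(\<integral>\<^sup>+ t. ennreal ((norm (\<Phi> f t))\<^sup>2) \<partial>haar) \<le> (\<integral>\<^sup>+ t. ennreal (C\<^sup>2) * ennreal ((norm (f t))\<^sup>2) \<partial>haar)"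
    proof (rule nn_integral_mono)
      fix t
      have "norm (\<Phi> f t) \<le> norm (\<pi> (\<alpha> (- t) a)) * norm (f t)" unfolding \<Phi>_def by (rule norm_bop_apply_le)
      also have "\<dots> \<le> C * norm (f t)" by (intro mult_right_mono C) simp
      finally have "(norm (\<Phi> f t))\<^sup>2 \<le> (C * norm (f t))\<^sup>2" by (rule power_mono) simp
      then show "ennreal ((norm (\<Phi> f t))\<^sup>2) \<le> ennreal (C\<^sup>2) * ennreal ((norm (f t))\<^sup>2)"
        using C0 by (simp add: power_mult_distrib ennreal_leI flip: ennreal_mult)
    qed
    also have "\<dots> = ennreal (C\<^sup>2) * (\<integral>\<^sup>+ t. ennreal ((norm (f t))\<^sup>2) \<partial>haar)"
      by (rule nn_integral_cmult) measurable
    finally show ?thesis .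
  qed
  show SI: "f \<in> square_integrable haar \<Longrightarrow> \<Phi> f \<in> square_integrable haar" for f
    using bound[of f] strongly_measurable_bop_apply[OF pi_alpha_continuous[of a], of f]
    by (auto simp: square_integrable_def \<Phi>_def intro: le_less_trans simp: ennreal_mult_less_top)
  have lin: "linear (bop_apply T)" for T :: "'h bop"
    by (rule bounded_linear.linear[OF bounded_linear_bop_apply])
  note op = L2_operator_apply[of \<Phi> C, OF SI _ _ bound C0]
  show "f \<in> square_integrable haar \<Longrightarrow> bop_apply (regular_rep \<pi> \<alpha> a) (abs_L2 f) = abs_L2 (\<Phi> f)"
    unfolding regular_rep_def \<Phi>_def[symmetric]
    by (rule op(1)) (simp_all add: \<Phi>_def linear_add[OF lin] bop_apply_scaleC)
  show "norm (regular_rep \<pi> \<alpha> a) \<le> C"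
    unfolding regular_rep_def \<Phi>_def[symmetric]
    by (rule op(2)) (simp_all add: \<Phi>_def linear_add[OF lin] bop_apply_scaleC)
qed

lemma norm_regular_rep_le: "norm (regular_rep \<pi> \<alpha> a) \<le> norm a"
  by (rule regular_rep_aux(3)[OF norm_pi_alpha_le])

lemma norm_regular_rep_alpha_le: "norm (regular_rep \<pi> \<alpha> (\<alpha> s a)) \<le> norm a"
  by (rule regular_rep_aux(3)) (simp add: alpha_alpha norm_pi_alpha_le)

lemmas square_integrable_regular_rep = regular_rep_aux(1)[OF norm_pi_alpha_le]
lemmas regular_rep_abs_L2 = regular_rep_aux(2)[OF norm_pi_alpha_le]

lemma regular_rep_eqI:
  assumes "\<And>f. f \<in> square_integrable haar \<Longrightarrow>
    bop_apply T (abs_L2 f) = abs_L2 (\<lambda>t. bop_apply (\<pi> (\<alpha> (- t) a)) (f t))"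
  shows "regular_rep \<pi> \<alpha> a = T"
proof (rule bop_eqI)
  fix x
  show "bop_apply (regular_rep \<pi> \<alpha> a) x = bop_apply T x"
    by (rule L2_repE[of x]) (simp add: regular_rep_abs_L2 assms)
qed

lemma regular_rep_add: "regular_rep \<pi> \<alpha> (a + b) = regular_rep \<pi> \<alpha> a + regular_rep \<pi> \<alpha> b"
  by (rule regular_rep_eqI)
    (simp add: plus_bop.rep_eq alpha_simps pi_simps regular_rep_abs_L2 square_integrable_regular_rep flip: abs_L2_add)

lemma regular_rep_scaleC: "regular_rep \<pi> \<alpha> (c *\<^sub>C a) = c *\<^sub>C regular_rep \<pi> \<alpha> a"
  by (rule regular_rep_eqI)
    (simp add: scaleC_bop.rep_eq alpha_simps pi_simps regular_rep_abs_L2 square_integrable_regular_rep flip: abs_L2_scaleC)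

lemma regular_rep_mult: "regular_rep \<pi> \<alpha> (a * b) = regular_rep \<pi> \<alpha> a * regular_rep \<pi> \<alpha> b"
  by (rule regular_rep_eqI)
    (simp add: times_bop.rep_eq alpha_simps pi_simps regular_rep_abs_L2 square_integrable_regular_rep)

lemma regular_rep_diff: "regular_rep \<pi> \<alpha> (a - b) = regular_rep \<pi> \<alpha> a - regular_rep \<pi> \<alpha> b"
  using regular_rep_add[of "a - b" b] by simp

lemma regular_rep_star: "regular_rep \<pi> \<alpha> (star a) = star (regular_rep \<pi> \<alpha> a)"
proof (rule sym, rule star_bop_eqI)
  fix x y :: "('g, 'h) L2"
  obtain f where f: "f \<in> square_integrable haar" "x = abs_L2 f" by (rule L2_repE)
  obtain g where g: "g \<in> square_integrable haar" "y = abs_L2 g" by (rule L2_repE)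
  show "cinner x (bop_apply (regular_rep \<pi> \<alpha> (star a)) y) = cinner (bop_apply (regular_rep \<pi> \<alpha> a) x) y"
    using square_integrable_regular_rep[OF g(1), of "star a"] square_integrable_regular_rep[OF f(1), of a]
    unfolding f(2) g(2) regular_rep_abs_L2[OF f(1)] regular_rep_abs_L2[OF g(1)]
    by (simp add: cinner_abs_L2 f(1) g(1) alpha_simps pi_simps cinner_star_bop)
qed

lemma translation_regular_rep:
  "translation s * regular_rep \<pi> \<alpha> a = regular_rep \<pi> \<alpha> (\<alpha> s a) * translation s"
proof (rule bop_eqI)
  fix x :: "('g, 'h) L2"
  obtain f where f: "f \<in> square_integrable haar" "x = abs_L2 f" by (rule L2_repE)
  show "bop_apply (translation s * regular_rep \<pi> \<alpha> a) x = bop_apply (regular_rep \<pi> \<alpha> (\<alpha> s a) * translation s) x"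
    unfolding f(2)
    by (simp add: times_bop.rep_eq regular_rep_abs_L2 translation_abs_L2 square_integrable_regular_rep
        square_integrable_translation f(1) alpha_alpha minus_add)
qed

end

section \<open>Convolution operators\<close>

text \<open>The integrated form of the left regular representation, characterized by its matrix
  coefficients, since the translations are in general not norm continuous.\<close>

definition convolution_operator :: "('g::locally_compact_group \<Rightarrow> complex) \<Rightarrow> ('g, 'h::complex_hilbert_space) L2 bop" where
  "convolution_operator f = (SOME T. \<forall>x y. cinner (bop_apply T x) y
     = (LINT s|haar. f s * cinner (bop_apply (translation s) x) y))"

lemma continuous_cinner_left:
  "continuous_on A u \<Longrightarrow> continuous_on A (\<lambda>s. cinner (u s) (y :: 'h::complex_hilbert_space))"
proof -
  assume u: "continuous_on A u"
  have "bounded_linear (\<lambda>x. cinner x y)"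
    by (rule bounded_linear_intro[where K = "norm y"])
      (simp_all add: cinner_add_left scaleR_scaleC cinner_scaleC_left scaleR_conv_of_real cmod_cinner_le)
  from bounded_linear.continuous_on[OF this u] show ?thesis .
qed

lemma csc_integrable:
  fixes f :: "'g::locally_compact_group \<Rightarrow> complex"
  assumes f: "f \<in> compactly_supported_continuous" and u: "continuous_on UNIV u"
  shows "integrable haar (\<lambda>s. f s * u s)"
proof -
  obtain K where K: "compact K" "\<And>t. t \<notin> K \<Longrightarrow> f t = 0" and cf: "continuous_on UNIV f"
    using f unfolding compactly_supported_continuous_def by blast
  show ?thesis
    by (rule integrable_haar_compact_support[OF _ K(1)]) (use K in \<open>auto intro!: continuous_intros cf u\<close>)
qed

lemma csc_integrable_norm:
  fixes f :: "'g::locally_compact_group \<Rightarrow> complex"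
  assumes f: "f \<in> compactly_supported_continuous"
  shows "integrable haar (\<lambda>s. cmod (f s))"
  using csc_integrable[OF f continuous_on_const[of UNIV 1]] by simp

lemma cinner_convolution_operator:
  fixes f :: "'g::locally_compact_group \<Rightarrow> complex" and x y :: "('g, 'h::complex_hilbert_space) L2"
  assumes f: "f \<in> compactly_supported_continuous"
  shows "cinner (bop_apply (convolution_operator f) x) y = (LINT s|haar. f s * cinner (bop_apply (translation s) x) y)"
    and "norm (convolution_operator f :: ('g, 'h) L2 bop) \<le> (LINT s|haar. cmod (f s))"
proof -
  have int: "integrable haar (\<lambda>s. f s * cinner (bop_apply (translation s) x) y)" for x y :: "('g, 'h) L2"
    by (rule csc_integrable[OF f continuous_cinner_left[OF continuous_translation]])
  have lin: "linear (bop_apply T)" for T :: "('g, 'h) L2 bop"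
    by (rule bounded_linear.linear[OF bounded_linear_bop_apply])
  have bound: "cmod (LINT s|haar. f s * cinner (bop_apply (translation s) x) y) \<le> (LINT s|haar. cmod (f s)) * norm x * norm y"
    for x y :: "('g, 'h) L2"
  proof -
    have "cmod (LINT s|haar. f s * cinner (bop_apply (translation s) x) y) \<le> (LINT s|haar. cmod (f s) * (norm x * norm y))"
    proof (rule norm_integral_le)
      show "integrable haar (\<lambda>s. cmod (f s) * (norm x * norm y))"
        by (rule integrable_mult_left[OF csc_integrable_norm[OF f]])
      show "cmod (f s * cinner (bop_apply (translation s) x) y) \<le> cmod (f s) * (norm x * norm y)" for s
        using cmod_cinner_le[of "bop_apply (translation s) x" y]
        by (simp add: norm_mult norm_translation_apply mult_left_mono)
    qed
    also have "\<dots> = (LINT s|haar. cmod (f s)) * norm x * norm y" by (simp add: mult.assoc)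
    finally show ?thesis .
  qed
  have pos: "0 \<le> (LINT s|haar. cmod (f s))" by simp
  have ex: "\<exists>T :: ('g, 'h) L2 bop. (\<forall>x y. cinner (bop_apply T x) y = (LINT s|haar. f s * cinner (bop_apply (translation s) x) y))
      \<and> norm T \<le> (LINT s|haar. cmod (f s))"
    by (rule sesquilinear_form_bop[OF _ _ _ _ bound pos])
      (simp_all add: linear_add[OF lin] bop_apply_scaleC cinner_add_left cinner_add_right distrib_left
        cinner_scaleC_left cinner_scaleC_right int mult.left_commute)
  then have "\<exists>T :: ('g, 'h) L2 bop. \<forall>x y. cinner (bop_apply T x) y = (LINT s|haar. f s * cinner (bop_apply (translation s) x) y)"
    by blast
  from someI_ex[OF this]
  have eq: "cinner (bop_apply (convolution_operator f) x) y = (LINT s|haar. f s * cinner (bop_apply (translation s) x) y)"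
    for x y :: "('g, 'h) L2"
    unfolding convolution_operator_def by blast
  show "cinner (bop_apply (convolution_operator f) x) y = (LINT s|haar. f s * cinner (bop_apply (translation s) x) y)"
    by (rule eq)
  show "norm (convolution_operator f :: ('g, 'h) L2 bop) \<le> (LINT s|haar. cmod (f s))"
    by (rule norm_bop_le_cinner[OF _ pos]) (simp add: eq bound)
qed

lemma csc_translate:
  fixes f :: "'g::locally_compact_group \<Rightarrow> complex"
  assumes f: "f \<in> compactly_supported_continuous"
  shows "(\<lambda>s. f (r + s)) \<in> compactly_supported_continuous"
proof -
  obtain K where K: "compact K" "\<And>t. t \<notin> K \<Longrightarrow> f t = 0" and cf: "continuous_on UNIV f"
    using f unfolding compactly_supported_continuous_def by blast
  have "compact ((\<lambda>t. - r + t) ` K)"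
    by (intro compact_continuous_image continuous_intros K)
  moreover have "f (r + t) = 0" if "t \<notin> (\<lambda>t. - r + t) ` K" for t
    using that K(2) by (auto simp: image_translation_eq_vimage)
  moreover have "continuous_on UNIV (\<lambda>s. f (r + s))"
    by (rule continuous_on_compose2[OF cf]) (auto intro!: continuous_intros)
  ultimately show ?thesis unfolding compactly_supported_continuous_def by blast
qed

lemma csc_diff:
  fixes f g :: "'g::t2_space \<Rightarrow> complex"
  assumes "f \<in> compactly_supported_continuous" "g \<in> compactly_supported_continuous"
  shows "(\<lambda>s. f s - g s) \<in> compactly_supported_continuous"
proof -
  obtain K where K: "compact K" "\<And>t. t \<notin> K \<Longrightarrow> f t = 0" and cf: "continuous_on UNIV f"
    using assms unfolding compactly_supported_continuous_def by blast
  obtain L where L: "compact L" "\<And>t. t \<notin> L \<Longrightarrow> g t = 0" and cg: "continuous_on UNIV g"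
    using assms unfolding compactly_supported_continuous_def by blast
  have "compact (K \<union> L)" using K L by (simp add: compact_Un)
  moreover have "continuous_on UNIV (\<lambda>s. f s - g s)" by (intro continuous_intros cf cg)
  moreover have "f t - g t = 0" if "t \<notin> K \<union> L" for t using that K L by simp
  ultimately show ?thesis unfolding compactly_supported_continuous_def by blast
qed

lemma convolution_operator_diff:
  fixes f g :: "'g::locally_compact_group \<Rightarrow> complex"
  assumes f: "f \<in> compactly_supported_continuous" and g: "g \<in> compactly_supported_continuous"
  shows "convolution_operator f - convolution_operator g
    = (convolution_operator (\<lambda>s. f s - g s) :: ('g, 'h::complex_hilbert_space) L2 bop)"
proof (rule bop_eqI_cinner)
  fix x y :: "('g, 'h) L2"
  have int: "integrable haar (\<lambda>s. f s * cinner (bop_apply (translation s) x) y)"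
    "integrable haar (\<lambda>s. g s * cinner (bop_apply (translation s) x) y)"
    by (rule csc_integrable[OF f continuous_cinner_left[OF continuous_translation]]
        csc_integrable[OF g continuous_cinner_left[OF continuous_translation]])+
  then show "cinner (bop_apply (convolution_operator f - convolution_operator g) x) y
      = cinner (bop_apply (convolution_operator (\<lambda>s. f s - g s)) x) y"
    by (simp add: minus_bop.rep_eq cinner_diff_left cinner_convolution_operator(1) f g csc_diff left_diff_distrib)
qed

text \<open>By left invariance the translation is absorbed into \<open>f\<close>, so products of a
  translated convolution operator with the regular representation are again generators of the
  crossed product.\<close>

lemma translation_convolution_operator:
  fixes f :: "'g::locally_compact_group \<Rightarrow> complex"
  assumes f: "f \<in> compactly_supported_continuous"
  shows "translation (- r) * convolution_operator f
    = (convolution_operator (\<lambda>s. f (r + s)) :: ('g, 'h::complex_hilbert_space) L2 bop)"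
proof (rule bop_eqI_cinner)
  fix x y :: "('g, 'h) L2"
  define F where "F s = f s * cinner (bop_apply (translation s) x) (bop_apply (translation r) y)" for s
  have "integrable haar F"
    unfolding F_def by (rule csc_integrable[OF f continuous_cinner_left[OF continuous_translation]])
  then have Fm: "F \<in> borel_measurable haar" by simp
  have "cinner (bop_apply (translation (- r) * convolution_operator f) x) y
      = cinner (bop_apply (translation r) (bop_apply (translation (- r)) (bop_apply (convolution_operator f) x))) (bop_apply (translation r) y)"
    by (simp add: cinner_translation times_bop.rep_eq)
  also have "\<dots> = cinner (bop_apply (convolution_operator f) x) (bop_apply (translation r) y)"
    by (simp add: translation_translation translation_zero)
  also have "\<dots> = (LINT s|haar. F s)" by (simp add: cinner_convolution_operator(1)[OF f] F_def)
  also have "\<dots> = (LINT s|haar. F (r + s))" by (rule integral_haar_translation[OF Fm, symmetric])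
  also have "\<dots> = (LINT s|haar. f (r + s) * cinner (bop_apply (translation s) x) y)"
    by (simp add: F_def cinner_translation flip: translation_translation)
  finally show "cinner (bop_apply (translation (- r) * convolution_operator f) x) y
      = cinner (bop_apply (convolution_operator (\<lambda>s. f (r + s))) x) y"
    by (simp add: cinner_convolution_operator(1) csc_translate f)
qed

text \<open>Conjugation replaces \<open>s\<close> by \<open>g + s - g\<close> under the weak
  integral; the invariance of \<open>f\<close> and of Haar measure undo this. In effect the
  convolution operator commutes with \<open>translation g\<close>.\<close>

lemma convolution_operator_conjugation:
  fixes f :: "'g::locally_compact_group \<Rightarrow> complex"
  assumes f: "f \<in> compactly_supported_continuous" and basis: "invariant_neighbourhood_basis g"
    and inv: "\<And>s. f (g + s - g) = f s"
  shows "bop_apply (translation g) (bop_apply (convolution_operator f) (bop_apply (translation (- g)) x))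
    = bop_apply (convolution_operator f) (x :: ('g, 'h::complex_hilbert_space) L2)"
proof -
  obtain K where K: "compact K" "\<And>t. t \<notin> K \<Longrightarrow> f t = 0" and cf: "continuous_on UNIV f"
    using f unfolding compactly_supported_continuous_def by blast
  have "cinner (bop_apply (translation g) (bop_apply (convolution_operator f) (bop_apply (translation (- g)) x))) y
      = cinner (bop_apply (convolution_operator f) x) y" for y
  proof -
    define u where "u s = f s * cinner (bop_apply (translation s) x) y" for s
    have u: "continuous_on UNIV u"
      unfolding u_def by (intro continuous_on_mult cf continuous_cinner_left continuous_translation)
    have "cinner (bop_apply (translation g) (bop_apply (convolution_operator f) (bop_apply (translation (- g)) x))) y
        = cinner (bop_apply (convolution_operator f) (bop_apply (translation (- g)) x)) (bop_apply (translation (- g)) y)"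
      by (subst cinner_translation[of "- g", symmetric]) (simp add: translation_translation translation_zero)
    also have "\<dots> = (LINT s|haar. f s * cinner (bop_apply (translation (s + - g)) x) (bop_apply (translation (- g)) y))"
      by (simp add: cinner_convolution_operator(1)[OF f] translation_translation)
    also have "\<dots> = (LINT s|haar. u (g + s - g))"
    proof (rule Bochner_Integration.integral_cong[OF refl])
      fix s
      have "cinner (bop_apply (translation (s + - g)) x) (bop_apply (translation (- g)) y)
          = cinner (bop_apply (translation (g + s - g)) x) y"
        by (subst cinner_translation[of g, symmetric])
          (simp add: translation_translation translation_zero group_add_assoc_simps del: add_uminus_conv_diff)
      then show "f s * cinner (bop_apply (translation (s + - g)) x) (bop_apply (translation (- g)) y) = u (g + s - g)"
        by (simp add: u_def inv)
    qed
    also have "\<dots> = (LINT s|haar. u s)"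
      by (rule integral_haar_conjugation[OF basis u K(1)]) (simp add: u_def K)
    also have "\<dots> = cinner (bop_apply (convolution_operator f) x) y"
      by (simp add: u_def cinner_convolution_operator(1)[OF f])
    finally show ?thesis .
  qed
  then show ?thesis
    by (intro cinner_eqI) (metis cinner_commute)
qed

text \<open>Convolution operators are bounded by the \<open>L^1\<close> norm, in which translates of
  \<open>f\<close> vary continuously. Convolution thus turns strongly continuous translations into
  norm continuous families.\<close>

lemma continuous_convolution_operator_translate:
  fixes f :: "'g::locally_compact_group \<Rightarrow> complex"
  assumes f: "f \<in> compactly_supported_continuous"
  shows "continuous_on UNIV (\<lambda>s. convolution_operator (\<lambda>r. f (s + r)) :: ('g, 'h::complex_hilbert_space) L2 bop)"
proof (rule continuous_on_UNIV_normI)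
  fix s :: 'g and e :: real assume e: "e > 0"
  obtain K where K: "compact K" "\<And>t. t \<notin> K \<Longrightarrow> f t = 0" and cf: "continuous_on UNIV f"
    using f unfolding compactly_supported_continuous_def by blast
  obtain U0 K1 where U0: "open U0" "s \<in> U0" "U0 \<subseteq> K1" "compact K1"
    using locally_compact_group[of s] by blast
  \<comment> \<open>A compact set that supports all translates of \<open>f\<close> by elements near
    \<open>s\<close>.\<close>
  define R where "R = {x + y | x y. x \<in> uminus ` K1 \<and> y \<in> K}"
  have "compact (uminus ` K1)" by (intro compact_continuous_image continuous_intros U0)
  then have R: "compact R" unfolding R_def by (rule compact_sum_set(1)[OF _ K(1)])
  have fR: "f (s' + r) = 0" if "s' \<in> U0" "r \<notin> R" for s' r
  proof (rule ccontr)
    assume "f (s' + r) \<noteq> 0"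
    then have "s' + r \<in> K" using K(2) by blast
    moreover have "- s' \<in> uminus ` K1" using that U0 by auto
    moreover have "r = - s' + (s' + r)" by simp
    ultimately have "r \<in> R" unfolding R_def by blast
    then show False using that by simp
  qed
  define d where "d = e / (measure haar R + 1)"
  have pos: "measure haar R + 1 > 0" by (simp add: add_nonneg_pos)
  then have d: "d > 0" using e by (simp add: d_def)
  have "d * measure haar R \<le> d * (measure haar R + 1)" using d by simp
  also have "\<dots> = e" using pos by (simp add: d_def)
  finally have dR: "d * measure haar R \<le> e" .
  have "continuous_on UNIV (\<lambda>p. f (fst p + snd p))"
    by (rule continuous_on_compose2[OF cf]) (auto intro!: continuous_intros)
  from uniform_neighbourhood[OF this R d, of s] obtain U1 where
    U1: "open U1" "s \<in> U1" "\<forall>s'\<in>U1. \<forall>r\<in>R. cmod (f (s' + r) - f (s + r)) \<le> d" by auto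
  have "norm (convolution_operator (\<lambda>r. f (s' + r)) - convolution_operator (\<lambda>r. f (s + r)) :: ('g, 'h) L2 bop) \<le> e"
    if s': "s' \<in> U0 \<inter> U1" for s'
  proof -
    have "norm (convolution_operator (\<lambda>r. f (s' + r)) - convolution_operator (\<lambda>r. f (s + r)) :: ('g, 'h) L2 bop)
        \<le> (LINT r|haar. cmod (f (s' + r) - f (s + r)))"
      unfolding convolution_operator_diff[OF csc_translate[OF f] csc_translate[OF f]]
      by (rule cinner_convolution_operator(2)) (intro csc_diff csc_translate f)
    also have "\<dots> \<le> norm (LINT r|haar. cmod (f (s' + r) - f (s + r)))" by simp
    also have "\<dots> \<le> d * measure haar R"
      by (rule norm_integral_le_compact[OF R]) (use U1(3) s' fR U0(2) in auto)
    also have "\<dots> \<le> e" by (rule dR)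
    finally show ?thesis .
  qed
  then show "\<exists>U. open U \<and> s \<in> U \<and> (\<forall>s'\<in>U. norm (convolution_operator (\<lambda>r. f (s' + r))
      - convolution_operator (\<lambda>r. f (s + r)) :: ('g, 'h) L2 bop) \<le> e)"
    using U0 U1 by (intro exI[of _ "U0 \<inter> U1"]) auto
qed

section \<open>Elements of the reduced crossed product\<close>

text \<open>\<open>complex_span\<close> attaches coefficients to the elements of a set, whereas
  \<open>v\<close> may repeat a vector; the coefficients of equal vectors are added up.\<close>

lemma complex_span_sum:
  assumes I: "finite I" and v: "\<And>i. i \<in> I \<Longrightarrow> v i \<in> S"
  shows "(\<Sum>i\<in>I. c i *\<^sub>C v i) \<in> complex_span S"
proof -
  have sum_left: "(\<Sum>i\<in>A. c i *\<^sub>C x) = (\<Sum>i\<in>A. c i) *\<^sub>C x" for A x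
  proof (induction A rule: infinite_finite_induct)
    case (insert i A)
    then show ?case by (simp add: scaleC_add_left)
  qed (use scaleR_scaleC[of 0 x] in simp_all)
  have "(\<Sum>i\<in>I. c i *\<^sub>C v i) = (\<Sum>x\<in>v ` I. \<Sum>i\<in>{i\<in>I. v i = x}. c i *\<^sub>C v i)"
    by (rule sum.image_gen[OF I])
  also have "\<dots> = (\<Sum>x\<in>v ` I. (\<Sum>i\<in>{i\<in>I. v i = x}. c i) *\<^sub>C x)"
    by (rule sum.cong[OF refl]) (simp flip: sum_left)
  finally show ?thesis
    unfolding complex_span_def using I v
    by (auto intro!: exI[of _ "v ` I"] exI[of _ "\<lambda>x. \<Sum>i\<in>{i\<in>I. v i = x}. c i"])
qed

text \<open>The partition depends on \<open>G\<close> alone. Hence the Riemann estimates of all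
  matrix coefficients hold with the same pieces and combine into an estimate in operator
  norm.\<close>

lemma weak_integral_in_closure_span:
  fixes G :: "'g::locally_compact_group \<Rightarrow> 'k::complex_hilbert_space bop"
  assumes G: "continuous_on UNIV G" and K: "compact K" "\<And>s. s \<notin> K \<Longrightarrow> G s = 0"
    and S: "\<And>s. G s \<in> S"
    and X: "\<And>x y. cinner (bop_apply X x) y = (LINT s|haar. cinner (bop_apply (G s) x) y)"
  shows "X \<in> closure (complex_span S)"
  unfolding closure_approachable
proof (intro allI impI)
  fix e :: real assume e: "e > 0"
  define d where "d = e / 2 / (measure haar K + 1)"
  have pos: "measure haar K + 1 > 0" by (simp add: add_nonneg_pos)
  then have d: "d > 0" using e by (simp add: d_def)
  have "d * measure haar K \<le> d * (measure haar K + 1)" using d by simp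
  also have "\<dots> = e / 2" using pos by (metis d_def less_irrefl nonzero_eq_divide_eq)
  finally have dK: "d * measure haar K < e" using e by linarith
  define U where "U s = G -` ball (G s) d" for s
  have "open (U s) \<and> s \<in> U s" for s
    unfolding U_def using d by (auto intro!: open_vimage G)
  then obtain T E where T: "finite T" "T \<subseteq> K" and T': "disjoint_family_on E T" "(\<Union>t\<in>T. E t) = K"
    and E: "\<forall>t\<in>T. E t \<in> sets borel \<and> E t \<subseteq> U t"
    by (rule compact_borel_partition[OF K(1), of U]) (rule that)
  define Y where "Y = (\<Sum>t\<in>T. complex_of_real (measure haar (E t)) *\<^sub>C G t)"
  have Y: "Y \<in> complex_span S" unfolding Y_def by (rule complex_span_sum[OF T(1) S])
  have app_sum: "bop_apply (\<Sum>t\<in>I. c t *\<^sub>C G t) x = (\<Sum>t\<in>I. c t *\<^sub>C bop_apply (G t) x)" for I c x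
    by (induction I rule: infinite_finite_induct) (simp_all add: zero_bop.rep_eq plus_bop.rep_eq scaleC_bop.rep_eq)
  have "norm (X - Y) \<le> d * measure haar K"
  proof (rule norm_bop_le_cinner)
    fix x y
    define h where "h s = cinner (bop_apply (G s) x) y" for s
    have app: "continuous_on UNIV (\<lambda>s. bop_apply (G s) x)"
    proof -
      have "bounded_linear (\<lambda>T. bop_apply T x)"
        by (rule bounded_linear_intro[where K = "norm x"])
          (simp_all add: plus_bop.rep_eq scaleR_bop.rep_eq norm_bop_apply_le)
      from bounded_linear.continuous_on[OF this G] show ?thesis .
    qed
    have h0: "h s = 0" if "s \<notin> K" for s
      using K(2)[OF that] cinner_scaleC_left[of 0 0 y] by (simp add: h_def zero_bop.rep_eq scaleC_zero_right)
    have h: "integrable haar h"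
      unfolding h_def by (rule integrable_haar_compact_support[OF continuous_cinner_left[OF app] K(1)])
        (use h0 in \<open>simp add: h_def\<close>)
    have near: "cmod (h s - h t) \<le> d * norm x * norm y" if "t \<in> T" "s \<in> E t" for s t
    proof -
      have "norm (G s - G t) \<le> d" using E that by (force simp: U_def dist_norm norm_minus_commute)
      have "cmod (h s - h t) = cmod (cinner (bop_apply (G s - G t) x) y)"
        by (simp add: h_def minus_bop.rep_eq cinner_diff_left)
      also have "\<dots> \<le> norm (bop_apply (G s - G t) x) * norm y" by (rule cmod_cinner_le)
      also have "\<dots> \<le> (norm (G s - G t) * norm x) * norm y" by (intro mult_right_mono norm_bop_apply_le) simp
      also have "\<dots> \<le> (d * norm x) * norm y" using \<open>norm (G s - G t) \<le> d\<close> by (intro mult_right_mono) auto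
      finally show ?thesis .
    qed
    have "cinner (bop_apply (X - Y) x) y = integral\<^sup>L haar h - (\<Sum>t\<in>T. measure haar (E t) *\<^sub>R h t)"
      by (simp add: minus_bop.rep_eq cinner_diff_left X Y_def app_sum cinner_sum_left cinner_scaleC_left
          h_def[abs_def] scaleR_conv_of_real)
    also have "cmod \<dots> \<le> d * norm x * norm y * measure haar K"
      by (rule riemann_sum_estimate[OF K(1) T(1) T' _ h h0 near]) (use E in \<open>auto simp: sets_haar_borel\<close>)
    finally show "cmod (cinner (bop_apply (X - Y) x) y) \<le> d * measure haar K * norm x * norm y"
      by (simp add: ac_simps)
  qed (use d in simp)
  then have "dist Y X < e" using dK by (simp add: dist_norm norm_minus_commute)
  then show "\<exists>y\<in>complex_span S. dist y X < e" using Y by blast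
qed

context represented_system
begin

definition generators :: "('g, 'h) L2 bop set" where
  "generators = {X. \<exists>f\<in>compactly_supported_continuous. \<exists>a.
         has_weak_integral haar (\<lambda>s. f s *\<^sub>C (regular_rep \<pi> \<alpha> a * translation s)) X}"

lemma regular_rep_convolution_generator:
  assumes f: "f \<in> compactly_supported_continuous"
  shows "regular_rep \<pi> \<alpha> a * convolution_operator f \<in> generators"
proof -
  have "has_weak_integral haar (\<lambda>s. f s *\<^sub>C (regular_rep \<pi> \<alpha> a * translation s)) (regular_rep \<pi> \<alpha> a * convolution_operator f)"
    unfolding has_weak_integral_def
  proof (intro allI conjI)
    fix x y :: "('g, 'h) L2"
    have eq: "cinner (bop_apply (f s *\<^sub>C (regular_rep \<pi> \<alpha> a * translation s)) x) y
        = f s * cinner (bop_apply (translation s) x) (bop_apply (star (regular_rep \<pi> \<alpha> a)) y)" for s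
      by (simp add: scaleC_bop.rep_eq times_bop.rep_eq cinner_scaleC_left cinner_star_bop)
    show "integrable haar (\<lambda>s. cinner (bop_apply (f s *\<^sub>C (regular_rep \<pi> \<alpha> a * translation s)) x) y)"
      unfolding eq by (rule csc_integrable[OF f continuous_cinner_left[OF continuous_translation]])
    show "cinner (bop_apply (regular_rep \<pi> \<alpha> a * convolution_operator f) x) y
        = (LINT s|haar. cinner (bop_apply (f s *\<^sub>C (regular_rep \<pi> \<alpha> a * translation s)) x) y)"
      unfolding eq cinner_convolution_operator(1)[OF f, symmetric]
      by (simp add: times_bop.rep_eq cinner_star_bop)
  qed
  then show ?thesis unfolding generators_def using f by blast
qed

lemma generators_in_crossed_product: "generators \<subseteq> reduced_crossed_product \<pi> \<alpha>"
proof
  fix X assume "X \<in> generators"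
  then have "(\<Sum>i\<in>{()}. 1 *\<^sub>C X) \<in> complex_span generators" by (intro complex_span_sum) auto
  then have "X \<in> complex_span generators" by (simp add: scaleC_one)
  then show "X \<in> reduced_crossed_product \<pi> \<alpha>"
    unfolding reduced_crossed_product_def generators_def[symmetric] using closure_subset by blast
qed

text \<open>The integrand of the weak integral representing this operator is norm continuous, so that
  the integral is a norm limit of Riemann sums.\<close>

lemma compression_in_crossed_product:
  assumes f: "f \<in> compactly_supported_continuous" and real: "\<And>s. cnj (f s) = f s"
  shows "star (convolution_operator f) * (regular_rep \<pi> \<alpha> a * convolution_operator f) \<in> reduced_crossed_product \<pi> \<alpha>"
proof -
  obtain K where K: "compact K" "\<And>t. t \<notin> K \<Longrightarrow> f t = 0" and cf: "continuous_on UNIV f"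
    using f unfolding compactly_supported_continuous_def by blast
  define L where "L = (convolution_operator f :: ('g, 'h) L2 bop)"
  \<comment> \<open>By covariance this is \<open>f s\<close> times the translate by
    \<open>- s\<close> of the product of \<open>regular_rep \<pi> \<alpha> a\<close> and
    \<open>L\<close>. The factor \<open>star L\<close> conjugates the scalar and inverts the
    translation under the integral; \<open>f\<close> is real, so the conjugation has no
    effect.\<close>
  define G where "G s = regular_rep \<pi> \<alpha> (f s *\<^sub>C \<alpha> (- s) a) * convolution_operator (\<lambda>r. f (s + r))" for s
  have rep_cont: "continuous_on UNIV (regular_rep \<pi> \<alpha>)"
    unfolding continuous_on_iff dist_norm regular_rep_diff[symmetric]
    using norm_regular_rep_le by (meson le_less_trans)
  have sc_cont: "continuous_on UNIV (\<lambda>s. f s *\<^sub>C \<alpha> (- s) a)"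
  proof (rule continuous_on_UNIV_normI)
    fix s :: 'g and e :: real assume e: "e > 0"
    define q where "q s' = cmod (f s' - f s) * norm (\<alpha> (- s') a) + cmod (f s) * norm (\<alpha> (- s') a - \<alpha> (- s) a)" for s'
    have ac: "continuous_on UNIV (\<lambda>t. \<alpha> (- t) a)"
      by (rule continuous_on_compose2[OF alpha_continuous]) (auto intro!: continuous_intros)
    have "continuous_on UNIV q" unfolding q_def by (intro continuous_intros cf ac)
    then have "open {s'. q s' < e}" by (intro open_Collect_less continuous_on_const)
    moreover have "s \<in> {s'. q s' < e}" using e by (simp add: q_def)
    moreover have "norm (f s' *\<^sub>C \<alpha> (- s') a - f s *\<^sub>C \<alpha> (- s) a) \<le> q s'" for s'
    proof -
      have "f s' *\<^sub>C \<alpha> (- s') a = (f s' - f s) *\<^sub>C \<alpha> (- s') a + f s *\<^sub>C \<alpha> (- s') a"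
        by (simp flip: scaleC_add_left)
      then have "f s' *\<^sub>C \<alpha> (- s') a - f s *\<^sub>C \<alpha> (- s) a
          = (f s' - f s) *\<^sub>C \<alpha> (- s') a + f s *\<^sub>C (\<alpha> (- s') a - \<alpha> (- s) a)"
        by (simp add: scaleC_diff_right)
      then show ?thesis
        using norm_triangle_ineq[of "(f s' - f s) *\<^sub>C \<alpha> (- s') a" "f s *\<^sub>C (\<alpha> (- s') a - \<alpha> (- s) a)"]
        by (simp add: q_def norm_scaleC)
    qed
    ultimately show "\<exists>U. open U \<and> s \<in> U \<and> (\<forall>s'\<in>U. norm (f s' *\<^sub>C \<alpha> (- s') a - f s *\<^sub>C \<alpha> (- s) a) \<le> e)"
      by (intro exI[of _ "{s'. q s' < e}"]) (auto intro: order_trans less_imp_le)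
  qed
  have "star L * (regular_rep \<pi> \<alpha> a * L) \<in> closure (complex_span generators)"
  proof (rule weak_integral_in_closure_span)
    show "continuous_on UNIV G"
      unfolding G_def
      by (intro continuous_on_mult continuous_convolution_operator_translate[OF f]
          continuous_on_compose2[OF rep_cont sc_cont]) simp
    show "compact K" by (rule K)
    show "G s = 0" if "s \<notin> K" for s
      using K(2)[OF that] regular_rep_scaleC[of 0 0] scaleR_scaleC[of 0 "\<alpha> (- s) a"]
        scaleR_scaleC[of 0 "regular_rep \<pi> \<alpha> 0"] by (simp add: G_def scaleC_zero_right)
    show "G s \<in> generators" for s
      unfolding G_def by (rule regular_rep_convolution_generator[OF csc_translate[OF f]])
    fix x y :: "('g, 'h) L2"
    define z where "z = bop_apply (regular_rep \<pi> \<alpha> a) (bop_apply L x)"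
    have "cinner (bop_apply (star L * (regular_rep \<pi> \<alpha> a * L)) x) y = cinner z (bop_apply L y)"
      by (simp add: times_bop.rep_eq cinner_star_bop' z_def)
    also have "\<dots> = cnj (cinner (bop_apply L y) z)" by (rule cinner_commute)
    also have "\<dots> = cnj (LINT s|haar. f s * cinner (bop_apply (translation s) y) z)"
      by (simp add: L_def cinner_convolution_operator(1)[OF f])
    also have "\<dots> = (LINT s|haar. cnj (f s * cinner (bop_apply (translation s) y) z))"
      by (rule Bochner_Integration.integral_cnj[symmetric])
    also have "\<dots> = (LINT s|haar. cinner (bop_apply (G s) x) y)"
    proof (rule Bochner_Integration.integral_cong[OF refl])
      fix s
      have "cinner z (bop_apply (translation s) y) = cinner (bop_apply (translation (- s)) z) y"
        by (subst cinner_translation[of "- s", symmetric]) (simp add: translation_translation translation_zero)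
      also have "bop_apply (translation (- s)) z
          = bop_apply (translation (- s) * regular_rep \<pi> \<alpha> a * L) x"
        by (simp add: z_def times_bop.rep_eq)
      also have "translation (- s) * regular_rep \<pi> \<alpha> a * L
          = regular_rep \<pi> \<alpha> (\<alpha> (- s) a) * convolution_operator (\<lambda>r. f (s + r))"
        by (simp add: translation_regular_rep mult.assoc L_def translation_convolution_operator[OF f])
      finally have "cinner z (bop_apply (translation s) y)
          = cinner (bop_apply (regular_rep \<pi> \<alpha> (\<alpha> (- s) a) * convolution_operator (\<lambda>r. f (s + r))) x) y" .
      moreover have "cnj (f s * cinner (bop_apply (translation s) y) z) = f s * cinner z (bop_apply (translation s) y)"
        by (simp add: real cinner_commute[of z])
      ultimately show "cnj (f s * cinner (bop_apply (translation s) y) z) = cinner (bop_apply (G s) x) y"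
        by (simp add: G_def regular_rep_scaleC mult_scaleC_left scaleC_bop.rep_eq cinner_scaleC_left)
    qed
    finally show "cinner (bop_apply (star L * (regular_rep \<pi> \<alpha> a * L)) x) y = (LINT s|haar. cinner (bop_apply (G s) x) y)" .
  qed
  then show ?thesis
    by (simp add: reduced_crossed_product_def generators_def L_def)
qed

end

section \<open>Approximate factorization through the crossed product\<close>

context represented_system
begin

definition compression :: "('g \<Rightarrow> complex) \<Rightarrow> 'a \<Rightarrow> ('g, 'h) L2 bop" where
  "compression f a = star (convolution_operator f) * (regular_rep \<pi> \<alpha> a * convolution_operator f)"

lemma compression_add: "compression f (a + b) = compression f a + compression f b"
  by (simp add: compression_def regular_rep_add distrib_left distrib_right)

lemma compression_scaleC: "compression f (c *\<^sub>C a) = c *\<^sub>C compression f a"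
  by (simp add: compression_def regular_rep_scaleC mult_scaleC_left mult_scaleC_right)

lemma compression_sum: "compression f (\<Sum>i\<in>I. v i) = (\<Sum>i\<in>I. compression f (v i))"
proof -
  have "compression f 0 = 0" using compression_add[of f 0 0] by simp
  then show ?thesis by (induction I rule: infinite_finite_induct) (simp_all add: compression_add)
qed

lemma compression_star_mult:
  "compression f (star a * b)
    = star (regular_rep \<pi> \<alpha> a * convolution_operator f) * (regular_rep \<pi> \<alpha> b * convolution_operator f)"
  by (simp add: compression_def regular_rep_mult regular_rep_star star_mult mult.assoc)

text \<open>Positivity must be witnessed inside the crossed product. The factor \<open>y\<close> is
  replaced by its image times the convolution operator, which is a generator although the
  convolution operator alone need not belong to the crossed product.\<close>

lemma positive_matrix_compression:
  assumes f: "f \<in> compactly_supported_continuous" and x: "positive_matrix UNIV n x"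
  shows "positive_matrix (reduced_crossed_product \<pi> \<alpha>) n (\<lambda>i j. compression f (x i j))"
proof -
  obtain y where y: "\<forall>i<n. \<forall>j<n. x i j = (\<Sum>k<n. star (y k i) * y k j)"
    using x by (auto simp: positive_matrix_def)
  show ?thesis
    unfolding positive_matrix_def
  proof (intro exI conjI allI impI)
    show "regular_rep \<pi> \<alpha> (y i j) * convolution_operator f \<in> reduced_crossed_product \<pi> \<alpha>" for i j
      using regular_rep_convolution_generator[OF f] generators_in_crossed_product by blast
    fix i j assume "i < n" "j < n"
    then show "compression f (x i j) = (\<Sum>k<n. star (regular_rep \<pi> \<alpha> (y k i) * convolution_operator f)
        * (regular_rep \<pi> \<alpha> (y k j) * convolution_operator f))"
      using y by (simp add: compression_sum compression_star_mult)
  qed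
qed

lemma norm_compression_le:
  assumes f: "f \<in> compactly_supported_continuous" and le: "(LINT s|haar. cmod (f s)) \<le> 1"
  shows "norm (compression f a) \<le> norm a"
proof -
  define L where "L = (convolution_operator f :: ('g, 'h) L2 bop)"
  have L: "norm L \<le> 1" using cinner_convolution_operator(2)[OF f] le unfolding L_def by (rule order_trans)
  have "norm (compression f a) \<le> norm (star L) * norm (regular_rep \<pi> \<alpha> a * L)"
    unfolding compression_def L_def[symmetric] by (rule norm_mult_ineq)
  also have "\<dots> \<le> norm (star L) * (norm (regular_rep \<pi> \<alpha> a) * norm L)"
    by (intro mult_left_mono norm_mult_ineq) simp
  also have "\<dots> \<le> 1 * (norm a * 1)"
    using L norm_regular_rep_le[of a] by (intro mult_mono) (auto simp: norm_star)
  finally show ?thesis by simp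
qed

text \<open>Both outer factors commute with \<open>translation g\<close>, so the conjugation acts on
  the middle factor only, where it is \<alpha> by covariance.\<close>

lemma Ad_compression:
  assumes f: "f \<in> compactly_supported_continuous" and basis: "invariant_neighbourhood_basis g"
    and inv: "\<And>s. f (g + s - g) = f s"
  shows "Ad_translation g (compression f a) = compression f (\<alpha> g a)"
proof -
  define L where "L = (convolution_operator f :: ('g, 'h) L2 bop)"
  define T where "T = (translation g :: ('g, 'h) L2 bop)"
  define T' where "T' = (translation (- g) :: ('g, 'h) L2 bop)"
  have TT': "T * (T' * X) = X" "T' * (T * X) = X" for X
    by (rule bop_eqI; simp add: T_def T'_def times_bop.rep_eq translation_translation translation_zero)+
  have st: "star T = T'" "star T' = T" by (simp_all add: T_def T'_def star_translation)
  have "T * (L * T') = L"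
    by (rule bop_eqI) (simp add: T_def T'_def L_def times_bop.rep_eq convolution_operator_conjugation[OF f basis inv])
  then have LT: "L * T' = T' * L" using TT'(2)[of "L * T'"] by simp
  have "T * star L = star (L * T')" by (simp add: star_mult st)
  also have "\<dots> = star L * T" unfolding LT by (simp add: star_mult st)
  finally have TL: "T * star L = star L * T" .
  have "Ad_translation g (compression f a) = T * star L * (regular_rep \<pi> \<alpha> a * (L * T'))"
    by (simp add: Ad_translation_def compression_def mult.assoc st flip: T_def L_def)
  also have "\<dots> = star L * (T * regular_rep \<pi> \<alpha> a * (T' * L))"
    unfolding TL LT by (simp add: mult.assoc)
  also have "T * regular_rep \<pi> \<alpha> a = regular_rep \<pi> \<alpha> (\<alpha> g a) * T"
    unfolding T_def by (rule translation_regular_rep)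
  finally show ?thesis by (simp add: compression_def mult.assoc TT' flip: L_def)
qed

lemma Ad_compression_funpow:
  assumes "f \<in> compactly_supported_continuous" "invariant_neighbourhood_basis g" "\<And>s. f (g + s - g) = f s"
  shows "(Ad_translation g ^^ i) (compression f a) = compression f ((\<alpha> g ^^ i) a)"
  by (induction i) (simp_all add: Ad_compression[OF assms])

text \<open>Every iterate is the action of one group element that leaves all compact
  \<open>g\<close>-invariant sets invariant. Estimates along the orbit thus reduce to estimates over
  \<open>conjugators g\<close>.\<close>

lemma alpha_funpow: "\<exists>x\<in>conjugators g. \<forall>a. (\<alpha> g ^^ i) a = \<alpha> x a"
proof (induction i)
  case 0
  show ?case by (intro bexI[of _ 0]) (simp_all add: alpha_zero conjugators_zero)
next
  case (Suc i)
  then obtain x where "x \<in> conjugators g" "\<forall>a. (\<alpha> g ^^ i) a = \<alpha> x a" by blast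
  then show ?case
    using conjugators_add[OF conjugators_self] by (auto simp: alpha_alpha intro!: bexI[of _ "g + x"])
qed

lemma cp_contraction_to_mat_compression:
  assumes f: "f \<in> compactly_supported_continuous" "\<And>s. cnj (f s) = f s" and le: "(LINT s|haar. cmod (f s)) \<le> 1"
    and \<phi>: "cp_contraction_to_mat (reduced_crossed_product \<pi> \<alpha>) m \<phi>"
  shows "cp_contraction_to_mat UNIV m (\<lambda>a. \<phi> (compression f a))"
proof -
  have mem: "compression f a \<in> reduced_crossed_product \<pi> \<alpha>" for a
    unfolding compression_def by (rule compression_in_crossed_product[OF f])
  have "mat_norm (\<phi> (compression f a)) \<le> norm a" for a
  proof -
    have "mat_norm (\<phi> (compression f a)) \<le> norm (compression f a)"
      using \<phi> mem unfolding cp_contraction_to_mat_def by blast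
    also have "\<dots> \<le> norm a" by (rule norm_compression_le[OF f(1) le])
    finally show ?thesis .
  qed
  moreover have "positive_matrix_mat m n (\<lambda>i j. \<phi> (compression f (x i j)))" if "positive_matrix UNIV n x" for n x
    using \<phi> positive_matrix_compression[OF f(1) that] unfolding cp_contraction_to_mat_def by blast
  ultimately show ?thesis
    using \<phi> mem unfolding cp_contraction_to_mat_def by (simp add: compression_add compression_scaleC)
qed

end

section \<open>Compression of operators along an isometry\<close>

lemma cp_contraction_from_mat_compress:
  fixes V :: "'h::complex_hilbert_space \<Rightarrow> 'k::complex_hilbert_space"
  assumes \<psi>: "cp_contraction_from_mat m \<psi>"
    and \<Psi>: "\<And>T x y. cinner (bop_apply (\<Psi> T) x) y = cinner (bop_apply T (V x)) (V y)"
    and norm: "\<And>T. norm (\<Psi> T) \<le> norm T"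
  shows "cp_contraction_from_mat m (\<lambda>A. \<Psi> (\<psi> A))"
proof -
  have add: "\<Psi> (S + T) = \<Psi> S + \<Psi> T" for S T
    by (rule bop_eqI_cinner) (simp add: \<Psi> plus_bop.rep_eq cinner_add_left)
  have sc: "\<Psi> (z *\<^sub>C T) = z *\<^sub>C \<Psi> T" for z T
    by (rule bop_eqI_cinner) (simp add: \<Psi> scaleC_bop.rep_eq cinner_scaleC_left)
  have "positive_matrix_bop n (\<lambda>i j. \<Psi> (\<psi> (x i j)))" if "positive_matrix_mat m n x" for n x
  proof -
    have "positive_matrix_bop n (\<lambda>i j. \<psi> (x i j))"
      using \<psi> that unfolding cp_contraction_from_mat_def by blast
    then have pos: "(\<Sum>i<n. \<Sum>j<n. cinner (bop_apply (\<psi> (x i j)) (v j)) (v i)) \<in> \<real>\<^sub>\<ge>\<^sub>0" for v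
      unfolding positive_matrix_bop_def by blast
    show ?thesis unfolding positive_matrix_bop_def \<Psi> by (intro allI pos)
  qed
  moreover have "norm (\<Psi> (\<psi> A)) \<le> mat_norm A" if "A \<in> carrier_mat m m" for A
    using \<psi> that norm[of "\<psi> A"] unfolding cp_contraction_from_mat_def by (meson order_trans)
  ultimately show ?thesis
    using \<psi> unfolding cp_contraction_from_mat_def by (simp add: add sc)
qed

text \<open>This is \<open>T\<close> multiplied by \<open>V\<close> on the right and by the adjoint
  of \<open>V\<close> on the left. As \<open>V\<close> acts between different spaces and
  \<open>star\<close> is an operation on operators of a single space, the map is described by its
  sesquilinear form.\<close>

lemma ex_compression_map:
  fixes V :: "'h::complex_hilbert_space \<Rightarrow> 'k::complex_hilbert_space"
  assumes add: "\<And>x y. V (x + y) = V x + V y" and sc: "\<And>c x. V (c *\<^sub>C x) = c *\<^sub>C V x"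
    and norm: "\<And>x. norm (V x) = norm x"
  obtains \<Psi> where "\<forall>T x y. cinner (bop_apply (\<Psi> T) x) y = cinner (bop_apply T (V x)) (V y)"
    "\<forall>T. norm (\<Psi> T) \<le> norm T"
proof -
  have lin: "linear (bop_apply T)" for T :: "'k bop"
    by (rule bounded_linear.linear[OF bounded_linear_bop_apply])
  have "\<exists>S. (\<forall>x y. cinner (bop_apply S x) y = cinner (bop_apply T (V x)) (V y)) \<and> norm S \<le> norm T" for T
  proof (rule sesquilinear_form_bop)
    show "cmod (cinner (bop_apply T (V x)) (V y)) \<le> norm T * norm x * norm y" for x y
    proof -
      have "cmod (cinner (bop_apply T (V x)) (V y)) \<le> norm (bop_apply T (V x)) * norm (V y)"
        by (rule cmod_cinner_le)
      also have "\<dots> \<le> norm T * norm (V x) * norm (V y)" by (intro mult_right_mono norm_bop_apply_le) simp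
      finally show ?thesis by (simp add: norm)
    qed
  qed (simp_all add: add sc linear_add[OF lin] bop_apply_scaleC cinner_add_left cinner_add_right
      cinner_scaleC_left cinner_scaleC_right)
  then have "\<forall>T. \<exists>S. (\<forall>x y. cinner (bop_apply S x) y = cinner (bop_apply T (V x)) (V y)) \<and> norm S \<le> norm T" by blast
  from choice[OF this] obtain \<Psi> where
    "\<forall>T. (\<forall>x y. cinner (bop_apply (\<Psi> T) x) y = cinner (bop_apply T (V x)) (V y)) \<and> norm (\<Psi> T) \<le> norm T" ..
  then show ?thesis by (intro that[of \<Psi>]) simp_all
qed

section \<open>Choice of the smearing function and of the isometry\<close>

context represented_system
begin

text \<open>As \<open>f\<close> has integral one, the difference is the weak mean of
  \<open>translation s v - v\<close> with weight \<open>f\<close>. Pairing it with itself bounds its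
  norm by \<open>c\<close> times the \<open>L^1\<close> norm of \<open>f\<close>.\<close>

lemma norm_convolution_diff_le:
  fixes v :: "('g, 'h) L2"
  assumes f: "f \<in> compactly_supported_continuous" and f1: "(LINT s|haar. f s) = 1" "(LINT s|haar. cmod (f s)) = 1"
    and near: "\<And>s. f s \<noteq> 0 \<Longrightarrow> norm (bop_apply (translation s) v - v) \<le> c"
  shows "norm (bop_apply (convolution_operator f) v - v) \<le> c"
proof -
  define w where "w = bop_apply (convolution_operator f) v - v"
  have int: "integrable haar (\<lambda>s. f s * cinner (bop_apply (translation s) v) w)" "integrable haar (\<lambda>s. f s * cinner v w)"
    by (rule csc_integrable[OF f]; intro continuous_cinner_left continuous_translation continuous_on_const)+
  have intf: "integrable haar f" using csc_integrable[OF f continuous_on_const[of UNIV 1]] by simp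
  have "\<exists>s. f s \<noteq> 0"
  proof (rule ccontr)
    assume "\<not> (\<exists>s. f s \<noteq> 0)"
    then have "f = (\<lambda>s. 0)" by auto
    then show False using f1(1) by simp
  qed
  then have c: "c \<ge> 0" using near norm_ge_zero order_trans by blast
  have "cinner w w = (LINT s|haar. f s * cinner (bop_apply (translation s) v) w) - (LINT s|haar. f s * cinner v w)"
    using intf f1(1) by (simp add: w_def[symmetric] cinner_diff_left[of _ v w, folded w_def]
        cinner_convolution_operator(1)[OF f, symmetric] flip: cinner_diff_left)
  also have "\<dots> = (LINT s|haar. f s * cinner (bop_apply (translation s) v - v) w)"
    using int by (simp add: cinner_diff_left right_diff_distrib)
  also have "cmod \<dots> \<le> (LINT s|haar. cmod (f s) * (c * norm w))"
  proof (rule norm_integral_le)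
    show "integrable haar (\<lambda>s. cmod (f s) * (c * norm w))"
      by (rule integrable_mult_left[OF csc_integrable_norm[OF f]])
    fix s
    have "cmod (cinner (bop_apply (translation s) v - v) w) \<le> c * norm w" if "f s \<noteq> 0"
      using cmod_cinner_le[of "bop_apply (translation s) v - v" w] mult_right_mono[OF near[OF that], of "norm w"] by simp
    then show "cmod (f s * cinner (bop_apply (translation s) v - v) w) \<le> cmod (f s) * (c * norm w)"
      by (cases "f s = 0") (auto simp: norm_mult intro: mult_left_mono)
  qed
  also have "\<dots> = c * norm w" using f1(2) by simp
  finally have "norm w * norm w \<le> c * norm w" by (simp add: cinner_self norm_mult power2_eq_square)
  then show ?thesis using c by (cases "norm w = 0") (auto simp: w_def[symmetric] mult_le_cancel_right)
qed

text \<open>\<open>V x\<close> is the tensor of \<open>x\<close> with the normalized indicator function of a small invariant compact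
  set \<open>M\<close>, and \<open>f\<close> is an approximate unit, invariant under the conjugation by \<open>g\<close>, with support so
  small that convolution by \<open>f\<close> almost fixes this indicator function. The invariance of \<open>M\<close> makes the
  estimate uniform along the orbits of \<open>\<alpha> g\<close>.\<close>

lemma approximate_factorization:
  assumes basis: "invariant_neighbourhood_basis g" and \<omega>: "finite \<omega>" and \<delta>: "\<delta> > 0"
  obtains f and V :: "'h \<Rightarrow> ('g, 'h) L2"
  where "f \<in> compactly_supported_continuous" "\<forall>s. cnj (f s) = f s" "(LINT s|haar. cmod (f s)) \<le> 1"
    "\<forall>s. f (g + s - g) = f s"
    "\<forall>x y. V (x + y) = V x + V y" "\<forall>c x. V (c *\<^sub>C x) = c *\<^sub>C V x" "\<forall>x. norm (V x) = norm x"
    "\<forall>a\<in>\<omega>. \<forall>i x y. cmod (cinner (bop_apply (compression f ((\<alpha> g ^^ i) a)) (V x)) (V y)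
      - cinner (bop_apply (\<pi> ((\<alpha> g ^^ i) a)) x) y) \<le> \<delta> * norm x * norm y"
proof -
  \<comment> \<open>The summand 1 keeps the divisor in \<open>\<eta>\<close> positive, for instance
    when \<open>\<omega>\<close> is empty.\<close>
  define C where "C = (\<Sum>a\<in>\<omega>. norm a) + 1"
  have C: "C \<ge> 1" by (simp add: C_def sum_nonneg)
  have aC: "norm a \<le> C" if "a \<in> \<omega>" for a
    using member_le_sum[OF that, of norm] \<omega> by (simp add: C_def)
  \<comment> \<open>Half of \<open>\<delta>\<close> pays for removing \<open>L\<close> from the two
    arguments, at a cost of \<open>\<eta> * C\<close> each. The other half pays for the oscillation
    of the orbit maps on \<open>U1\<close>.\<close>
  define \<eta> where "\<eta> = \<delta> / (4 * C)"
  have \<eta>: "\<eta> > 0" "2 * (\<eta> * C) = \<delta> / 2" using C \<delta> by (simp_all add: \<eta>_def)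
  define U1 where "U1 = (\<Inter>a\<in>\<omega>. {t. norm (\<alpha> (- t) a - a) < \<delta> / 2})"
  have "open {t. norm (\<alpha> (- t) a - a) < \<delta> / 2}" for a
    by (intro open_Collect_less continuous_intros continuous_on_compose2[OF alpha_continuous]) auto
  then have U1: "open U1" "0 \<in> U1" using \<omega> \<delta> by (auto simp: U1_def alpha_zero)
  obtain M where M: "compact M" "0 \<in> interior M" "M \<subseteq> U1" "invariant_under g M"
    using invariant_neighbourhood_basisE[OF basis U1] .
  have Ms: "M \<in> sets haar" "emeasure haar M < \<infinity>"
    using M(1) by (simp_all add: sets_haar_compact haar_compact_finite[simplified])
  define \<mu> where "\<mu> = measure haar M"
  have "emeasure haar (interior M) > 0" using M(2) by (intro haar_open_pos) auto
  then have "emeasure haar M > 0" using emeasure_mono[OF interior_subset Ms(1)] by (rule less_le_trans)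
  then have \<mu>: "\<mu> > 0" using Ms(2) by (simp add: \<mu>_def measure_def enn2real_positive_iff)
  define V where "V x = (1 / sqrt \<mu>) *\<^sub>R L2_indicator M x" for x :: 'h
  have Vadd: "V (x + y) = V x + V y" for x y
    by (simp add: V_def L2_indicator_add[OF Ms] scaleR_add_right)
  have Vsc: "V (c *\<^sub>C x) = c *\<^sub>C V x" for c x
    by (simp add: V_def L2_indicator_scaleC[OF Ms] scaleC_scaleR)
  have Vn: "norm (V x) = norm x" for x
  proof -
    have "(norm (V x))\<^sup>2 = (norm x)\<^sup>2"
      using \<mu> by (simp add: V_def power_mult_distrib power_divide norm_L2_indicator[OF Ms] flip: \<mu>_def)
    then show ?thesis by simp
  qed
  \<comment> \<open>The two differences add up to \<open>\<eta>\<^sup>2 * \<mu>\<close>, and the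
    normalization of \<open>V\<close> divides this by \<open>\<mu>\<close>.\<close>
  have "\<eta>\<^sup>2 * \<mu> / 2 > 0" using \<eta> \<mu> by simp
  from translation_measure_diff[OF M(1) this] obtain W where W: "open W" "0 \<in> W"
    "\<forall>w\<in>W. measure haar ((\<lambda>t. w + t) ` M - M) \<le> \<eta>\<^sup>2 * \<mu> / 2 \<and> measure haar (M - (\<lambda>t. w + t) ` M) \<le> \<eta>\<^sup>2 * \<mu> / 2"
    by blast
  have Vw: "norm (bop_apply (translation w) (V x) - V x) \<le> \<eta> * norm x" if w: "w \<in> W" for w x
  proof (rule power2_le_imp_le)
    have tM: "(\<lambda>t. w + t) ` M \<in> sets haar" "emeasure haar ((\<lambda>t. w + t) ` M) < \<infinity>"
      using Ms by (simp_all add: sets_haar_translation haar_left_invariant)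
    have "bop_apply (translation w) (V x) - V x = (1 / sqrt \<mu>) *\<^sub>R (L2_indicator ((\<lambda>t. w + t) ` M) x - L2_indicator M x)"
      by (simp add: V_def linear_scale[OF bounded_linear.linear[OF bounded_linear_bop_apply]]
          translation_L2_indicator[OF Ms] flip: scaleR_diff_right)
    then have "(norm (bop_apply (translation w) (V x) - V x))\<^sup>2
        = (measure haar ((\<lambda>t. w + t) ` M - M) + measure haar (M - (\<lambda>t. w + t) ` M)) * (norm x)\<^sup>2 / \<mu>"
      using \<mu> by (simp add: power_mult_distrib power_divide norm_L2_indicator_diff[OF tM Ms])
    also have "\<dots> \<le> (\<eta>\<^sup>2 * \<mu> / 2 + \<eta>\<^sup>2 * \<mu> / 2) * (norm x)\<^sup>2 / \<mu>"
      using W(3) w \<mu> by (intro divide_right_mono mult_right_mono add_mono) auto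
    also have "\<dots> = (\<eta> * norm x)\<^sup>2" using \<mu> by (simp add: power_mult_distrib)
    finally show "(norm (bop_apply (translation w) (V x) - V x))\<^sup>2 \<le> (\<eta> * norm x)\<^sup>2" .
  qed (use \<eta> in simp)
  obtain k :: "'g \<Rightarrow> real" and N where k: "continuous_on UNIV k" "\<forall>t. 0 \<le> k t"
      "\<forall>t. k (- t) = k t" "\<forall>t. k (g + t - g) = k t" "compact N" "N \<subseteq> W"
      "\<forall>t. t \<notin> N \<longrightarrow> k t = 0" "integral\<^sup>L haar k > 0"
    by (rule invariant_bump[OF basis W(1,2)]) (rule that)
  define f where "f s = complex_of_real (k s / integral\<^sup>L haar k)" for s
  have f: "f \<in> compactly_supported_continuous"
    unfolding compactly_supported_continuous_def f_def using k(1,5,7,8)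
    by (auto intro!: continuous_intros exI[of _ N])
  have kint: "(LINT s|haar. k s / integral\<^sup>L haar k) = 1" using k(8) by simp
  have f1: "(LINT s|haar. f s) = 1" using kint unfolding f_def integral_complex_of_real by simp
  have "cmod (f s) = k s / integral\<^sup>L haar k" for s
    unfolding f_def norm_of_real using k(2,8) by simp
  then have f2: "(LINT s|haar. cmod (f s)) = 1" using kint by presburger
  define L where "L = (convolution_operator f :: ('g, 'h) L2 bop)"
  have L: "norm L \<le> 1" using cinner_convolution_operator(2)[OF f] f2 unfolding L_def by metis
  have LV: "norm (bop_apply L (V x) - V x) \<le> \<eta> * norm x" for x
    unfolding L_def
  proof (rule norm_convolution_diff_le[OF f f1 f2])
    fix s assume "f s \<noteq> 0"
    then have "s \<in> W" using k(6,7) by (auto simp: f_def)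
    then show "norm (bop_apply (translation s) (V x) - V x) \<le> \<eta> * norm x" by (rule Vw)
  qed
  have LVn: "norm (bop_apply L (V x)) \<le> norm x" for x
    using order_trans[OF norm_bop_apply_le mult_right_mono[OF L norm_ge_zero], of "V x"] by (simp add: Vn)
  have est: "cmod (cinner (bop_apply (compression f (\<alpha> z a)) (V x)) (V y) - cinner (bop_apply (\<pi> (\<alpha> z a)) x) y)
      \<le> \<delta> * norm x * norm y" if a: "a \<in> \<omega>" and z: "z \<in> conjugators g" for a z x y
  proof -
    define R where "R = regular_rep \<pi> \<alpha> (\<alpha> z a)"
    have Rn: "norm (bop_apply R v) \<le> C * norm v" for v
      using order_trans[OF norm_bop_apply_le mult_right_mono, of R C v]
        norm_regular_rep_alpha_le[of z a] aC[OF a] by (simp add: R_def)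
    have eq: "cinner (bop_apply (compression f (\<alpha> z a)) (V x)) (V y) = cinner (bop_apply R (bop_apply L (V x))) (bop_apply L (V y))"
      by (simp add: compression_def times_bop.rep_eq cinner_star_bop' R_def flip: L_def)
    have "cinner (bop_apply R (bop_apply L (V x))) (bop_apply L (V y)) - cinner (bop_apply R (V x)) (V y)
        = cinner (bop_apply R (bop_apply L (V x) - V x)) (bop_apply L (V y))
          + cinner (bop_apply R (V x)) (bop_apply L (V y) - V y)"
      by (simp add: linear_diff[OF bounded_linear.linear[OF bounded_linear_bop_apply]] cinner_diff_left cinner_diff_right)
    also have "cmod \<dots> \<le> cmod (cinner (bop_apply R (bop_apply L (V x) - V x)) (bop_apply L (V y)))
          + cmod (cinner (bop_apply R (V x)) (bop_apply L (V y) - V y))" by (rule norm_triangle_ineq)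
    also have "\<dots> \<le> norm (bop_apply R (bop_apply L (V x) - V x)) * norm (bop_apply L (V y))
          + norm (bop_apply R (V x)) * norm (bop_apply L (V y) - V y)"
      by (intro add_mono cmod_cinner_le)
    also have "\<dots> \<le> (C * (\<eta> * norm x)) * norm y + (C * norm x) * (\<eta> * norm y)"
    proof (intro add_mono mult_mono LV LVn)
      show "norm (bop_apply R (bop_apply L (V x) - V x)) \<le> C * (\<eta> * norm x)"
        using C by (intro order_trans[OF Rn] mult_left_mono LV) simp
      show "norm (bop_apply R (V x)) \<le> C * norm x" using Rn[of "V x"] by (simp add: Vn)
    qed (use C \<eta> in auto)
    also have "\<dots> = (2 * (\<eta> * C)) * (norm x * norm y)" by (simp add: algebra_simps)
    also have "\<dots> = \<delta> / 2 * (norm x * norm y)" unfolding \<eta>(2) ..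
    finally have 1: "cmod (cinner (bop_apply R (bop_apply L (V x))) (bop_apply L (V y)) - cinner (bop_apply R (V x)) (V y))
        \<le> \<delta> / 2 * (norm x * norm y)" .
    define p where "p = cinner (bop_apply (\<pi> (\<alpha> z a)) x) y"
    \<comment> \<open>The coefficient of \<open>R\<close> at \<open>V x\<close> and
      \<open>V y\<close> is the mean of \<open>q\<close> over \<open>M\<close>, while
      \<open>p\<close> is the coefficient without the shift by \<open>- t\<close>. It remains to
      bound the distance from \<open>q t\<close> to \<open>p\<close> on \<open>M\<close>.\<close>
    define q where "q t = indicat_real M t *\<^sub>R cinner (bop_apply (\<pi> (\<alpha> (- t) (\<alpha> z a))) x) y" for t
    note SIx = square_integrable_indicator[OF Ms, of x] and SIy = square_integrable_indicator[OF Ms, of y]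
    have qeq: "cinner (bop_apply (\<pi> (\<alpha> (- t) (\<alpha> z a))) (indicat_real M t *\<^sub>R x)) (indicat_real M t *\<^sub>R y) = q t" for t
    proof (cases "t \<in> M")
      case False
      have "cinner v 0 = 0" for v :: 'h using cinner_add_right[of v 0 0] by simp
      then show ?thesis using False by (simp add: q_def)
    qed (simp add: q_def)
    have "cinner (bop_apply R (L2_indicator M x)) (L2_indicator M y) = (LINT t|haar. q t)"
      unfolding L2_indicator_def R_def regular_rep_abs_L2[OF SIx]
        cinner_abs_L2[OF square_integrable_regular_rep[OF SIx] SIy] qeq ..
    moreover have "cinner (bop_apply R (V x)) (V y) = cinner (bop_apply R (L2_indicator M x)) (L2_indicator M y) / \<mu>"
    proof -
      have "cinner (bop_apply R (V x)) (V y)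
          = complex_of_real (1 / sqrt \<mu>) * (complex_of_real (1 / sqrt \<mu>) * cinner (bop_apply R (L2_indicator M x)) (L2_indicator M y))"
        unfolding V_def scaleR_scaleC bop_apply_scaleC cinner_scaleC_left cinner_scaleC_right by simp
      also have "\<dots> = cinner (bop_apply R (L2_indicator M x)) (L2_indicator M y) / complex_of_real (sqrt \<mu> * sqrt \<mu>)"
        unfolding of_real_mult of_real_divide by (simp del: of_real_mult)
      also have "sqrt \<mu> * sqrt \<mu> = \<mu>" using \<mu> by simp
      finally show ?thesis .
    qed
    ultimately have RV: "cinner (bop_apply R (V x)) (V y) = (LINT t|haar. q t) / \<mu>" by simp
    have "integrable haar (\<lambda>t. cinner (bop_apply (\<pi> (\<alpha> (- t) (\<alpha> z a))) (indicat_real M t *\<^sub>R x)) (indicat_real M t *\<^sub>R y))"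
      by (rule integrable_cinner[OF square_integrable_regular_rep[OF SIx] SIy])
    then have qint: "integrable haar q" by (simp only: qeq)
    have indint: "integrable haar (\<lambda>t. indicat_real M t *\<^sub>R p)"
      using Ms by (intro integrable_scaleR_left) (simp add: integrable_real_indicator)
    have indval: "(LINT t|haar. indicat_real M t *\<^sub>R p) = \<mu> *\<^sub>R p"
      using Ms by (subst integral_scaleR_left) (auto simp: \<mu>_def integrable_real_indicator)
    have "cmod (LINT t|haar. q t - indicat_real M t *\<^sub>R p) \<le> \<delta> / 2 * (norm x * norm y) * \<mu>"
      unfolding \<mu>_def
    proof (rule norm_integral_le_compact[OF M(1)])
      fix t assume t: "t \<in> M"
      \<comment> \<open>Passing \<open>- t\<close> to the right of \<open>z\<close> turns it into
        \<open>- t'\<close>, and the invariance of \<open>M\<close> under \<open>z\<close> keeps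
        \<open>t'\<close> in \<open>M\<close>. So the oscillation of \<open>a\<close> itself is what
        matters, and the bound does not depend on \<open>z\<close>.\<close>
      define t' where "t' = - z + t + z"
      have "z + t' - z = t" by (simp add: t'_def group_add_assoc_simps del: add_uminus_conv_diff)
      then have "t' \<in> M" using conjugators_invariant[OF z M(1,4), of t'] t by simp
      then have "norm (\<alpha> (- t') a - a) \<le> \<delta> / 2" using M(3) a by (force simp: U1_def)
      moreover have "z + - t' = - t + z"
        by (simp add: t'_def group_add_assoc_simps del: add_uminus_conv_diff)
      then have "\<pi> (\<alpha> (- t) (\<alpha> z a)) - \<pi> (\<alpha> z a) = \<pi> (\<alpha> z (\<alpha> (- t') a - a))"
        by (simp only: alpha_diff pi_diff alpha_alpha)
      ultimately have n: "norm (\<pi> (\<alpha> (- t) (\<alpha> z a)) - \<pi> (\<alpha> z a)) \<le> \<delta> / 2"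
        using norm_pi_alpha_le[of z "\<alpha> (- t') a - a"] by simp
      have "q t - indicat_real M t *\<^sub>R p = cinner (bop_apply (\<pi> (\<alpha> (- t) (\<alpha> z a)) - \<pi> (\<alpha> z a)) x) y"
        using t by (simp add: q_def p_def minus_bop.rep_eq cinner_diff_left)
      also have "cmod \<dots> \<le> norm (bop_apply (\<pi> (\<alpha> (- t) (\<alpha> z a)) - \<pi> (\<alpha> z a)) x) * norm y" by (rule cmod_cinner_le)
      also have "\<dots> \<le> (norm (\<pi> (\<alpha> (- t) (\<alpha> z a)) - \<pi> (\<alpha> z a)) * norm x) * norm y"
        by (intro mult_right_mono norm_bop_apply_le) simp
      also have "\<dots> \<le> (\<delta> / 2 * norm x) * norm y" by (intro mult_right_mono n) auto
      finally show "cmod (q t - indicat_real M t *\<^sub>R p) \<le> \<delta> / 2 * (norm x * norm y)" by (simp add: mult.assoc)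
    qed (simp add: q_def)
    then have "cmod ((LINT t|haar. q t) - \<mu> *\<^sub>R p) \<le> \<delta> / 2 * (norm x * norm y) * \<mu>"
      using qint indint indval by simp
    moreover have "(LINT t|haar. q t) / \<mu> - p = ((LINT t|haar. q t) - \<mu> *\<^sub>R p) / \<mu>"
      using \<mu> by (simp add: scaleR_conv_of_real field_simps)
    ultimately have 2: "cmod (cinner (bop_apply R (V x)) (V y) - p) \<le> \<delta> / 2 * (norm x * norm y)"
      unfolding RV using \<mu> by (simp add: norm_divide pos_divide_le_eq)
    have "cmod (cinner (bop_apply R (bop_apply L (V x))) (bop_apply L (V y)) - p) \<le> \<delta> / 2 * (norm x * norm y) + \<delta> / 2 * (norm x * norm y)"
      by (rule norm_diff_triangle_le[OF 1 2])
    then show ?thesis unfolding eq p_def by (simp add: field_simps)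
  qed
  have "cmod (cinner (bop_apply (compression f ((\<alpha> g ^^ i) a)) (V x)) (V y)
      - cinner (bop_apply (\<pi> ((\<alpha> g ^^ i) a)) x) y) \<le> \<delta> * norm x * norm y" if "a \<in> \<omega>" for a i x y
  proof -
    obtain z where "z \<in> conjugators g" "(\<alpha> g ^^ i) a = \<alpha> z a" using alpha_funpow[of g i] by blast
    then show ?thesis using est[OF that, of z x y] by simp
  qed
  then show ?thesis
    using f f2 k(4) Vadd Vsc Vn by (intro that[of f V]) (auto simp: f_def)
qed

text \<open>The set \<open>\<omega>'\<close> is chosen before \<open>n\<close>, which the growth
  rate in \<open>n\<close> requires, and the matrix size \<open>m\<close> is unchanged. Given a
  factorization on the crossed product, the smearing map precedes it and the compression follows
  it.\<close>

lemma cp_approximable_transfer: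
  assumes basis: "invariant_neighbourhood_basis g" and \<omega>: "finite \<omega>" and \<delta>: "\<delta> > 0"
  obtains \<omega>' where "finite \<omega>'" "\<omega>' \<subseteq> reduced_crossed_product \<pi> \<alpha>"
    "\<forall>n m. cp_approximable (reduced_crossed_product \<pi> \<alpha>) (\<lambda>x. x) (\<Union>i<n. (Ad_translation g ^^ i) ` \<omega>') (\<delta> / 2) m
      \<longrightarrow> cp_approximable UNIV \<pi> (\<Union>i<n. (\<alpha> g ^^ i) ` \<omega>) \<delta> m"
proof -
  \<comment> \<open>The compression contributes at most \<open>\<delta> / 4\<close> and the given
    factorization less than \<open>\<delta> / 2\<close>, so the total stays strictly below
    \<open>\<delta>\<close>.\<close>
  have "\<delta> / 4 > 0" using \<delta> by simp
  then obtain f and V :: "'h \<Rightarrow> ('g, 'h) L2"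
  where f: "f \<in> compactly_supported_continuous" "\<forall>s. cnj (f s) = f s" "(LINT s|haar. cmod (f s)) \<le> 1"
    "\<forall>s. f (g + s - g) = f s"
    and V: "\<forall>x y. V (x + y) = V x + V y" "\<forall>c x. V (c *\<^sub>C x) = c *\<^sub>C V x" "\<forall>x. norm (V x) = norm x"
    and est: "\<forall>a\<in>\<omega>. \<forall>i x y. cmod (cinner (bop_apply (compression f ((\<alpha> g ^^ i) a)) (V x)) (V y)
      - cinner (bop_apply (\<pi> ((\<alpha> g ^^ i) a)) x) y) \<le> \<delta> / 4 * norm x * norm y"
    by (rule approximate_factorization[OF basis \<omega>]) (rule that)
  obtain \<Psi> where \<Psi>: "\<forall>T x y. cinner (bop_apply (\<Psi> T) x) y = cinner (bop_apply T (V x)) (V y)"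
    "\<forall>T. norm (\<Psi> T) \<le> norm T"
    by (rule ex_compression_map[of V]) (simp_all only: V that)
  have cnjf: "\<And>s. cnj (f s) = f s" using f(2) by simp
  show ?thesis
  proof (rule that[of "compression f ` \<omega>"])
    show "finite (compression f ` \<omega>)" using \<omega> by simp
    show "compression f ` \<omega> \<subseteq> reduced_crossed_product \<pi> \<alpha>"
      using compression_in_crossed_product[OF f(1) cnjf] by (auto simp: compression_def)
    show "\<forall>n m. cp_approximable (reduced_crossed_product \<pi> \<alpha>) (\<lambda>x. x) (\<Union>i<n. (Ad_translation g ^^ i) ` compression f ` \<omega>) (\<delta> / 2) m
      \<longrightarrow> cp_approximable UNIV \<pi> (\<Union>i<n. (\<alpha> g ^^ i) ` \<omega>) \<delta> m"
    proof (intro allI impI)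
      fix n m
      assume "cp_approximable (reduced_crossed_product \<pi> \<alpha>) (\<lambda>x. x) (\<Union>i<n. (Ad_translation g ^^ i) ` compression f ` \<omega>) (\<delta> / 2) m"
      then obtain \<phi> \<psi> where "cp_contraction_to_mat (reduced_crossed_product \<pi> \<alpha>) m \<phi> \<and>
          cp_contraction_from_mat m \<psi> \<and>
          (\<forall>b\<in>(\<Union>i<n. (Ad_translation g ^^ i) ` compression f ` \<omega>). norm (\<psi> (\<phi> b) - b) < \<delta> / 2)"
        unfolding cp_approximable_def by (elim exE) (rule that)
      then have \<phi>: "cp_contraction_to_mat (reduced_crossed_product \<pi> \<alpha>) m \<phi>"
        and \<psi>: "cp_contraction_from_mat m \<psi>"
        and appr: "\<forall>b\<in>(\<Union>i<n. (Ad_translation g ^^ i) ` compression f ` \<omega>). norm (\<psi> (\<phi> b) - b) < \<delta> / 2"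
        by - (elim conjE, assumption)+
      have "norm (\<Psi> (\<psi> (\<phi> (compression f b))) - \<pi> b) < \<delta>" if b: "b \<in> (\<Union>i<n. (\<alpha> g ^^ i) ` \<omega>)" for b
      proof -
        obtain i a where ia: "i < n" "a \<in> \<omega>" "b = (\<alpha> g ^^ i) a" using b by blast
        define D where "D = \<psi> (\<phi> (compression f b)) - compression f b"
        have "compression f b = (Ad_translation g ^^ i) (compression f a)"
          using f(4) by (simp add: ia(3) Ad_compression_funpow[OF f(1) basis])
        then have D: "norm D < \<delta> / 2" unfolding D_def using ia by (intro bspec[OF appr]) blast
        have "norm (\<Psi> (\<psi> (\<phi> (compression f b))) - \<pi> b) \<le> norm D + \<delta> / 4"
        proof (rule norm_bop_le_cinner)
          fix x y
          have "cinner (bop_apply (\<Psi> (\<psi> (\<phi> (compression f b))) - \<pi> b) x) y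
              = cinner (bop_apply D (V x)) (V y)
                + (cinner (bop_apply (compression f b) (V x)) (V y) - cinner (bop_apply (\<pi> b) x) y)"
            using \<Psi>(1) by (simp add: D_def minus_bop.rep_eq cinner_diff_left)
          also have "cmod \<dots> \<le> cmod (cinner (bop_apply D (V x)) (V y))
              + cmod (cinner (bop_apply (compression f b) (V x)) (V y) - cinner (bop_apply (\<pi> b) x) y)"
            by (rule norm_triangle_ineq)
          also have "\<dots> \<le> norm D * norm x * norm y + \<delta> / 4 * norm x * norm y"
          proof (rule add_mono)
            have "cmod (cinner (bop_apply D (V x)) (V y)) \<le> norm (bop_apply D (V x)) * norm (V y)"
              by (rule cmod_cinner_le)
            also have "\<dots> \<le> norm D * norm (V x) * norm (V y)" by (intro mult_right_mono norm_bop_apply_le) simp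
            finally show "cmod (cinner (bop_apply D (V x)) (V y)) \<le> norm D * norm x * norm y" using V(3) by simp
            show "cmod (cinner (bop_apply (compression f b) (V x)) (V y) - cinner (bop_apply (\<pi> b) x) y) \<le> \<delta> / 4 * norm x * norm y"
              unfolding ia(3) using est ia(2) by blast
          qed
          also have "\<dots> = (norm D + \<delta> / 4) * norm x * norm y" by (simp add: distrib_right)
          finally show "cmod (cinner (bop_apply (\<Psi> (\<psi> (\<phi> (compression f b))) - \<pi> b) x) y) \<le> (norm D + \<delta> / 4) * norm x * norm y" .
        qed (use \<delta> in simp)
        also have "\<dots> < \<delta>" using D \<delta> by simp
        finally show ?thesis .
      qed
      moreover have "cp_contraction_to_mat UNIV m (\<lambda>a. \<phi> (compression f a))"
        by (rule cp_contraction_to_mat_compression[OF f(1) cnjf f(3) \<phi>])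
      moreover have "cp_contraction_from_mat m (\<lambda>A. \<Psi> (\<psi> A))"
        by (rule cp_contraction_from_mat_compress[OF \<psi>, where V = V]) (simp_all add: \<Psi>)
      ultimately show "cp_approximable UNIV \<pi> (\<Union>i<n. (\<alpha> g ^^ i) ` \<omega>) \<delta> m"
        unfolding cp_approximable_def by (intro exI[of _ "\<lambda>a. \<phi> (compression f a)"] exI[of _ "\<lambda>A. \<Psi> (\<psi> A)"]) simp
    qed
  qed
qed

end

section \<open>Comparison of the entropies\<close>

lemma ln_enat_mono:
  assumes "a \<le> b"
  shows "ln_enat a \<le> ln_enat b"
proof (cases b)
  case (enat j)
  then obtain i where i: "a = enat i" "i \<le> j" using assms by (cases a) auto
  have "ln (real i) \<le> ln (real j)"
  \<comment> \<open>The value of \<open>ln\<close> at 0 is 0 by convention and \<open>ln\<close> is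
    nonnegative at positive integers, so monotonicity extends to 0.\<close>
  proof (cases "i = 0")
    case True
    then show ?thesis by (cases "j = 0") auto
  qed (use i in simp)
  then show ?thesis by (simp add: ln_enat_def enat i)
qed (simp add: ln_enat_def)

theorem theorem5p2:
  fixes \<alpha> :: "'g::locally_compact_group \<Rightarrow> 'a::cstar_algebra \<Rightarrow> 'a"
    and \<pi> :: "'a \<Rightarrow> 'h::complex_hilbert_space bop"
    and g :: 'g
  assumes exact: "exact_cstar_algebra TYPE('a) TYPE('x::complex_hilbert_space)"
    and system: "cstar_dynamical_system \<alpha>"
    and faithful: "faithful_representation \<pi>"
    and basis: "\<forall>U. open U \<and> 0 \<in> U \<longrightarrow>
      (\<exists>N. compact N \<and> 0 \<in> interior N \<and> N \<subseteq> U \<and> invariant_under g N)"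
  shows "topological_entropy UNIV \<pi> (\<alpha> g)
    \<le> topological_entropy (reduced_crossed_product \<pi> \<alpha>) (\<lambda>x. x) (Ad_translation g)"
proof -
  interpret represented_system \<alpha> \<pi>
    using system faithful by unfold_locales (simp_all add: faithful_representation_def)
  have inb: "invariant_neighbourhood_basis g"
    using basis by (simp add: invariant_neighbourhood_basis_def)
  show ?thesis
    unfolding topological_entropy_def[of UNIV]
  proof (intro SUP_least)
    fix \<omega> :: "'a set" and \<delta> :: real
    assume "\<omega> \<in> {\<omega>. finite \<omega> \<and> \<omega> \<subseteq> UNIV}" and "\<delta> \<in> {0<..}"
    then have \<omega>: "finite \<omega>" and \<delta>: "\<delta> > 0" by auto
    obtain \<omega>' where \<omega>': "finite \<omega>'" "\<omega>' \<subseteq> reduced_crossed_product \<pi> \<alpha>"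
      and transfer: "\<forall>n m. cp_approximable (reduced_crossed_product \<pi> \<alpha>) (\<lambda>x. x) (\<Union>i<n. (Ad_translation g ^^ i) ` \<omega>') (\<delta> / 2) m
        \<longrightarrow> cp_approximable UNIV \<pi> (\<Union>i<n. (\<alpha> g ^^ i) ` \<omega>) \<delta> m"
      by (rule cp_approximable_transfer[OF inb \<omega> \<delta>])
    let ?r = "\<lambda>n. rcp (reduced_crossed_product \<pi> \<alpha>) (\<lambda>x. x) (\<Union>i<n. (Ad_translation g ^^ i) ` \<omega>') (\<delta> / 2)"
    have "rcp UNIV \<pi> (\<Union>i<n. (\<alpha> g ^^ i) ` \<omega>) \<delta> \<le> ?r n" for n
      \<comment> \<open>Every matrix size admissible in the crossed product is admissible in the
        algebra, so the infimum there is over a larger set.\<close>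
      unfolding rcp_def using transfer by (intro Inf_superset_mono) blast
    then have "limsup (\<lambda>n. ereal (1 / real n) * ln_enat (rcp UNIV \<pi> (\<Union>i<n. (\<alpha> g ^^ i) ` \<omega>) \<delta>))
        \<le> limsup (\<lambda>n. ereal (1 / real n) * ln_enat (?r n))"
      by (intro Limsup_mono always_eventually allI ereal_mult_left_mono ln_enat_mono) auto
    also have "\<dots> \<le> topological_entropy (reduced_crossed_product \<pi> \<alpha>) (\<lambda>x. x) (Ad_translation g)"
      unfolding topological_entropy_def
      \<comment> \<open>Halving the tolerance is harmless, as the entropy is a supremum over all
        positive tolerances.\<close>
      by (rule SUP_upper2[of \<omega>'], use \<omega>' in simp, rule SUP_upper2[of "\<delta> / 2"], use \<delta> in simp, rule order_refl)
    finally show "limsup (\<lambda>n. ereal (1 / real n) * ln_enat (rcp UNIV \<pi> (\<Union>i<n. (\<alpha> g ^^ i) ` \<omega>) \<delta>))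
        \<le> topological_entropy (reduced_crossed_product \<pi> \<alpha>) (\<lambda>x. x) (Ad_translation g)" .
  qed
qed

end
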